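(* Let $s\in\mathbb{C}$ with $-1<\operatorname{Re}s<1$. For $x>0$ let \begin{align*} f(x,s):={}&\frac{x^{s/2}\zeta(1+s)}{2\sin\left(\frac12\pi s\right)}+\frac{x^{2-s/2}}{\pi\cos\left(\frac12\pi s\right)}\sum_{n=1}^{\infty}\sigma_{-s}(n)\left(\frac{n^{s-1}-x^{s-1}}{n^2-x^2}\right)\\ &-2^{-s}\pi^{-1-s}x^{-s/2}\left\{\Gamma(s)\zeta(s)\left(\pi\tan\left(\frac{\pi s}{2}\right)-2(\gamma+\log x)\right)-\frac{(2\pi)^s\zeta'(1-s)}{\cos\left(\frac12\pi s\right)}\right\}. \end{align*} Then, for $\alpha,\beta>0$ with $\alpha\beta=1$, \begin{align*} &\sqrt\alpha\int_0^{\infty}K_{s/2}(2\pi\alpha x)f(x,s)\,dx=\sqrt\beta\int_0^{\infty}K_{s/2}(2\pi\beta x)f(x,s)\,dx\\ &=\frac{1}{4\pi^3}\int_0^{\infty}\Gamma\left(\frac{s-1+it}{4}\right)\Gamma\left(\frac{s-1-it}{4}\right)\Gamma\left(\frac{-s+1+it}{4}\right)\Gamma\left(\frac{-s+1-it}{4}\right)\\ &\qquad\times\Xi\left(\frac{t-is}{2}\right)\Xi\left(\frac{t+is}{2}\right)\frac{\cos\left(\frac12 t\log\alpha\right)}{t^2+(s+1)^2}\,dt. \end{align*}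
   Context: $\sigma_s(n)=\sum_{d\mid n}d^s$; $\zeta$ is the Riemann zeta function; $\gamma$ is Euler's constant; $K_\nu$ is the modified Bessel function of the second kind. $\xi(s)=\frac12s(s-1)\pi^{-s/2}\Gamma(\frac12s)\zeta(s)$ and $\Xi(t)=\xi(\frac12+it)$. When $x$ is a positive integer $m$, the term $n=m$ uses $\lim_{x\to m}\frac{m^{s-1}-x^{s-1}}{m^2-x^2}=\frac{s-1}{2}m^{s-3}$. At $s=0$, $f(x,s)$ is understood as its limit as $s\to0$. *)

theory Defs
  imports "HOL-Complex_Analysis.Complex_Analysis"
begin

text \<open>
  The Riemann zeta function as the analytic continuation of its Dirichlet series to the complex
  plane without the point \<open>1\<close>. These two conditions determine it everywhere except at the pole
  \<open>1\<close>, where its value is left unspecified.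
\<close>

definition riemann_zeta :: "complex \<Rightarrow> complex" where
  "riemann_zeta = (SOME f. f holomorphic_on (- {1}) \<and>
     (\<forall>s. Re s > 1 \<longrightarrow> (\<lambda>n. 1 / of_nat (Suc n) powr s) sums f s))"

definition divisor_sigma :: "complex \<Rightarrow> nat \<Rightarrow> complex" where
  "divisor_sigma s n = (\<Sum>d | d dvd n. of_nat d powr s)"

text \<open>
  Modified Bessel functions of the first and second kind, for \<open>z \<noteq> 0\<close> and with principal
  branches. The reciprocal Gamma function \<open>rGamma\<close> is entire, so the terms of \<open>bessel_I\<close> are
  also correct at negative integer orders. At an integer order, \<open>bessel_K\<close> is the limit of the
  quotient in the order.
\<close>

definition bessel_I :: "complex \<Rightarrow> complex \<Rightarrow> complex" where
  "bessel_I \<nu> z = (\<Sum>k. (z / 2) powr (\<nu> + 2 * of_nat k) * rGamma (\<nu> + of_nat k + 1) / fact k)"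

definition bessel_K_quotient :: "complex \<Rightarrow> complex \<Rightarrow> complex" where
  "bessel_K_quotient \<nu> z = of_real pi / 2 * (bessel_I (- \<nu>) z - bessel_I \<nu> z) / sin (\<nu> * of_real pi)"

definition bessel_K :: "complex \<Rightarrow> complex \<Rightarrow> complex" where
  "bessel_K \<nu> z =
     (if \<nu> \<in> \<int> then Lim (at \<nu>) (\<lambda>\<mu>. bessel_K_quotient \<mu> z) else bessel_K_quotient \<nu> z)"

text \<open>
  The formula for \<open>\<xi>\<close> is taken literally. Its removable singularities (at \<open>1\<close> and the
  nonpositive even integers) are not filled in. They lie outside the strip \<open>0 < Re w < 1\<close>.
\<close>

definition riemann_xi :: "complex \<Rightarrow> complex" where
  "riemann_xi w = 1 / 2 * w * (w - 1) * of_real pi powr (- w / 2) * Gamma (w / 2) * riemann_zeta w"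

definition riemann_Xi :: "complex \<Rightarrow> complex" where
  "riemann_Xi t = riemann_xi (1 / 2 + \<i> * t)"

text \<open>The quotient \<open>(n\<^sup>s\<^sup>-\<^sup>1 - x\<^sup>s\<^sup>-\<^sup>1) / (n\<^sup>2 - x\<^sup>2)\<close>, continued to \<open>x = n\<close> by its limit.\<close>

definition power_quotient :: "real \<Rightarrow> complex \<Rightarrow> nat \<Rightarrow> complex" where
  "power_quotient x s n =
     (if x = real n then (s - 1) / 2 * of_nat n powr (s - 3)
      else (of_nat n powr (s - 1) - of_real x powr (s - 1)) / of_real ((real n)\<^sup>2 - x\<^sup>2))"

definition f_formula :: "real \<Rightarrow> complex \<Rightarrow> complex" where
  "f_formula x s =
     of_real x powr (s / 2) * riemann_zeta (1 + s) / (2 * sin (of_real pi * s / 2))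
   + of_real x powr (2 - s / 2) / (of_real pi * cos (of_real pi * s / 2))
       * (\<Sum>n. divisor_sigma (- s) (Suc n) * power_quotient x s (Suc n))
   - 2 powr (- s) * of_real pi powr (- 1 - s) * of_real x powr (- s / 2)
       * (Gamma s * riemann_zeta s
            * (of_real pi * tan (of_real pi * s / 2) - 2 * (euler_mascheroni + of_real (ln x)))
          - of_real (2 * pi) powr s * deriv riemann_zeta (1 - s) / cos (of_real pi * s / 2))"

definition f_kernel :: "real \<Rightarrow> complex \<Rightarrow> complex" where
  "f_kernel x s = (if s = 0 then Lim (at 0) (f_formula x) else f_formula x s)"

end

theory Submission
  imports Defs
begin

text \<open>
  With \<open>w = 1/2 + it\<close>, the function \<open>f(x, s)\<close> is the inverse Mellin transform
  \<open>1/(4\<pi>) \<integral> \<zeta>(w + s/2) \<zeta>(w - s/2) x\<^sup>w\<^sup>-\<^sup>1 / (cos (\<pi>(w + s/2)/2) sin (\<pi>(w - s/2)/2)) dt\<close>.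
  Indeed, on a line to the right of \<open>w = 1 + s/2\<close> and of \<open>w = 1 - s/2\<close> the product of the zeta functions
  is a Dirichlet series in \<open>\<sigma>\<^sub>-\<^sub>s(n)\<close>, which integrates termwise to the sum in \<open>f\<close>; moving the line back to
  \<open>Re w = 1/2\<close> crosses a simple pole at \<open>1 + s/2\<close> and a double pole at \<open>1 - s/2\<close>, whose residues give the
  other two terms. This formula is also continuous at \<open>s = 0\<close>. Integrating against \<open>K\<^sub>s\<^sub>/\<^sub>2(2\<pi>\<alpha>x)\<close>, whose Mellin
  transform is a product of two Gamma functions, turns the integrand into a product of two completed zeta
  functions and the trigonometric factor, which is even in \<open>t\<close> by the functional equation; hence only \<open>cos (t log \<alpha>)\<close>
  survives, and this is symmetric under \<open>\<alpha> \<mapsto> 1/\<alpha>\<close>. The reflection formula for Gamma rewrites the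
  trigonometric factor as the four Gamma factors.

  The functional equation itself comes from comparing two Mellin integrals over \<open>-1 < Re s < 0\<close>: one from the trapezoidal
  remainders of the Dirichlet series, the other from the partial fractions of coth.
\<close>

section \<open>Integrals over the half-line in the exponential variable\<close>

text \<open>Definitions by choice and by limit shape the work. \<open>riemann_zeta\<close> is a
  \<open>SOME\<close>, so a continuation to the whole punctured plane has to be built before
  anything is known of it; the functional equation is what reaches Re s <= -1.
  \<open>bessel_K\<close> is a quotient of power series, while its Mellin transform calls for an
  integral; the bridge cuts that integral at v = 0, because expanding the kernel over the whole line
  gives divergent terms. \<open>f_kernel\<close> at s = 0 is a \<open>Lim\<close> of an expression
  with singular terms, but on Re w = 1/2 the contour integral does not see the collision of the two
  poles. Mellin integrals run over the real line in u = ln x: scaling becomes translation. Absolute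
  convergence is mostly free: the norm of an integrand is often the same integrand at the real parts
  of its parameters, so one formula is both value and majorant. Contours are shifted under a decay
  of exp (- |t|), which the kernel's exp (- pi |t|) still yields after paying for the polynomial
  growth of the zeta factors.\<close>

lemma absolutely_integrable_complex_iff_Re_Im:
  fixes f :: "real \<Rightarrow> complex"
  shows "f absolutely_integrable_on S \<longleftrightarrow>
    (\<lambda>x. Re (f x)) absolutely_integrable_on S \<and> (\<lambda>x. Im (f x)) absolutely_integrable_on S"
proof
  assume "f absolutely_integrable_on S"
  then show "(\<lambda>x. Re (f x)) absolutely_integrable_on S \<and> (\<lambda>x. Im (f x)) absolutely_integrable_on S"
    using absolutely_integrable_linear[where f=f and h=Re] absolutely_integrable_linear[where f=f and h=Im]
    by (simp add: o_def bounded_linear_Re bounded_linear_Im)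
next
  assume *: "(\<lambda>x. Re (f x)) absolutely_integrable_on S \<and> (\<lambda>x. Im (f x)) absolutely_integrable_on S"
  have "(\<lambda>x. of_real (Re (f x)) :: complex) absolutely_integrable_on S"
    using absolutely_integrable_linear[where f="\<lambda>x. Re (f x)" and h="of_real :: real \<Rightarrow> complex"] * by (simp add: o_def bounded_linear_of_real)
  moreover have "(\<lambda>x. \<i> * of_real (Im (f x)) :: complex) absolutely_integrable_on S"
    using absolutely_integrable_linear[where f="\<lambda>x. Im (f x)" and h="\<lambda>x. \<i> * of_real x"] *
    by (simp add: o_def bounded_linear_of_real bounded_linear_const_mult)
  ultimately have "(\<lambda>x. of_real (Re (f x)) + \<i> * of_real (Im (f x))) absolutely_integrable_on S"
    by (rule set_integral_add)
  then show "f absolutely_integrable_on S" by (simp add: complex_eq[symmetric])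
qed

text \<open>The change of variables is applied to real and imaginary parts. Integrability has to
  transfer in both directions, hence the equivalence.\<close>

lemma absolutely_integrable_exp_substitution:
  fixes f :: "real \<Rightarrow> complex"
  shows "(\<lambda>u. exp u *\<^sub>R f (exp u)) absolutely_integrable_on UNIV \<and>
           integral UNIV (\<lambda>u. exp u *\<^sub>R f (exp u)) = I
         \<longleftrightarrow> f absolutely_integrable_on {0<..} \<and> integral {0<..} f = I"
proof -
  have img: "exp ` (UNIV :: real set) = {0<..}"
    by (metis exp_gt_zero exp_ln greaterThan_iff image_eqI range_eqI subsetI subset_antisym image_subsetI)
  have *: "(\<lambda>u. exp u * g (exp u)) absolutely_integrable_on UNIV \<and>
           integral UNIV (\<lambda>u. exp u * g (exp u)) = b
         \<longleftrightarrow> g absolutely_integrable_on {0<..} \<and> integral {0<..} g = b" for g :: "real \<Rightarrow> real" and b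
    using has_absolute_integral_change_of_variables_1'[of UNIV exp exp g b]
    by (simp add: img inj_on_def DERIV_exp)
  have ReIm: "integral S h = Complex (integral S (\<lambda>x. Re (h x))) (integral S (\<lambda>x. Im (h x)))"
    if "h absolutely_integrable_on S" for h :: "real \<Rightarrow> complex" and S
    using that integral_linear[where f=h and h=Re] integral_linear[where f=h and h=Im]
    by (simp add: complex_eq_iff absolutely_integrable_on_def o_def bounded_linear_Re bounded_linear_Im)
  let ?g = "\<lambda>u. exp u *\<^sub>R f (exp u)"
  have iff: "?g absolutely_integrable_on UNIV \<longleftrightarrow> f absolutely_integrable_on {0<..}"
    unfolding absolutely_integrable_complex_iff_Re_Im
    using *[of "\<lambda>x. Re (f x)"] *[of "\<lambda>x. Im (f x)"] by auto
  have "integral UNIV ?g = integral {0<..} f" if "f absolutely_integrable_on {0<..}"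
  proof -
    have "?g absolutely_integrable_on UNIV" using iff that by blast
    then show ?thesis
      using *[of "\<lambda>x. Re (f x)"] *[of "\<lambda>x. Im (f x)"] ReIm[OF that] ReIm[of UNIV ?g] that
      unfolding absolutely_integrable_complex_iff_Re_Im by auto
  qed
  with iff show ?thesis by auto
qed

text \<open>Bridges two kinds of integral: Fubini and termwise integration are used for Bochner
  integrals over \<open>lborel\<close>, whereas Euler's integral for Gamma and the final statement
  are gauge integrals on {0<..}.\<close>

lemma has_bochner_integral_exp_substitution:
  fixes f :: "real \<Rightarrow> complex"
  assumes [measurable]: "(\<lambda>u. exp u *\<^sub>R f (exp u)) \<in> borel_measurable borel"
  shows "has_bochner_integral lborel (\<lambda>u. exp u *\<^sub>R f (exp u)) I \<longleftrightarrow>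
    f absolutely_integrable_on {0<..} \<and> integral {0<..} f = I"
proof -
  have 1: "has_bochner_integral lborel g J \<longleftrightarrow> g absolutely_integrable_on UNIV \<and> integral UNIV g = J"
    if [measurable]: "g \<in> borel_measurable borel" for g :: "real \<Rightarrow> complex" and J
  proof -
    have "integrable lborel g \<longleftrightarrow> g absolutely_integrable_on UNIV"
      by (simp add: set_integrable_def integrable_completion)
    moreover have "integral\<^sup>L lborel g = integral UNIV g" if "g absolutely_integrable_on UNIV"
      using set_lebesgue_integral_eq_integral(2)[OF that]
      by (simp add: set_lebesgue_integral_def integral_completion)
    ultimately show ?thesis by (auto simp: has_bochner_integral_iff)
  qed
  show ?thesis by (simp add: 1 absolutely_integrable_exp_substitution)
qed

lemma has_bochner_integral_translate:
  fixes f :: "real \<Rightarrow> complex"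
  shows "has_bochner_integral lborel (\<lambda>u. f (t + u)) I \<longleftrightarrow> has_bochner_integral lborel f I"
  using lborel_has_bochner_integral_real_affine_iff[of 1 f I t] by simp

text \<open>Euler's integral after t = exp u; the factor a becomes a translation of u by
  \<open>ln a\<close>. The Mellin integrals below take their Gamma factors from here.\<close>

lemma has_bochner_integral_Gamma_exp:
  assumes z: "Re z > 0" and a: "a > 0"
  shows "has_bochner_integral lborel (\<lambda>u. exp (z * of_real u - of_real (a * exp u)))
           (Gamma z * exp (- z * of_real (ln a)))"
proof -
  have eq: "exp u *\<^sub>R (of_real (exp u) powr (z - 1) / of_real (exp (exp u))) = exp (z * of_real u - of_real (exp u))"
    for u :: real
    by (simp add: powr_def scaleR_conv_of_real Ln_of_real exp_diff left_diff_distrib flip: exp_of_real)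
  have "has_bochner_integral lborel (\<lambda>u. exp u *\<^sub>R (of_real (exp u) powr (z - 1) / of_real (exp (exp u)))) (Gamma z)"
    by (subst has_bochner_integral_exp_substitution)
      (auto simp: eq intro!: borel_measurable_continuous_onI continuous_intros
        absolutely_integrable_Gamma_integral'[OF z] integral_unique Gamma_integral_complex'[OF z])
  then have 1: "has_bochner_integral lborel (\<lambda>u. exp (z * of_real u - of_real (exp u))) (Gamma z)"
    by (simp only: eq)
  have "has_bochner_integral lborel (\<lambda>u. exp (z * of_real (ln a + u) - of_real (exp (ln a + u)))) (Gamma z)"
    using 1 by (subst has_bochner_integral_translate[of "\<lambda>u. exp (z * of_real u - of_real (exp u))"])
  then have "has_bochner_integral lborel
      (\<lambda>u. exp (z * of_real (ln a + u) - of_real (exp (ln a + u))) * exp (- z * of_real (ln a)))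
      (Gamma z * exp (- z * of_real (ln a)))"
    by (rule has_bochner_integral_mult_left)
  also have "(\<lambda>u. exp (z * of_real (ln a + u) - of_real (exp (ln a + u))) * exp (- z * of_real (ln a)))
     = (\<lambda>u. exp (z * of_real u - of_real (a * exp u)))"
    using a by (simp add: fun_eq_iff exp_add[symmetric] exp_add algebra_simps flip: exp_add)
      (simp add: exp_add mult.commute)
  finally show ?thesis .
qed

text \<open>Inner integrals are asked for at every point, since closed forms are available
  pointwise; the integral of the norm is a separate function \<open>n\<close>, which expresses
  Tonelli's condition.\<close>

lemma has_bochner_integral_fubini:
  fixes f :: "real \<Rightarrow> real \<Rightarrow> complex"
  assumes meas: "(\<lambda>p. f (fst p) (snd p)) \<in> borel_measurable borel"
    and g: "\<And>x. has_bochner_integral lborel (\<lambda>y. f x y) (g x)"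
    and n: "\<And>x. has_bochner_integral lborel (\<lambda>y. norm (f x y)) (n x)"
    and N: "integrable lborel n"
    and h: "\<And>y. has_bochner_integral lborel (\<lambda>x. f x y) (h y)"
  shows "integrable lborel g" "has_bochner_integral lborel h (integral\<^sup>L lborel g)"
proof -
  have m: "case_prod f \<in> borel_measurable (lborel \<Otimes>\<^sub>M lborel)"
    using meas by (simp add: case_prod_unfold borel_prod[symmetric] cong: measurable_cong_sets)
  have g': "g = (\<lambda>x. \<integral>y. f x y \<partial>lborel)" and h': "h = (\<lambda>y. \<integral>x. f x y \<partial>lborel)"
    and n': "n = (\<lambda>x. \<integral>y. norm (f x y) \<partial>lborel)"
    using g h n by (simp_all add: has_bochner_integral_iff fun_eq_iff)
  have int: "integrable (lborel \<Otimes>\<^sub>M lborel) (case_prod f)"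
    by (rule lborel_pair.Fubini_integrable[OF m])
      (use N g in \<open>auto simp: n' has_bochner_integral_iff\<close>)
  show gi: "integrable lborel g"
    unfolding g' by (rule lborel_pair.integrable_fst[OF int])
  have "integrable lborel h"
    unfolding h' by (rule lborel_pair.integrable_snd[OF int])
  moreover have "integral\<^sup>L lborel h = integral\<^sup>L lborel g"
    unfolding g' h' by (rule lborel_pair.Fubini_integral[OF int])
  ultimately show "has_bochner_integral lborel h (integral\<^sup>L lborel g)"
    by (simp add: has_bochner_integral_iff)
qed

lemma has_bochner_integral_absolutely_integrable:
  fixes f :: "real \<Rightarrow> 'a::euclidean_space"
  assumes f: "f absolutely_integrable_on S"
    and [measurable]: "(\<lambda>x. indicator S x *\<^sub>R f x) \<in> borel_measurable borel"
  shows "has_bochner_integral lborel (\<lambda>x. indicator S x *\<^sub>R f x) (integral S f)"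
  using f set_lebesgue_integral_eq_integral(2)[OF f]
  by (simp add: has_bochner_integral_iff set_integrable_def set_lebesgue_integral_def integrable_completion
      integral_completion)

text \<open>Repeated integration by parts against the Peano kernel u (1 - u) / 2, which vanishes at
  both ends: the right side is s - 1 times the error of the trapezoidal rule for x powr (- s) on
  [a, a + 1]. The case a = 0 serves the functional equation, which needs the interval [0, 1] as
  well; there \<open>0 powr z = 0\<close> is the true limit because Re s < 0.\<close>

lemma trapezoid_powr:
  fixes a :: real and s :: complex
  assumes "a > 0 \<or> (a = 0 \<and> Re s < 0)"
  shows "((\<lambda>u. (s - 1) * s * (s + 1) * (of_real (u * (1 - u) / 2) * of_real (a + u) powr (- s - 2)))
     has_integral ((s - 1) / 2 * (of_real a powr (- s) + of_real (a + 1) powr (- s))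
        + of_real (a + 1) powr (1 - s) - of_real a powr (1 - s))) {0..1}"
proof -
  define g where "g u = of_real (a + u) powr (1 - s)" for u :: real
  define g' where "g' u = (1 - s) * of_real (a + u) powr (- s)" for u :: real
  \<comment> \<open>At a = 0 the power u powr (- s - 1) may blow up, but times u it is u powr (- s),
    continuous at 0 for Re s < 0. The merged form keeps \<open>F\<close> continuous on the closed
    interval; its derivative is needed inside only.\<close>
  define k where "k u = - s * (1 - s) * (of_real (1 - u) / 2 * (if a = 0 then of_real u powr (- s) else of_real u * of_real (a + u) powr (- s - 1)))" for u :: real
  define k' where "k' u = - s * (1 - s) * of_real (a + u) powr (- s - 1)" for u :: real
  define F where "F u = - k u + of_real ((1 - 2 * u) / 2) * g' u + g u" for u :: real
  have "((\<lambda>u. (s - 1) * s * (s + 1) * (of_real (u * (1 - u) / 2) * of_real (a + u) powr (- s - 2)))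
     has_integral (F 1 - F 0)) {0..1}"
  proof (rule fundamental_theorem_of_calculus_interior)
    show "continuous_on {0..1} F"
    proof (cases "a = 0")
      case True
      then show ?thesis using assms unfolding F_def k_def g'_def g_def
        by (auto intro!: continuous_intros)
    next
      case False
      then show ?thesis using assms unfolding F_def k_def g'_def g_def
        by (auto intro!: continuous_intros simp: complex_eq_iff)
    qed
    fix x :: real assume x: "x \<in> {0<..<1}"
    have ax: "a + x > 0" using x assms by auto
    have k_eq: "k u = of_real (u * (1 - u) / 2) * k' u" if u: "u > 0" for u
    proof (cases "a = 0")
      case True
      have "of_real u powr (- s) = of_real u * (of_real u powr (- s - 1) :: complex)"
        using u by (simp add: powr_diff)
      then show ?thesis using True by (simp add: k_def k'_def)
    qed (simp add: k_def k'_def)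
    define A X :: complex where "A = of_real a" and "X = of_real x"
    have pw: "((\<lambda>w. (A + w) powr z) has_field_derivative z * (A + X) powr (z - 1)) (at X)" for z
      using ax by (auto intro!: derivative_eq_intros simp: complex_nonpos_Reals_iff A_def X_def simp flip: of_real_add)
    have p1: "((\<lambda>w. w * (1 - w) / 2) has_field_derivative (1 - 2 * X) / 2) (at X)"
      by (auto intro!: derivative_eq_intros)
    have p2: "((\<lambda>w. (1 - 2 * w) / 2) has_field_derivative - 1) (at X)"
      by (auto intro!: derivative_eq_intros)
    have "((\<lambda>w. - (w * (1 - w) / 2 * (- s * (1 - s) * (A + w) powr (- s - 1))) + (1 - 2 * w) / 2 * ((1 - s) * (A + w) powr (- s))
        + (A + w) powr (1 - s)) has_field_derivative
        (s - 1) * s * (s + 1) * (X * (1 - X) / 2 * (A + X) powr (- s - 2))) (at X)"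
    proof (rule DERIV_cong)
      show "((\<lambda>w. - (w * (1 - w) / 2 * (- s * (1 - s) * (A + w) powr (- s - 1))) + (1 - 2 * w) / 2 * ((1 - s) * (A + w) powr (- s))
        + (A + w) powr (1 - s)) has_field_derivative
         - ((X * (1 - X) / 2) * (- s * (1 - s) * ((- s - 1) * (A + X) powr (- s - 1 - 1))) + (1 - 2 * X) / 2 * (- s * (1 - s) * (A + X) powr (- s - 1)))
         + ((1 - 2 * X) / 2 * ((1 - s) * (- s * (A + X) powr (- s - 1))) + - 1 * ((1 - s) * (A + X) powr (- s)))
         + (1 - s) * (A + X) powr (1 - s - 1)) (at X)"
        by (intro DERIV_add DERIV_minus DERIV_mult' DERIV_cmult p1 p2 pw)
      have alg: "- (h * (- s * (1 - s) * ((- s - 1) * P2)) + m * (- s * (1 - s) * P1)) + (m * ((1 - s) * (- s * P1)) + - 1 * ((1 - s) * P0))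
         + (1 - s) * P0 = (s - 1) * s * (s + 1) * (h * P2)" for h m P0 P1 P2
        by (simp add: algebra_simps)
      have e: "- s - 1 - 1 = - s - 2" "1 - s - 1 = - s" by simp_all
      show "- ((X * (1 - X) / 2) * (- s * (1 - s) * ((- s - 1) * (A + X) powr (- s - 1 - 1))) + (1 - 2 * X) / 2 * (- s * (1 - s) * (A + X) powr (- s - 1)))
         + ((1 - 2 * X) / 2 * ((1 - s) * (- s * (A + X) powr (- s - 1))) + - 1 * ((1 - s) * (A + X) powr (- s)))
         + (1 - s) * (A + X) powr (1 - s - 1) = (s - 1) * s * (s + 1) * (X * (1 - X) / 2 * (A + X) powr (- s - 2))"
        unfolding e by (rule alg)
    qed
    from has_vector_derivative_real_field[OF this[unfolded X_def]]
    have "((\<lambda>u. - (of_real (u * (1 - u) / 2) * k' u) + of_real ((1 - 2 * u) / 2) * g' u + g u) has_vector_derivative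
        (s - 1) * s * (s + 1) * (of_real (x * (1 - x) / 2) * of_real (a + x) powr (- s - 2))) (at x)"
      by (simp add: k'_def g'_def g_def A_def)
    then show "(F has_vector_derivative (s - 1) * s * (s + 1) * (of_real (x * (1 - x) / 2) * of_real (a + x) powr (- s - 2))) (at x)"
      by (rule has_vector_derivative_transform_within_open[where S = "{0<..<1}"])
        (use x in \<open>auto simp: F_def k_eq\<close>)
  qed simp
  also have "F 1 - F 0 = (s - 1) / 2 * (of_real a powr (- s) + of_real (a + 1) powr (- s))
        + of_real (a + 1) powr (1 - s) - of_real a powr (1 - s)"
  proof -
    have "k 1 = 0" "k 0 = 0" by (simp_all add: k_def)
    moreover have "- 1 / 2 * ((1 - s) * P) + Q - (1 / 2 * ((1 - s) * P') + Q') = (s - 1) / 2 * (P' + P) + Q - Q'" for P Q P' Q'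
      by (simp add: field_simps)
    ultimately show ?thesis by (simp add: F_def g'_def g_def)
  qed
  finally show ?thesis .
qed

section \<open>The zeta function without its pole\<close>

text \<open>The summands are \<open>s - 1\<close> times the errors of the trapezoidal rule for \<open>x\<^sup>-\<^sup>s\<close> on \<open>[n + 1, n + 2]\<close>, so
  \<open>zeta_reg s\<close> is \<open>(s - 1) \<zeta>(s)\<close>, already continued to \<open>Re s > -1\<close>.\<close>

definition zeta_term :: "nat \<Rightarrow> complex \<Rightarrow> complex" where
  "zeta_term n s = (s - 1) / 2 * (of_nat (Suc n) powr (- s) + of_nat (n + 2) powr (- s))
     + of_nat (n + 2) powr (1 - s) - of_nat (Suc n) powr (1 - s)"

text \<open>In the Peano form two derivatives fall on the power, hence the decay n powr (- Re s -
  2): the series converges for Re s > -1 although its separate parts do not. The kernel itself is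
  bounded crudely by 1.\<close>

lemma norm_zeta_term_le:
  assumes "Re s \<ge> -2"
  shows "norm (zeta_term n s) \<le> norm ((s - 1) * s * (s + 1)) * real (Suc n) powr (- Re s - 2)"
proof -
  have I: "((\<lambda>u. (s - 1) * s * (s + 1) * (of_real (u * (1 - u) / 2) * of_real (real (Suc n) + u) powr (- s - 2)))
     has_integral zeta_term n s) {0..1}"
    using trapezoid_powr[of "real (Suc n)" s] by (simp add: zeta_term_def add_ac)
  have "norm (zeta_term n s) \<le> norm ((s - 1) * s * (s + 1)) * real (Suc n) powr (- Re s - 2) * measure lborel {0..1::real}"
  proof (rule has_integral_bound_real[where S = "{}", OF _ _ I])
    fix u :: real assume "u \<in> {0..1} - {}"
    then have u: "u \<in> {0..1}" by simp
    have n1: "norm (of_real (real (Suc n) + u) powr (- s - 2) :: complex) = (real (Suc n) + u) powr (- Re s - 2)"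
      using u by (subst norm_powr_real_powr) auto
    have n2: "norm (of_real (u * (1 - u) / 2) :: complex) = u * (1 - u) / 2"
      unfolding norm_of_real using u by (intro abs_of_nonneg) auto
    have "norm ((s - 1) * s * (s + 1) * (of_real (u * (1 - u) / 2) * of_real (real (Suc n) + u) powr (- s - 2)))
       = norm ((s - 1) * s * (s + 1)) * ((u * (1 - u) / 2) * (real (Suc n) + u) powr (- Re s - 2))"
      unfolding norm_mult[of "(s - 1) * s * (s + 1)"] norm_mult[of "of_real (u * (1 - u) / 2)"] n1 n2 ..
    also have "\<dots> \<le> norm ((s - 1) * s * (s + 1)) * (1 * real (Suc n) powr (- Re s - 2))"
    proof (intro mult_left_mono mult_mono)
      have "u * (1 - u) \<le> 1 * 1" using u by (intro mult_mono) auto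
      then show "u * (1 - u) / 2 \<le> 1" by simp
      show "(real (Suc n) + u) powr (- Re s - 2) \<le> real (Suc n) powr (- Re s - 2)"
        using u assms by (intro powr_mono2') auto
    qed auto
    finally show "norm ((s - 1) * s * (s + 1) * (of_real (u * (1 - u) / 2) * of_real (real (Suc n) + u) powr (- s - 2)))
       \<le> norm ((s - 1) * s * (s + 1)) * real (Suc n) powr (- Re s - 2)" by (simp only: mult_1)
  qed auto
  then show ?thesis by simp
qed

lemma summable_Suc_powr: "a < -1 \<Longrightarrow> summable (\<lambda>n. real (Suc n) powr a)"
  using summable_real_powr_iff[of a] summable_Suc_iff[of "\<lambda>n. real n powr a"] by simp

lemma summable_norm_zeta_term: "Re s > -1 \<Longrightarrow> summable (\<lambda>n. norm (zeta_term n s))"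
  by (rule summable_comparison_test'[OF summable_mult[OF summable_Suc_powr[of "- Re s - 2"]], of 0 _ "norm ((s - 1) * s * (s + 1))"])
    (use norm_zeta_term_le[of s] in auto)

text \<open>The trapezoidal sum counts the first term by half and subtracts the integral of x powr
  (- s) from 1 on; multiplied by s - 1, these two corrections are (s - 1) / 2 and 1.\<close>

definition zeta_reg :: "complex \<Rightarrow> complex" where
  "zeta_reg s = 1 + (s - 1) / 2 + (\<Sum>n. zeta_term n s)"

lemma zeta_term_sums: "Re s > -1 \<Longrightarrow> (\<lambda>n. zeta_term n s) sums (zeta_reg s - 1 - (s - 1) / 2)"
  using summable_norm_zeta_term[of s] by (simp add: zeta_reg_def summable_sums summable_norm_cancel)

definition zeta_term_deriv :: "nat \<Rightarrow> complex \<Rightarrow> complex" where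
  "zeta_term_deriv n s = (of_nat (Suc n) powr (- s) + of_nat (n + 2) powr (- s)) / 2
     - (s - 1) / 2 * (of_real (ln (real (Suc n))) * of_nat (Suc n) powr (- s) + of_real (ln (real (n + 2))) * of_nat (n + 2) powr (- s))
     - of_real (ln (real (n + 2))) * of_nat (n + 2) powr (1 - s) + of_real (ln (real (Suc n))) * of_nat (Suc n) powr (1 - s)"

lemma has_field_derivative_of_nat_powr:
  assumes "n > 0" "(f has_field_derivative D) (at z)"
  shows "((\<lambda>z. of_nat n powr f z :: complex) has_field_derivative D * of_real (ln (real n)) * of_nat n powr f z) (at z)"
proof -
  have "((\<lambda>w. of_nat n powr w :: complex) has_field_derivative Ln (of_nat n) * of_nat n powr f z) (at (f z))"
    using assms(1) by (intro has_field_derivative_powr_right) auto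
  from DERIV_chain2[OF this assms(2)] show ?thesis
    using assms(1) by (simp add: Ln_of_nat mult_ac)
qed

lemma has_field_derivative_zeta_term: "(zeta_term n has_field_derivative zeta_term_deriv n s) (at s)"
proof -
  have m: "((\<lambda>s. of_nat k powr (- s) :: complex) has_field_derivative - 1 * of_real (ln (real k)) * of_nat k powr (- s)) (at s)"
    and o: "((\<lambda>s. of_nat k powr (1 - s) :: complex) has_field_derivative - 1 * of_real (ln (real k)) * of_nat k powr (1 - s)) (at s)"
    if "k > 0" for k :: nat
    by (rule has_field_derivative_of_nat_powr[OF that]; auto intro!: derivative_eq_intros)+
  have l: "((\<lambda>s. (s - 1) / 2) has_field_derivative (1 / 2 :: complex)) (at s)"
    by (auto intro!: derivative_eq_intros)
  have pos: "Suc n > 0" "n + 2 > 0" by auto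
  have alg: "(s - 1) / 2 * (- 1 * L1 * P1 + - 1 * L2 * P2) + 1 / 2 * (P1 + P2) + - 1 * L2 * Q2 - - 1 * L1 * Q1
     = (P1 + P2) / 2 - (s - 1) / 2 * (L1 * P1 + L2 * P2) - L2 * Q2 + L1 * Q1" for L1 L2 P1 P2 Q1 Q2 :: complex
    by (simp add: field_simps)
  show ?thesis
    unfolding zeta_term_def[abs_def] zeta_term_deriv_def alg[symmetric]
    by (rule DERIV_diff[OF DERIV_add[OF DERIV_mult'[OF l DERIV_add[OF m[OF pos(1)] m[OF pos(2)]]] o[OF pos(2)]] o[OF pos(1)]])
qed

text \<open>The derivative at 1 is needed as a number, for the double pole, so the series of
  derivatives is kept instead of mere holomorphy.\<close>

lemma zeta_reg_series_deriv:
  assumes "Re s > -1"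
  shows "\<exists>D. (\<lambda>n. zeta_term_deriv n s) sums D \<and> (zeta_reg has_field_derivative (1 / 2 + D)) (at s)"
proof -
  let ?S = "{s. Re s > -1}"
  have "\<exists>g g'. \<forall>x \<in> ?S. ((\<lambda>n. zeta_term n x) sums g x) \<and> ((\<lambda>n. zeta_term_deriv n x) sums g' x) \<and> (g has_field_derivative g' x) (at x)"
  proof (rule series_and_derivative_comparison_local)
    show "open ?S" by (rule open_halfspace_Re_gt)
    fix x assume x: "x \<in> ?S"
    \<comment> \<open>Half the distance to the line Re s = -1: on the ball Re y >= d - 1, so the
      exponent - Re y - 2 is at most -1 - d.\<close>
    define d where "d = (Re x + 1) / 2"
    define h where "h n = (norm x + d + 1) ^ 3 * real (Suc n) powr (-1 - d)" for n
    have d: "d > 0" using x by (simp add: d_def)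
    have "summable h" unfolding h_def using d by (intro summable_mult summable_Suc_powr) auto
    moreover have "norm (zeta_term n y) \<le> h n" if "y \<in> ball x d \<inter> ?S" for n y
    proof -
      have xy: "norm (y - x) < d" using that by (simp add: dist_norm norm_minus_commute)
      have "Re y > Re x - d" using abs_Re_le_cmod[of "y - x"] xy by auto
      moreover have "2 * d = Re x + 1" by (simp add: d_def)
      moreover have X0: "norm x + d + 1 \<ge> 0" using d norm_ge_zero[of x] by linarith
      ultimately have re: "Re y \<ge> d - 1" by linarith
      have ny: "norm y \<le> norm x + d" using norm_triangle_sub[of y x] xy by simp
      have "norm (y - 1) \<le> norm x + d + 1" "norm (y + 1) \<le> norm x + d + 1"
        using ny norm_triangle_ineq4[of y 1] norm_triangle_ineq[of y 1] by auto
      then have "norm ((y - 1) * y * (y + 1)) \<le> (norm x + d + 1) * (norm x + d + 1) * (norm x + d + 1)"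
        unfolding norm_mult using ny X0 by (intro mult_mono) auto
      moreover have "real (Suc n) powr (- Re y - 2) \<le> real (Suc n) powr (-1 - d)"
        using re by (intro powr_mono) auto
      ultimately have "norm ((y - 1) * y * (y + 1)) * real (Suc n) powr (- Re y - 2) \<le> h n"
        unfolding h_def using d by (intro mult_mono) (auto simp: power3_eq_cube)
      then show ?thesis using norm_zeta_term_le[of y n] re d by simp
    qed
    ultimately show "\<exists>d h. 0 < d \<and> summable h \<and> (\<forall>\<^sub>F n in sequentially. \<forall>y\<in>ball x d \<inter> ?S. norm (zeta_term n y) \<le> h n)"
      using d by (intro exI[of _ d] exI[of _ h]) auto
  qed (rule has_field_derivative_zeta_term)
  then obtain g g' where g: "\<And>x. Re x > -1 \<Longrightarrow> (\<lambda>n. zeta_term n x) sums g x"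
      "\<And>x. Re x > -1 \<Longrightarrow> (\<lambda>n. zeta_term_deriv n x) sums g' x"
      "\<And>x. Re x > -1 \<Longrightarrow> (g has_field_derivative g' x) (at x)" by auto
  have "((\<lambda>s. 1 + (s - 1) / 2 + g s) has_field_derivative (1 / 2 + g' s)) (at s)"
    using g(3)[OF assms] by (auto intro!: derivative_eq_intros)
  then have "(zeta_reg has_field_derivative (1 / 2 + g' s)) (at s)"
    by (rule has_field_derivative_transform_within_open[where S = "{s. Re s > -1}"])
      (use assms g(1) in \<open>auto simp: open_halfspace_Re_gt zeta_reg_def sums_iff\<close>)
  then show ?thesis using g(2)[OF assms] by blast
qed

lemma holomorphic_zeta_reg: "zeta_reg holomorphic_on {s. Re s > -1}"
  unfolding holomorphic_on_def field_differentiable_def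
  using zeta_reg_series_deriv has_field_derivative_at_within by blast

lemma holomorphic_zeta_reg_comp [holomorphic_intros]:
  assumes "f holomorphic_on A" "\<And>z. z \<in> A \<Longrightarrow> Re (f z) > -1"
  shows "(\<lambda>z. zeta_reg (f z)) holomorphic_on A"
  using holomorphic_on_compose_gen[OF assms(1) holomorphic_zeta_reg] assms(2) by (auto simp: o_def)

lemma zeta_term_1: "zeta_term n 1 = 0"
  by (simp add: zeta_term_def powr_def del: of_nat_Suc of_nat_add)

lemma zeta_reg_1: "zeta_reg 1 = 1"
  by (simp add: zeta_reg_def zeta_term_1)

text \<open>At s = 1 the logarithms telescope and the partial sums become harmonic numbers minus
  logarithms. The halved first term costs 1 / 2, which the derivative 1 / 2 of the linear part
  restores. This is the source of \<open>euler_mascheroni\<close> in f.\<close>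

lemma has_field_derivative_zeta_reg_1: "(zeta_reg has_field_derivative euler_mascheroni) (at 1)"
proof -
  obtain D where D: "(\<lambda>n. zeta_term_deriv n 1) sums D" and zeta_reg: "(zeta_reg has_field_derivative (1 / 2 + D)) (at 1)"
    using zeta_reg_series_deriv[of 1] by auto
  have "(\<Sum>k<N. zeta_term_deriv k 1) = of_real (harm (Suc N) - ln (real (Suc N))) - 1 / 2 - 1 / (2 * of_nat (Suc N))" for N
  proof (induction N)
    case 0
    then show ?case by (simp add: harm_def)
  next
    case (Suc N)
    have p0: "of_nat k powr (1 - 1) = (1 :: complex)" "of_nat k powr (- 1) = (1 / of_nat k :: complex)" if "k > 0" for k :: nat
      using that by (simp_all add: powr_minus_divide)
    define a b :: complex where "a = 1 / of_nat (Suc N)" and "b = 1 / of_nat (Suc (Suc N))"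
    have 1: "zeta_term_deriv N 1 = (a + b) / 2 - of_real (ln (real (Suc (Suc N)))) + of_real (ln (real (Suc N)))"
      unfolding zeta_term_deriv_def a_def b_def add_2_eq_Suc' by (simp add: p0 del: of_nat_Suc of_nat_add diff_self)
    have 2: "of_real (harm (Suc (Suc N))) = of_real (harm (Suc N)) + b"
      unfolding harm_Suc[of "Suc N"] b_def by (simp add: inverse_eq_divide)
    have 3: "1 / (2 * of_nat (Suc N)) = a / 2" "1 / (2 * of_nat (Suc (Suc N))) = b / 2"
      unfolding a_def b_def by simp_all
    show ?case
      unfolding sum.lessThan_Suc Suc.IH of_real_diff 1 2 3 by (simp add: add_divide_distrib)
  qed
  moreover have "(\<lambda>N. of_real (harm (Suc N) - ln (real (Suc N))) - 1 / 2 - 1 / (2 * of_nat (Suc N))) \<longlonglongrightarrow> euler_mascheroni - 1 / 2 - (0 :: complex)"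
  proof (intro tendsto_diff tendsto_const)
    show "(\<lambda>N. of_real (harm (Suc N) - ln (real (Suc N)))) \<longlonglongrightarrow> (euler_mascheroni :: complex)"
      using LIMSEQ_Suc[OF euler_mascheroni_LIMSEQ_of_real] by simp
    have "(\<lambda>N. 1 / 2 * (1 / of_nat (Suc N)) :: complex) \<longlonglongrightarrow> 1 / 2 * 0"
      by (intro tendsto_mult tendsto_const LIMSEQ_Suc[OF lim_1_over_n])
    then show "(\<lambda>N. 1 / (2 * of_nat (Suc N)) :: complex) \<longlonglongrightarrow> 0" by (simp del: of_nat_Suc)
  qed
  ultimately have "(\<lambda>n. zeta_term_deriv n 1) sums (euler_mascheroni - 1 / 2)"
    by (simp add: sums_def)
  with D have "D = euler_mascheroni - 1 / 2" by (rule sums_unique2)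
  with zeta_reg show ?thesis by simp
qed

text \<open>The partial sums of \<open>zeta_term\<close> telescope to s - 1 times those of the
  Dirichlet series, up to constants and to powers of N + 1 that vanish for Re s > 1.\<close>

lemma zeta_reg_dirichlet_sums:
  assumes "Re s > 1"
  shows "(\<lambda>n. 1 / of_nat (Suc n) powr s) sums (zeta_reg s / (s - 1))"
proof -
  have s1: "s \<noteq> 1" using assms by auto
  have part: "(\<Sum>k<N. zeta_term k s) = (s - 1) * ((\<Sum>k<Suc N. 1 / of_nat (Suc k) powr s) - 1 / 2 - of_nat (Suc N) powr (- s) / 2)
     + of_nat (Suc N) powr (1 - s) - 1" for N
  proof (induction N)
    case 0
    then show ?case by (simp add: powr_def)
  next
    case (Suc N)
    have inv: "1 / of_nat k powr s = (of_nat k powr (- s) :: complex)" for k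
      by (simp add: powr_minus_divide)
    show ?case
      unfolding sum.lessThan_Suc[of "\<lambda>k. zeta_term k s" N] Suc.IH
        sum.lessThan_Suc[of "\<lambda>k. 1 / of_nat (Suc k) powr s" "Suc N"] zeta_term_def[of N] inv
      by (simp add: algebra_simps add_divide_distrib diff_divide_distrib)
  qed
  have "(\<lambda>N. ((\<Sum>k<N. zeta_term k s) - of_nat (Suc N) powr (1 - s) + 1) / (s - 1) + 1 / 2 + of_nat (Suc N) powr (- s) / 2)
    \<longlonglongrightarrow> ((zeta_reg s - 1 - (s - 1) / 2) - 0 + 1) / (s - 1) + 1 / 2 + 0 / 2"
    using zeta_term_sums[of s] assms s1
    by (intro tendsto_intros tendsto_neg_powr_complex_of_nat filterlim_Suc) (auto simp: sums_def)
  also have "((zeta_reg s - 1 - (s - 1) / 2) - 0 + 1) / (s - 1) + 1 / 2 + 0 / 2 = zeta_reg s / (s - 1)"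
    using s1 by (simp add: field_simps)
  also have "(\<lambda>N. ((\<Sum>k<N. zeta_term k s) - of_nat (Suc N) powr (1 - s) + 1) / (s - 1) + 1 / 2 + of_nat (Suc N) powr (- s) / 2)
    = (\<lambda>N. \<Sum>k<Suc N. 1 / of_nat (Suc k) powr s)"
  proof -
    have "((s - 1) * (S - 1 / 2 - P / 2) + Q - 1 - Q + 1) / (s - 1) + 1 / 2 + P / 2 = S" for S P Q
      using s1 by (simp add: field_simps)
    then show ?thesis unfolding part by (simp only:)
  qed
  finally show ?thesis
    unfolding sums_def by (rule LIMSEQ_imp_Suc)
qed

text \<open>The cube comes from the factor (s - 1) s (s + 1) of the Peano form. A polynomial bound
  is enough because it is set against the exponential decay of \<open>trig_kernel\<close>.\<close>

lemma norm_zeta_reg_le: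
  "\<exists>C>0. \<forall>s. Re s \<ge> 0 \<longrightarrow> norm (zeta_reg s) \<le> C * (1 + norm s) ^ 3"
proof (intro exI conjI allI impI)
  define C where "C = (\<Sum>n. real (Suc n) powr (-2))"
  have C0: "C \<ge> 0" unfolding C_def by (rule suminf_nonneg[OF summable_Suc_powr]) auto
  show "2 + C > 0" using C0 by simp
  fix s :: complex assume s: "Re s \<ge> 0"
  let ?N = "1 + norm s"
  have n1: "norm (s - 1) \<le> ?N" "norm (s + 1) \<le> ?N"
    using norm_triangle_ineq4[of s 1] norm_triangle_ineq[of s 1] by auto
  have le3: "norm ((s - 1) * s * (s + 1)) \<le> ?N ^ 3"
    unfolding norm_mult power3_eq_cube using n1 by (intro mult_mono) auto
  have "norm (\<Sum>n. zeta_term n s) \<le> (\<Sum>n. norm (zeta_term n s))"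
    using summable_norm_zeta_term[of s] s by (intro summable_norm) auto
  also have "\<dots> \<le> (\<Sum>n. ?N ^ 3 * real (Suc n) powr (-2))"
  proof (intro suminf_le summable_mult summable_Suc_powr summable_norm_zeta_term)
    fix n
    have "real (Suc n) powr (- Re s - 2) \<le> real (Suc n) powr (-2)"
      using s by (intro powr_mono) auto
    then have "norm ((s - 1) * s * (s + 1)) * real (Suc n) powr (- Re s - 2) \<le> ?N ^ 3 * real (Suc n) powr (-2)"
      using le3 by (intro mult_mono) auto
    then show "norm (zeta_term n s) \<le> ?N ^ 3 * real (Suc n) powr (-2)"
      using norm_zeta_term_le[of s n] s by linarith
  qed (use s in auto)
  also have "\<dots> = ?N ^ 3 * C" unfolding C_def by (intro suminf_mult summable_Suc_powr) auto
  finally have 1: "norm (\<Sum>n. zeta_term n s) \<le> ?N ^ 3 * C" .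
  have 2: "norm (zeta_reg s) \<le> norm (1 + (s - 1) / 2) + norm (\<Sum>n. zeta_term n s)"
    unfolding zeta_reg_def by (rule norm_triangle_ineq)
  have "norm (1 + (s - 1) / 2) \<le> norm (1 :: complex) + norm ((s - 1) / 2)" by (rule norm_triangle_ineq)
  also have "\<dots> = 1 + norm (s - 1) / 2" by (simp add: norm_divide)
  also have "\<dots> \<le> 1 + ?N / 2" using n1 by (intro add_left_mono divide_right_mono) auto
  finally have 3: "norm (1 + (s - 1) / 2) \<le> 1 + ?N / 2" .
  have "?N ^ 1 \<le> ?N ^ 3" by (intro power_increasing) auto
  then have 4: "?N \<le> ?N ^ 3" by simp
  have 5: "1 \<le> ?N" "?N / 2 \<le> ?N" by auto
  have "(2 + C) * ?N ^ 3 = 2 * ?N ^ 3 + ?N ^ 3 * C" by (simp only: distrib_right mult.commute[of C])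
  then show "norm (zeta_reg s) \<le> (2 + C) * ?N ^ 3" using 1 2 3 4 5 by linarith
qed

section \<open>Interchange of integrals, and of series with integrals\<close>

lemma of_real_powr_eq_exp: "a > 0 \<Longrightarrow> of_real a powr z = exp (z * of_real (ln a))" for z :: complex
  by (simp add: powr_def Ln_of_real)

lemma has_bochner_integral_Re:
  "has_bochner_integral M f x \<Longrightarrow> has_bochner_integral M (\<lambda>x. Re (f x)) (Re x)"
  by (rule has_bochner_integral_bounded_linear[OF bounded_linear_Re])

text \<open>The integral of the norm is stated with complex values so that it can be instantiated by
  the very formula under proof, at real parameters; its real part then gives Tonelli's
  condition.\<close>

lemma fubini_of_real_norm:
  fixes f :: "real \<Rightarrow> real \<Rightarrow> complex"
  assumes meas: "(\<lambda>p. f (fst p) (snd p)) \<in> borel_measurable borel"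
    and g: "\<And>x. has_bochner_integral lborel (\<lambda>y. f x y) (g x)"
    and n: "\<And>x. has_bochner_integral lborel (\<lambda>y. complex_of_real (norm (f x y))) (n x)"
    and N: "integrable lborel n"
    and h: "\<And>y. has_bochner_integral lborel (\<lambda>x. f x y) (h y)"
    and G: "has_bochner_integral lborel g I"
  shows "has_bochner_integral lborel h I"
proof -
  have "has_bochner_integral lborel h (integral\<^sup>L lborel g)"
  proof (rule has_bochner_integral_fubini(2)[OF meas g _ _ h])
    show "has_bochner_integral lborel (\<lambda>y. norm (f x y)) (Re (n x))" for x
      using has_bochner_integral_Re[OF n[of x]] by simp
    show "integrable lborel (\<lambda>x. Re (n x))" using N by (rule integrable_Re)
  qed
  then show ?thesis using G by (simp add: has_bochner_integral_iff)
qed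

text \<open>The same device for series: \<open>N\<close> is typically \<open>I\<close> at the real
  parts of the parameters, so its summability is a special case of a convergence already
  known.\<close>

lemma has_bochner_integral_sums:
  fixes f :: "nat \<Rightarrow> real \<Rightarrow> complex"
  assumes f: "\<And>i. has_bochner_integral lborel (f i) (I i)"
    and s: "\<And>x. summable (\<lambda>i. norm (f i x))"
    and n: "\<And>i. has_bochner_integral lborel (\<lambda>x. complex_of_real (norm (f i x))) (N i)"
    and N: "summable N"
    and F: "\<And>x. (\<lambda>i. f i x) sums F x"
    and L: "I sums L"
  shows "has_bochner_integral lborel F L"
proof -
  have int: "integrable lborel (f i)" for i using f by (simp add: has_bochner_integral_iff)
  have Nr: "integral\<^sup>L lborel (\<lambda>x. norm (f i x)) = Re (N i)" for i
    using has_bochner_integral_Re[OF n[of i]] by (simp add: has_bochner_integral_iff)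
  have sm: "summable (\<lambda>i. integral\<^sup>L lborel (\<lambda>x. norm (f i x)))"
    unfolding Nr using N by (rule summable_Re)
  have F': "F = (\<lambda>x. \<Sum>i. f i x)" using F by (simp add: sums_iff fun_eq_iff)
  have I': "I = (\<lambda>i. integral\<^sup>L lborel (f i))" using f by (simp add: has_bochner_integral_iff fun_eq_iff)
  have "integrable lborel F"
    unfolding F' by (rule integrable_suminf) (use int s sm in auto)
  moreover have "I sums integral\<^sup>L lborel F"
    unfolding F' I' by (rule sums_integral) (use int s sm in auto)
  ultimately show ?thesis using L sums_unique2 by (auto simp: has_bochner_integral_iff)
qed

section \<open>The functional equation\<close>

definition trapezoid :: "real \<Rightarrow> complex \<Rightarrow> complex" where
  "trapezoid a s = (s - 1) / 2 * (of_real a powr (- s) + of_real (a + 1) powr (- s))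
        + of_real (a + 1) powr (1 - s) - of_real a powr (1 - s)"

text \<open>The constant 1 + (s - 1) / 2 of \<open>zeta_reg\<close> is the term of the interval
  [0, 1], because \<open>0 powr z = 0\<close>. Hence one sum over all intervals [n, n + 1] with n
  starting at 0.\<close>

lemma trapezoid_sums:
  assumes "-1 < Re s"
  shows "(\<lambda>n. trapezoid (real n) s) sums zeta_reg s"
proof -
  have "trapezoid (real (Suc n)) s = zeta_term n s" for n
    by (simp add: trapezoid_def zeta_term_def add_ac)
  then have "(\<lambda>n. trapezoid (real (Suc n)) s) sums (zeta_reg s - 1 - (s - 1) / 2)"
    using zeta_term_sums[OF assms] by simp
  then have "(\<lambda>n. trapezoid (real n) s) sums (zeta_reg s - 1 - (s - 1) / 2 + trapezoid (real 0) s)"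
    by (rule sums_Suc)
  then show ?thesis by (simp add: trapezoid_def)
qed

lemma strip_nonzero:
  assumes "-1 < Re s" "Re s < 0"
  shows "(s - 1) * s * (s + 1) \<noteq> 0"
proof -
  have "s \<noteq> 1" "s \<noteq> 0" "s \<noteq> -1" using assms by auto
  then show ?thesis by (simp add: add_eq_0_iff2)
qed

lemma has_bochner_integral_trapezoid:
  assumes s: "-1 < Re s" "Re s < 0" and a: "a \<ge> 0"
  shows "has_bochner_integral lborel
     (\<lambda>u. indicator {0<..<1} u *\<^sub>R (of_real (u * (1 - u) / 2) * of_real (a + u) powr (- s - 2)))
     (trapezoid a s / ((s - 1) * s * (s + 1)))"
proof -
  have HK: "((\<lambda>u. of_real (u * (1 - u) / 2) * of_real (a + u) powr (- s - 2)) has_integral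
     (trapezoid a s / ((s - 1) * s * (s + 1)))) {0<..<1}" if "-1 < Re s" "Re s < 0" for s
  proof -
    have "((\<lambda>u. (s - 1) * s * (s + 1) * (of_real (u * (1 - u) / 2) * of_real (a + u) powr (- s - 2)) / ((s - 1) * s * (s + 1)))
       has_integral (trapezoid a s / ((s - 1) * s * (s + 1)))) {0..1}"
      unfolding trapezoid_def using that a
      by (intro has_integral_divide trapezoid_powr) auto
    then have "((\<lambda>u. of_real (u * (1 - u) / 2) * of_real (a + u) powr (- s - 2))
       has_integral (trapezoid a s / ((s - 1) * s * (s + 1)))) {0..1}"
      by (simp only: nonzero_mult_div_cancel_left[OF strip_nonzero[OF that]])
    then show ?thesis by (simp only: has_integral_Icc_iff_Ioo)
  qed
  \<comment> \<open>On (0, 1) taking the norm only replaces s by Re s, and \<open>HK\<close> at that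
    real exponent makes the majorant integrable.\<close>
  have nrm: "norm (of_real (u * (1 - u) / 2) * of_real (a + u) powr (- s - 2))
       = Re (of_real (u * (1 - u) / 2) * of_real (a + u) powr (- of_real (Re s) - 2))" if "u \<in> {0<..<1}" for u
  proof -
    have p: "u * (1 - u) / 2 \<ge> 0" "a + u > 0" using that a by auto
    have e: "- complex_of_real (Re s) - 2 = of_real (- Re s - 2)" by simp
    have "of_real (a + u) powr (- of_real (Re s) - 2) = complex_of_real ((a + u) powr (- Re s - 2))"
      unfolding e using p by (subst powr_of_real) auto
    moreover have "norm (of_real (a + u) powr (- s - 2) :: complex) = (a + u) powr (- Re s - 2)"
      using p by (subst norm_powr_real_powr) auto
    ultimately show ?thesis
      using p unfolding norm_mult norm_of_real by (simp only: abs_of_nonneg of_real_mult[symmetric] Re_complex_of_real)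
  qed
  have "(\<lambda>u. Re (of_real (u * (1 - u) / 2) * of_real (a + u) powr (- of_real (Re s) - 2))) integrable_on {0<..<1}"
    using has_integral_linear[OF HK[of "of_real (Re s)"] bounded_linear_Re] s
    unfolding o_def integrable_on_def by auto
  moreover have cont: "continuous_on {0<..<1} (\<lambda>u. complex_of_real (u * (1 - u) / 2) * of_real (a + u) powr (- s - 2))"
    using a by (auto intro!: continuous_intros simp: complex_eq_iff)
  ultimately have "(\<lambda>u. complex_of_real (u * (1 - u) / 2) * of_real (a + u) powr (- s - 2)) absolutely_integrable_on {0<..<1}"
    by (intro measurable_bounded_by_integrable_imp_absolutely_integrable[where
        g = "\<lambda>u. Re (of_real (u * (1 - u) / 2) * of_real (a + u) powr (- of_real (Re s) - 2))"]
        continuous_imp_measurable_on_sets_lebesgue eq_refl[OF nrm]) auto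
  from has_bochner_integral_absolutely_integrable[OF this] show ?thesis
    using cont integral_unique[OF HK[OF s]] by (auto intro!: borel_measurable_continuous_on_indicator)
qed

text \<open>The trapezoidal error of x \<mapsto> exp (- t x) on [a, a + 1].\<close>

definition trapezoid_exp :: "real \<Rightarrow> real \<Rightarrow> real" where
  "trapezoid_exp a t = (exp (- a * t) + exp (- (a + 1) * t)) / 2 - (exp (- a * t) - exp (- (a + 1) * t)) / t"

text \<open>The Peano kernel again, now against an exponential. Its nonnegativity passes to
  \<open>trapezoid_exp\<close>, which later lets norms be replaced by the functions
  themselves.\<close>

lemma has_bochner_integral_trapezoid_exp:
  assumes t: "t > 0"
  shows "has_bochner_integral lborel (\<lambda>u. indicator {0<..<1} u *\<^sub>R (u * (1 - u) / 2 * exp (- (a + u) * t)))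
       (trapezoid_exp a t / t\<^sup>2)" (is ?A)
    and trapezoid_exp_nonneg: "trapezoid_exp a t \<ge> 0" (is ?B)
proof -
  \<comment> \<open>Repeated integration by parts of a quadratic p = u (1 - u) / 2 against an
    exponential: the bracket collects p / t, p' / t^2 and p'' / t^3.\<close>
  define F where "F u = - exp (- (a + u) * t) * (u * (1 - u) / 2 / t + (1 - 2 * u) / 2 / t\<^sup>2 - 1 / t ^ 3)" for u
  have "((\<lambda>u. u * (1 - u) / 2 * exp (- (a + u) * t)) has_integral (F 1 - F 0)) {0..1}"
  proof (rule fundamental_theorem_of_calculus)
    fix x :: real
    have alg: "- (E * - t) * (u * (1 - u) / 2 / t + (1 - 2 * u) / 2 / t\<^sup>2 - 1 / t ^ 3) + - E * ((1 - 2 * u) / 2 / t + - 1 / t\<^sup>2)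
       = u * (1 - u) / 2 * E" for E u :: real
      using t by (simp add: field_simps power2_eq_square power3_eq_cube)
    have "(F has_field_derivative (u * (1 - u) / 2 * exp (- (a + u) * t))) (at u)" for u
      unfolding F_def
    proof (rule DERIV_cong)
      have 1: "((\<lambda>u. - exp (- (a + u) * t)) has_field_derivative - (exp (- (a + u) * t) * - t)) (at u)"
        by (auto intro!: derivative_eq_intros)
      have 2: "((\<lambda>u. u * (1 - u) / 2 / t + (1 - 2 * u) / 2 / t\<^sup>2 - 1 / t ^ 3) has_field_derivative
          ((1 - 2 * u) / 2 / t + - 1 / t\<^sup>2)) (at u)"
        proof -
          have 3: "((\<lambda>u. u * (1 - u) / 2) has_field_derivative (1 - 2 * u) / 2) (at u)"
            and 4: "((\<lambda>u. (1 - 2 * u) / 2) has_field_derivative - 1) (at u)"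
            by (auto intro!: derivative_eq_intros)
          show ?thesis
            using DERIV_diff[OF DERIV_add[OF DERIV_cdivide[OF 3] DERIV_cdivide[OF 4]] DERIV_const] by simp
        qed
      show "((\<lambda>u. - exp (- (a + u) * t) * (u * (1 - u) / 2 / t + (1 - 2 * u) / 2 / t\<^sup>2 - 1 / t ^ 3)) has_field_derivative
        (- exp (- (a + u) * t) * ((1 - 2 * u) / 2 / t + - 1 / t\<^sup>2) + - (exp (- (a + u) * t) * - t) * (u * (1 - u) / 2 / t + (1 - 2 * u) / 2 / t\<^sup>2 - 1 / t ^ 3))) (at u)"
        by (rule DERIV_mult'[OF 1 2])
    qed (use alg[of "exp (- (a + u) * t)" u] in linarith)
    then show "(F has_vector_derivative x * (1 - x) / 2 * exp (- (a + x) * t)) (at x within {0..1})"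
      by (simp add: has_real_derivative_iff_has_vector_derivative[symmetric] has_field_derivative_at_within)
  qed simp
  also have "F 1 - F 0 = trapezoid_exp a t / t\<^sup>2"
    using t by (simp add: F_def trapezoid_exp_def field_simps power2_eq_square power3_eq_cube)
  finally have I: "((\<lambda>u. u * (1 - u) / 2 * exp (- (a + u) * t)) has_integral trapezoid_exp a t / t\<^sup>2) {0<..<1}"
    by (simp only: has_integral_Icc_iff_Ioo)
  have "trapezoid_exp a t / t\<^sup>2 \<ge> 0" by (rule has_integral_nonneg[OF I]) auto
  then show ?B using t by (simp add: zero_le_divide_iff)
  have "(\<lambda>u. u * (1 - u) / 2 * exp (- (a + u) * t)) absolutely_integrable_on {0<..<1}"
    using I by (intro nonnegative_absolutely_integrable_1) (auto simp: integrable_on_def)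
  from has_bochner_integral_absolutely_integrable[OF this] show ?A
    unfolding integral_unique[OF I] by (auto intro!: borel_measurable_continuous_on_indicator continuous_intros)
qed


text \<open>Up to Gamma (s + 2), Euler's integral writes (a + u) powr (- s - 2) as an integral of
  exp ((s + 2) v - (a + u) exp v). Integrating over u first produces the trapezoidal error of an
  exponential of rate exp v, divided by the square of exp v, which lowers s + 2 to s.\<close>

lemma has_bochner_integral_trapezoid_mellin:
  assumes s: "-1 < Re s" "Re s < 0" and a: "a \<ge> 0"
  shows "has_bochner_integral lborel (\<lambda>v. exp (s * of_real v) * of_real (trapezoid_exp a (exp v)))
     (Gamma (s + 2) * (trapezoid a s / ((s - 1) * s * (s + 1))))"
proof -
  define f where "f s u v = indicator {0<..<1} u *\<^sub>R (of_real (u * (1 - u) / 2) *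
      exp ((s + 2) * of_real v - of_real ((a + u) * exp v)))" for s :: complex and u v :: real
  define g where "g s u = indicator {0<..<1} u *\<^sub>R (of_real (u * (1 - u) / 2) *
      of_real (a + u) powr (- s - 2)) * Gamma (s + 2)" for s :: complex and u :: real
  have fg: "has_bochner_integral lborel (f s u) (g s u)" if "-1 < Re s" for s u
  proof (cases "u \<in> {0<..<1}")
    case True
    have "has_bochner_integral lborel (\<lambda>v. exp ((s + 2) * of_real v - of_real ((a + u) * exp v)))
       (Gamma (s + 2) * exp (- (s + 2) * of_real (ln (a + u))))"
      using that True a by (intro has_bochner_integral_Gamma_exp) auto
    from has_bochner_integral_mult_right[OF this, of "of_real (u * (1 - u) / 2)"]
    have "has_bochner_integral lborel (f s u) (of_real (u * (1 - u) / 2) * (Gamma (s + 2) * exp (- (s + 2) * of_real (ln (a + u)))))"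
      using True by (simp add: f_def[abs_def])
    moreover have "- (s + 2) = - s - 2" by simp
    ultimately show ?thesis
      using True a of_real_powr_eq_exp[of "a + u" "- s - 2"] by (simp add: g_def mult_ac)
  next
    case False
    then show ?thesis by (simp add: f_def[abs_def] g_def has_bochner_integral_zero)
  qed
  have gI: "has_bochner_integral lborel (g s) (Gamma (s + 2) * (trapezoid a s / ((s - 1) * s * (s + 1))))"
    if "-1 < Re s" "Re s < 0" for s
    using has_bochner_integral_mult_left[OF has_bochner_integral_trapezoid[OF that a], of "Gamma (s + 2)"]
    by (simp add: g_def[abs_def] mult.commute)
  have fn: "complex_of_real (norm (f s u v)) = f (of_real (Re s)) u v" for s u v
  proof (cases "u \<in> {0<..<1}")
    case True
    have "exp ((of_real (Re s) + 2) * of_real v - of_real ((a + u) * exp v)) = complex_of_real (exp ((Re s + 2) * v - (a + u) * exp v))"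
      by (simp add: exp_of_real[symmetric])
    moreover have "norm (exp ((s + 2) * of_real v - of_real ((a + u) * exp v))) = exp ((Re s + 2) * v - (a + u) * exp v)"
      by (simp add: norm_exp_eq_Re)
    moreover have "norm (of_real (u * (1 - u) / 2) :: complex) = u * (1 - u) / 2"
      unfolding norm_of_real using True by (intro abs_of_nonneg) auto
    ultimately show ?thesis using True
      unfolding f_def norm_scaleR norm_mult by simp
  qed (simp add: f_def)
  show ?thesis
  proof (rule fubini_of_real_norm[where f = "f s" and g = "g s" and n = "g (of_real (Re s))"])
    show "(\<lambda>p. f s (fst p) (snd p)) \<in> borel_measurable borel"
    proof -
      have "(\<lambda>p. f s (fst p) (snd p)) = (\<lambda>p. indicator ({0<..<1} \<times> UNIV) p *\<^sub>R (of_real (fst p * (1 - fst p) / 2) *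
         exp ((s + 2) * of_real (snd p) - of_real ((a + fst p) * exp (snd p)))))"
        by (auto simp: f_def fun_eq_iff indicator_def)
      then show ?thesis
        by (auto intro!: borel_measurable_continuous_on_indicator continuous_intros simp: borel_Times)
    qed
    show "has_bochner_integral lborel (f s u) (g s u)" for u using s by (intro fg)
    show "has_bochner_integral lborel (\<lambda>v. complex_of_real (norm (f s u v))) (g (of_real (Re s)) u)" for u
      unfolding fn using fg[of "of_real (Re s)" u] s by simp
    show "integrable lborel (g (of_real (Re s)))"
      using gI[of "of_real (Re s)"] s by (simp add: has_bochner_integral_iff)
    show "has_bochner_integral lborel (g s) (Gamma (s + 2) * (trapezoid a s / ((s - 1) * s * (s + 1))))"
      by (rule gI[OF s])
    fix v :: real
    have "has_bochner_integral lborel (\<lambda>u. exp ((s + 2) * of_real v) * of_real (indicator {0<..<1} u *\<^sub>R (u * (1 - u) / 2 * exp (- (a + u) * exp v))))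
       (exp ((s + 2) * of_real v) * of_real (trapezoid_exp a (exp v) / (exp v)\<^sup>2))"
      by (intro has_bochner_integral_mult_right has_bochner_integral_of_real has_bochner_integral_trapezoid_exp) auto
    also have "(\<lambda>u. exp ((s + 2) * of_real v) * of_real (indicator {0<..<1} u *\<^sub>R (u * (1 - u) / 2 * exp (- (a + u) * exp v)))) = (\<lambda>u. f s u v)"
    proof
      fix u
      have "exp ((s + 2) * of_real v - of_real ((a + u) * exp v)) = exp ((s + 2) * of_real v) * of_real (exp (- (a + u) * exp v))"
        by (simp only: exp_of_real[symmetric] exp_add[symmetric]) (simp add: algebra_simps)
      then show "exp ((s + 2) * of_real v) * of_real (indicator {0<..<1} u *\<^sub>R (u * (1 - u) / 2 * exp (- (a + u) * exp v))) = f s u v"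
        by (simp add: f_def indicator_def)
    qed
    also have "exp ((s + 2) * of_real v) * of_real (trapezoid_exp a (exp v) / (exp v)\<^sup>2) = exp (s * of_real v) * of_real (trapezoid_exp a (exp v))"
    proof -
      have "exp ((s + 2) * of_real v) = exp (s * of_real v) * of_real ((exp v)\<^sup>2)"
        by (simp add: exp_add[symmetric] exp_of_real[symmetric] power2_eq_square distrib_right)
      then show ?thesis by simp
    qed
    finally show "has_bochner_integral lborel (\<lambda>u. f s u v) (exp (s * of_real v) * of_real (trapezoid_exp a (exp v)))" .
  qed
qed

text \<open>A geometric series. The value is t / (exp t - 1) without its Taylor terms 1 and - t / 2,
  divided by t: the generating function of the Bernoulli numbers.\<close>

lemma trapezoid_exp_sums:
  assumes t: "t > 0"
  shows "(\<lambda>n. trapezoid_exp (real n) t) sums (1 / (exp t - 1) + 1 / 2 - 1 / t)"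
proof -
  let ?r = "exp (- t)"
  have r: "norm ?r < 1" using t by simp
  have eq: "trapezoid_exp (real n) t = ?r ^ n * ((1 + ?r) / 2 - (1 - ?r) / t)" for n
  proof -
    have "exp (- real n * t) = ?r ^ n" by (simp add: exp_of_nat_mult[symmetric])
    moreover have "exp (- (real n + 1) * t) = ?r ^ n * ?r"
      by (simp add: exp_of_nat_mult[symmetric] exp_add[symmetric] algebra_simps)
    ultimately show ?thesis unfolding trapezoid_exp_def by (simp add: field_simps)
  qed
  have "(\<lambda>n. ?r ^ n * ((1 + ?r) / 2 - (1 - ?r) / t)) sums (1 / (1 - ?r) * ((1 + ?r) / 2 - (1 - ?r) / t))"
    by (intro sums_mult2 geometric_sums r)
  also have "1 / (1 - ?r) * ((1 + ?r) / 2 - (1 - ?r) / t) = 1 / (exp t - 1) + 1 / 2 - 1 / t"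
  proof -
    have r1: "1 - ?r \<noteq> 0" "exp t \<noteq> 1" "exp t \<noteq> 0" using t by auto
    have "?r = 1 / exp t" by (simp add: exp_minus inverse_eq_divide)
    moreover have "1 / (1 - 1 / E) * ((1 + 1 / E) / 2 - (1 - 1 / E) / t) = 1 / (E - 1) + 1 / 2 - 1 / t" if "E \<noteq> 0" "E \<noteq> 1" for E
      using t that by (simp add: field_simps)
    ultimately show ?thesis using r1 by metis
  qed
  finally show ?thesis unfolding eq .
qed

text \<open>Since Gamma (s + 2) = (s + 1) s Gamma s, the value is Gamma s times zeta s. The
  subtraction makes the function of t = exp v vanish at t = 0, which admits Re s > -1; its limit 1 /
  2 at infinity asks for Re s < 0.\<close>

lemma has_bochner_integral_bernoulli_mellin:
  assumes s: "-1 < Re s" "Re s < 0"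
  shows "has_bochner_integral lborel (\<lambda>v. exp (s * of_real v) * of_real (1 / (exp (exp v) - 1) + 1 / 2 - 1 / exp v))
     (Gamma (s + 2) * (zeta_reg s / ((s - 1) * s * (s + 1))))"
proof (rule has_bochner_integral_sums)
  let ?f = "\<lambda>s n v. exp (s * complex_of_real v) * of_real (trapezoid_exp (real n) (exp v))"
  let ?I = "\<lambda>s n. Gamma (s + 2) * (trapezoid (real n) s / ((s - 1) * s * (s + 1)))"
  have n: "complex_of_real (norm (?f s n v)) = ?f (of_real (Re s)) n v" for n v
    using trapezoid_exp_nonneg[of "exp v" "real n"] by (simp add: norm_mult exp_of_real[symmetric])
  show "has_bochner_integral lborel (?f s n) (?I s n)" for n
    by (rule has_bochner_integral_trapezoid_mellin[OF s]) simp
  show "has_bochner_integral lborel (\<lambda>v. complex_of_real (norm (?f s n v))) (?I (of_real (Re s)) n)" for n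
    unfolding n by (rule has_bochner_integral_trapezoid_mellin) (use s in auto)
  have sumI: "?I s sums (Gamma (s + 2) * (zeta_reg s / ((s - 1) * s * (s + 1))))" if "-1 < Re s" for s
    by (intro sums_mult sums_divide trapezoid_sums that)
  show "summable (?I (of_real (Re s)))" using sumI[of "of_real (Re s)"] s by (simp add: sums_iff)
  show "?I s sums (Gamma (s + 2) * (zeta_reg s / ((s - 1) * s * (s + 1))))" using s by (intro sumI)
  have ts: "(\<lambda>n. trapezoid_exp (real n) (exp v)) sums (1 / (exp (exp v) - 1) + 1 / 2 - 1 / exp v)" for v
    by (rule trapezoid_exp_sums) simp
  show "(\<lambda>n. ?f s n v) sums (exp (s * of_real v) * of_real (1 / (exp (exp v) - 1) + 1 / 2 - 1 / exp v))" for v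
    by (intro sums_mult sums_of_real ts)
  show "summable (\<lambda>n. norm (?f s n v))" for v
    unfolding norm_mult norm_of_real
    using ts[of v] trapezoid_exp_nonneg[of "exp v"] by (intro summable_mult) (simp add: sums_iff)
qed

section \<open>The same Mellin integral through the partial fractions of coth\<close>

lemma Gamma_half_reflection: "Gamma ((1 + s) / 2) * Gamma ((1 - s) / 2) = of_real pi / cos (of_real pi * s / 2)" for s :: complex
proof -
  have "sin (of_real pi * ((1 + s) / 2)) = cos (of_real pi * s / 2)"
  proof -
    have "of_real pi * ((1 + s) / 2) = of_real pi / 2 - (- (of_real pi * s / 2))" by (simp add: field_simps)
    then show ?thesis using cos_sin_eq[of "- (of_real pi * s / 2)"] by (metis cos_minus)
  qed
  then show ?thesis using Gamma_reflection_complex[of "(1 + s) / 2"] by (simp add: field_simps)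
qed

lemma not_nonpos_Ints_if_Re_pos: "Re z > 0 \<Longrightarrow> z \<notin> \<int>\<^sub>\<le>\<^sub>0"
  by (auto elim!: nonpos_Ints_cases)

text \<open>Since division by 0 gives 0, a zero of the cosine would make a product of two Gamma
  values vanish; Gamma has no zeros here.\<close>

lemma cos_half_pi_nonzero:
  assumes "-1 < Re s" "Re s < 1"
  shows "cos (of_real pi * s / 2) \<noteq> 0"
proof -
  have "Gamma ((1 + s) / 2) \<noteq> 0" "Gamma ((1 - s) / 2) \<noteq> 0"
    unfolding Gamma_eq_zero_iff using assms by (intro not_nonpos_Ints_if_Re_pos; simp)+
  then show ?thesis using Gamma_half_reflection[of s] by auto
qed

text \<open>The reciprocal of the quadratic is written as an integral over q. Integrating over v
  first gives Gamma ((s + 1) / 2), then q gives Gamma ((1 - s) / 2), and reflection joins them to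
  the cosine. The combination q + 2 v makes the two exponentials separate.\<close>

lemma has_bochner_integral_powr_over_quadratic:
  assumes s: "-1 < Re s" "Re s < 1" and a: "a > 0"
  shows "has_bochner_integral lborel (\<lambda>v. exp ((s + 1) * of_real v) * of_real (2 / ((exp v)\<^sup>2 + a\<^sup>2)))
     (of_real pi / cos (of_real pi * s / 2) * exp ((s - 1) * of_real (ln a)))"
proof -
  define f where "f s q v = 2 * exp ((1 - s) / 2 * of_real q - of_real (a\<^sup>2 * exp q)) *
      exp ((s + 1) / 2 * of_real (q + 2 * v) - of_real (exp (q + 2 * v)))" for s :: complex and q v :: real
  define g where "g s q = exp ((1 - s) / 2 * of_real q - of_real (a\<^sup>2 * exp q)) * Gamma ((s + 1) / 2)" for s :: complex and q :: real
  have fg: "has_bochner_integral lborel (f s q) (g s q)" if "-1 < Re s" "Re s < 1" for s q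
  proof -
    have "has_bochner_integral lborel (\<lambda>u. exp ((s + 1) / 2 * of_real u - of_real (1 * exp u))) (Gamma ((s + 1) / 2) * exp (- ((s + 1) / 2) * of_real (ln 1)))"
      using that by (intro has_bochner_integral_Gamma_exp) auto
    then have "has_bochner_integral lborel (\<lambda>u. exp ((s + 1) / 2 * of_real u - of_real (exp u))) (Gamma ((s + 1) / 2))"
      by simp
    then have "has_bochner_integral lborel (\<lambda>v. exp ((s + 1) / 2 * of_real (q + 2 * v) - of_real (exp (q + 2 * v)))) (Gamma ((s + 1) / 2) /\<^sub>R \<bar>2\<bar>)"
      by (subst (asm) lborel_has_bochner_integral_real_affine_iff[where c = 2 and t = q]) auto
    from has_bochner_integral_mult_right[OF this, of "2 * exp ((1 - s) / 2 * of_real q - of_real (a\<^sup>2 * exp q))"]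
    show ?thesis by (simp add: f_def[abs_def] g_def scaleR_conv_of_real)
  qed
  have gI: "has_bochner_integral lborel (g s) (of_real pi / cos (of_real pi * s / 2) * exp ((s - 1) * of_real (ln a)))"
    if "-1 < Re s" "Re s < 1" for s
  proof -
    have "has_bochner_integral lborel (g s) (Gamma ((1 - s) / 2) * exp (- ((1 - s) / 2) * of_real (ln (a\<^sup>2))) * Gamma ((s + 1) / 2))"
      unfolding g_def using that a by (intro has_bochner_integral_mult_left has_bochner_integral_Gamma_exp) auto
    moreover have "- ((1 - s) / 2) * of_real (ln (a\<^sup>2)) = (s - 1) * of_real (ln a)"
      using a by (simp add: ln_realpow field_simps)
    ultimately show ?thesis
      unfolding Gamma_half_reflection[symmetric] by (simp add: mult_ac add_ac)
  qed
  have fn: "complex_of_real (norm (f s q v)) = f (of_real (Re s)) q v" for s q v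
  proof -
    have "f (of_real (Re s)) q v = of_real (2 * exp ((1 - Re s) / 2 * q - a\<^sup>2 * exp q) * exp ((Re s + 1) / 2 * (q + 2 * v) - exp (q + 2 * v)))"
      by (simp add: f_def exp_of_real[symmetric])
    moreover have "norm (f s q v) = 2 * exp ((1 - Re s) / 2 * q - a\<^sup>2 * exp q) * exp ((Re s + 1) / 2 * (q + 2 * v) - exp (q + 2 * v))"
      by (simp add: f_def norm_mult norm_exp_eq_Re)
    ultimately show ?thesis by simp
  qed
  show ?thesis
  proof (rule fubini_of_real_norm[where f = "f s" and g = "g s" and n = "g (of_real (Re s))"])
    show "(\<lambda>p. f s (fst p) (snd p)) \<in> borel_measurable borel"
      unfolding f_def by (intro borel_measurable_continuous_onI continuous_intros)
    show "has_bochner_integral lborel (f s u) (g s u)" for u using s by (intro fg)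
    show "has_bochner_integral lborel (\<lambda>v. complex_of_real (norm (f s u v))) (g (of_real (Re s)) u)" for u
      unfolding fn using fg[of "of_real (Re s)" u] s by simp
    show "integrable lborel (g (of_real (Re s)))"
      using gI[of "of_real (Re s)"] s by (simp add: has_bochner_integral_iff)
    show "has_bochner_integral lborel (g s) (of_real pi / cos (of_real pi * s / 2) * exp ((s - 1) * of_real (ln a)))"
      by (rule gI[OF s])
    fix v :: real
    let ?b = "(exp v)\<^sup>2 + a\<^sup>2"
    have b: "?b > 0" using a by (simp add: add_pos_pos)
    have "has_bochner_integral lborel (\<lambda>q. 2 * exp ((s + 1) * of_real v) * exp (1 * of_real q - of_real (?b * exp q)))
      (2 * exp ((s + 1) * of_real v) * (Gamma 1 * exp (- 1 * of_real (ln ?b))))"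
      using b by (intro has_bochner_integral_mult_right has_bochner_integral_Gamma_exp) auto
    also have "(\<lambda>q. 2 * exp ((s + 1) * of_real v) * exp (1 * of_real q - of_real (?b * exp q))) = (\<lambda>q. f s q v)"
    proof
      fix q :: real
      have e: "exp (q + 2 * v) = (exp v)\<^sup>2 * exp q" by (simp add: exp_add exp_double)
      show "2 * exp ((s + 1) * of_real v) * exp (1 * of_real q - of_real (?b * exp q)) = f s q v"
      proof -
        define d where "d = (s + 1) / 2"
        have d: "s + 1 = 2 * d" "(1 - s) / 2 = 1 - d" by (simp_all add: d_def field_simps)
        show ?thesis
          unfolding f_def e mult.assoc exp_add[symmetric] d_def[symmetric] unfolding d by (simp add: algebra_simps)
      qed
    qed
    also have "2 * exp ((s + 1) * of_real v) * (Gamma 1 * exp (- 1 * of_real (ln ?b))) = exp ((s + 1) * of_real v) * of_real (2 / ?b)"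
    proof -
      have "exp (- 1 * complex_of_real (ln ?b)) = of_real (exp (- ln ?b))" by (simp add: exp_of_real[symmetric])
      also have "exp (- ln ?b) = 1 / ?b" using b by (simp add: exp_minus inverse_eq_divide)
      finally show ?thesis by simp
    qed
    finally show "has_bochner_integral lborel (\<lambda>q. f s q v) (exp ((s + 1) * of_real v) * of_real (2 / ?b))" .
  qed
qed

text \<open>Logarithmic differentiation of the reflection formula for Gamma.\<close>

lemma Digamma_reflection:
  fixes z :: complex
  assumes z: "z \<notin> \<int>"
  shows "Digamma (1 - z) - Digamma z = of_real pi * cot (of_real pi * z)"
proof -
  have z1: "1 - z \<notin> \<int>" using z by (metis Ints_1 Ints_diff diff_diff_eq2 add_diff_cancel_left')
  have nz: "z \<notin> \<int>\<^sub>\<le>\<^sub>0" "1 - z \<notin> \<int>\<^sub>\<le>\<^sub>0" using z z1 nonpos_Ints_Int by blast+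
  have sn: "sin (of_real pi * z) \<noteq> 0" using z
    by (auto simp: sin_eq_0 Ints_def)
  have 1: "((\<lambda>z. Gamma z * Gamma (1 - z)) has_field_derivative (Gamma z * Gamma (1 - z) * (Digamma z - Digamma (1 - z)))) (at z)"
    using nz by (auto intro!: derivative_eq_intros simp: algebra_simps)
  have 2: "((\<lambda>z. of_real pi / sin (of_real pi * z)) has_field_derivative
       (- of_real pi * (of_real pi * cos (of_real pi * z)) / (sin (of_real pi * z))\<^sup>2)) (at z)"
    using sn by (auto intro!: derivative_eq_intros simp: power2_eq_square)
  have "Gamma z * Gamma (1 - z) * (Digamma z - Digamma (1 - z)) = - of_real pi * (of_real pi * cos (of_real pi * z)) / (sin (of_real pi * z))\<^sup>2"
    using 1 2 DERIV_unique unfolding Gamma_reflection_complex by blast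
  then have eq: "of_real pi / S * (Digamma z - Digamma (1 - z)) = - of_real pi * (of_real pi * C) / S\<^sup>2"
    if "S = sin (of_real pi * z)" "C = cos (of_real pi * z)" for S C
    unfolding Gamma_reflection_complex that .
  have "Digamma z - Digamma (1 - z) = - (of_real pi * (C / S))"
    if "S = sin (of_real pi * z)" "C = cos (of_real pi * z)" for S C
  proof -
    have S: "S \<noteq> 0" using sn that by simp
    have "Digamma z - Digamma (1 - z) = S / of_real pi * (of_real pi / S * (Digamma z - Digamma (1 - z)))"
      using S by simp
    also have "\<dots> = - (of_real pi * (C / S))"
      unfolding eq[OF that] using S by (simp add: power2_eq_square)
    finally show ?thesis .
  qed
  from this[OF refl refl] show ?thesis by (simp add: cot_def algebra_simps)
qed

text \<open>The \<open>Digamma\<close> series at 1 - z and 1 + z differ by the partial fractions;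
  passing from z to 1 + z splits off 1 / z.\<close>

lemma cot_partial_fractions:
  fixes z :: complex
  assumes z: "z \<notin> \<int>"
  shows "(\<lambda>n. 2 * z / (z\<^sup>2 - (of_nat (Suc n))\<^sup>2)) sums (of_real pi * cot (of_real pi * z) - 1 / z)"
proof -
  have z0: "z \<noteq> 0" using z by auto
  have nz: "z + of_nat (Suc n) \<noteq> 0" "of_nat (Suc n) - z \<noteq> 0" for n
    using z by (metis Ints_minus Ints_of_nat add_eq_0_iff2 minus_minus, metis Ints_of_nat eq_iff_diff_eq_0)
  have ne: "1 + z \<noteq> 0" "1 - z \<noteq> 0" using nz[of 0] by (simp_all add: add_ac)
  have S: "(\<lambda>n. inverse (of_nat (Suc n)) - inverse (w + of_nat n)) sums (Digamma w + euler_mascheroni)" if "w \<noteq> 0" for w :: complex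
    using summable_sums[OF summable_Digamma[OF that]] by (simp add: Digamma_def)
  have "(\<lambda>n. (inverse (of_nat (Suc n)) - inverse ((1 - z) + of_nat n)) - (inverse (of_nat (Suc n)) - inverse ((1 + z) + of_nat n)))
     sums ((Digamma (1 - z) + euler_mascheroni) - (Digamma (1 + z) + euler_mascheroni))"
    by (intro sums_diff S ne)
  also have "(\<lambda>n. (inverse (of_nat (Suc n)) - inverse ((1 - z) + of_nat n)) - (inverse (of_nat (Suc n)) - inverse ((1 + z) + of_nat n)))
     = (\<lambda>n. 2 * z / (z\<^sup>2 - (of_nat (Suc n))\<^sup>2))"
  proof
    fix n
    let ?k = "of_nat (Suc n) :: complex"
    have a: "(1 - z) + of_nat n = ?k - z" "(1 + z) + of_nat n = z + ?k" by simp_all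
    have b: "z\<^sup>2 - ?k\<^sup>2 = - ((z + ?k) * (?k - z))" by (simp only: power2_eq_square) (simp add: algebra_simps)
    have c: "(inverse K - inverse b) - (inverse K - inverse a) = (b - a) / (a * b)" if "a \<noteq> 0" "b \<noteq> 0" for a b K :: complex
      using that by (simp add: field_simps)
    have d: "(?k - z) - (z + ?k) = - (2 * z)" by (simp add: algebra_simps)
    show "(inverse ?k - inverse ((1 - z) + of_nat n)) - (inverse ?k - inverse ((1 + z) + of_nat n)) = 2 * z / (z\<^sup>2 - ?k\<^sup>2)"
      unfolding a b c[OF nz(1)[of n] nz(2)[of n]] d by (simp only: minus_divide_left[symmetric] minus_divide_right[symmetric])
  qed
  also have "(Digamma (1 - z) + euler_mascheroni) - (Digamma (1 + z) + euler_mascheroni) = of_real pi * cot (of_real pi * z) - 1 / z"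
    using Digamma_reflection[OF z] Digamma_plus1[OF z0] by (simp add: algebra_simps)
  finally show ?thesis .
qed

text \<open>At the imaginary point z = i t / (2 pi) the cotangent is, up to the factor - i, the
  hyperbolic cotangent of t / 2, which equals 1 + 2 / (exp t - 1). Everything there is purely
  imaginary, so imaginary parts times - 1 / (2 pi) carry the whole identity.\<close>

lemma coth_partial_fractions:
  assumes t: "t > 0"
  shows "(\<lambda>k. t * (2 / (t\<^sup>2 + (2 * pi * real (Suc k))\<^sup>2))) sums (1 / (exp t - 1) + 1 / 2 - 1 / t)"
proof -
  define y where "y = t / (2 * pi)"
  define z where "z = \<i> * of_real y"
  have y: "y > 0" "t = 2 * pi * y" using t by (simp_all add: y_def)
  have z: "z \<notin> \<int>" using y by (auto simp: z_def Ints_def complex_eq_iff)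
  have "(\<lambda>n. Im (2 * z / (z\<^sup>2 - (of_nat (Suc n))\<^sup>2)) * (- 1 / (2 * pi))) sums (Im (of_real pi * cot (of_real pi * z) - 1 / z) * (- 1 / (2 * pi)))"
    by (intro sums_mult2 sums_Im cot_partial_fractions z)
  also have "(\<lambda>n. Im (2 * z / (z\<^sup>2 - (of_nat (Suc n))\<^sup>2)) * (- 1 / (2 * pi))) = (\<lambda>k. t * (2 / (t\<^sup>2 + (2 * pi * real (Suc k))\<^sup>2)))"
  proof
    fix n
    let ?N = "real (Suc n)"
    define P where "P = y\<^sup>2 + ?N\<^sup>2"
    have p: "P > 0" unfolding P_def by (intro add_nonneg_pos) auto
    have "z\<^sup>2 - (of_nat (Suc n))\<^sup>2 = - of_real P"
      unfolding z_def P_def power_mult_distrib by simp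
    then have "2 * z / (z\<^sup>2 - (of_nat (Suc n))\<^sup>2) = - \<i> * of_real (2 * y / P)"
      unfolding z_def by simp
    then have "Im (2 * z / (z\<^sup>2 - (of_nat (Suc n))\<^sup>2)) = - (2 * y / P)"
      by simp
    also have "\<dots> = - 2 * pi * (t * (2 / (t\<^sup>2 + (2 * pi * ?N)\<^sup>2)))"
    proof -
      have "t\<^sup>2 + (2 * pi * ?N)\<^sup>2 = (2 * pi)\<^sup>2 * P"
        unfolding y(2) P_def by (simp only: power_mult_distrib distrib_left)
      then show ?thesis unfolding y(2)
        using p by (simp add: field_simps power2_eq_square)
    qed
    finally have Im_eq: "Im (2 * z / (z\<^sup>2 - (of_nat (Suc n))\<^sup>2)) = - 2 * pi * (t * (2 / (t\<^sup>2 + (2 * pi * ?N)\<^sup>2)))" .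
    show "Im (2 * z / (z\<^sup>2 - (of_nat (Suc n))\<^sup>2)) * (- 1 / (2 * pi)) = t * (2 / (t\<^sup>2 + (2 * pi * ?N)\<^sup>2))"
    proof -
      have "- 2 * pi * W * (- 1 / (2 * pi)) = W" for W by simp
      then show ?thesis using Im_eq by (simp only:)
    qed
  qed
  also have "Im (of_real pi * cot (of_real pi * z) - 1 / z) * (- 1 / (2 * pi)) = 1 / (exp t - 1) + 1 / 2 - 1 / t"
  proof -
    let ?e = "exp (t / 2)"
    have e1: "?e > 1" using t by simp
    have et: "exp t = ?e * ?e" by (simp add: exp_add[symmetric])
    have pz: "of_real pi * z = \<i> * of_real (t / 2)" by (simp add: z_def y)
    have ex: "exp (\<i> * (\<i> * of_real (t / 2))) = complex_of_real (1 / ?e)" "exp (- (\<i> * (\<i> * of_real (t / 2)))) = complex_of_real ?e"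
      by (simp_all add: exp_of_real[symmetric] exp_minus inverse_eq_divide mult.assoc[symmetric])
    have c: "cos (\<i> * of_real (t / 2)) = of_real ((1 / ?e + ?e) / 2)" and sn: "sin (\<i> * of_real (t / 2)) = - \<i> * of_real ((1 / ?e - ?e) / 2)"
      unfolding cos_exp_eq sin_exp_eq ex by (simp_all add: field_simps)
    have ct: "cot (of_real pi * z) = - \<i> * of_real ((1 / ?e + ?e) / (?e - 1 / ?e))"
    proof -
      have "- \<i> * of_real ((1 / ?e - ?e) / 2) = \<i> * of_real ((?e - 1 / ?e) / 2)" by (simp add: field_simps)
      moreover have "?e - 1 / ?e \<noteq> 0"
      proof -
        have "1 / ?e < 1" using e1 by simp
        then show ?thesis using e1 by linarith
      qed
      moreover have "of_real (N / 2) / (\<i> * of_real (D / 2)) = - \<i> * of_real (N / D)" if "D \<noteq> 0" for N D :: real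
        using that by (simp add: field_simps)
      ultimately show ?thesis unfolding pz cot_def c sn by (simp only:)
    qed
    have "1 / z = - \<i> * of_real (1 / y)"
      using y by (simp add: z_def field_simps)
    then have "of_real pi * cot (of_real pi * z) - 1 / z = \<i> * of_real (- pi * ((1 / ?e + ?e) / (?e - 1 / ?e)) + 1 / y)"
      unfolding ct by (simp add: algebra_simps)
    then have "Im (of_real pi * cot (of_real pi * z) - 1 / z) = - pi * ((1 / ?e + ?e) / (?e - 1 / ?e)) + 1 / y"
      by (simp only: Im_i_times Re_complex_of_real)
    also have "1 / y = 2 * pi / t" using y by simp
    finally have "Im (of_real pi * cot (of_real pi * z) - 1 / z) = - pi * ((1 / ?e + ?e) / (?e - 1 / ?e)) + 2 * pi / t" .
    moreover have "(- pi * ((1 / E + E) / (E - 1 / E)) + 2 * pi / t) * (- 1 / (2 * pi)) = 1 / (E * E - 1) + 1 / 2 - 1 / t" if "E > 1" for E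
    proof -
      have "E * E > 1" using that by (metis less_1_mult)
      then have "E * E - 1 \<noteq> 0" "E \<noteq> 0" using that by auto
      moreover have "(1 / E + E) / (E - 1 / E) = (1 + E * E) / (E * E - 1)" using that \<open>E * E > 1\<close> by (simp add: field_simps)
      moreover have "(1 + E * E) / (E * E - 1) = 1 + 2 * (1 / (E * E - 1))" using \<open>E * E - 1 \<noteq> 0\<close> by (simp add: field_simps)
      moreover have "(- pi * (1 + 2 * W) + 2 * pi / t) * (- 1 / (2 * pi)) = W + 1 / 2 - 1 / t" for W
        using t by (simp add: field_simps)
      ultimately show ?thesis by (simp only:)
    qed
    ultimately show ?thesis unfolding et using e1 by simp
  qed
  finally show ?thesis .
qed


text \<open>Each partial fraction is the quadratic Mellin integral with a = 2 pi (k + 1), whose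
  value contains a powr (s - 1); these powers add up to zeta at 1 - s.\<close>

lemma has_bochner_integral_bernoulli_mellin_reflected:
  assumes s: "-1 < Re s" "Re s < 0"
  shows "has_bochner_integral lborel (\<lambda>v. exp (s * of_real v) * of_real (1 / (exp (exp v) - 1) + 1 / 2 - 1 / exp v))
     (of_real pi / cos (of_real pi * s / 2) * (exp ((s - 1) * of_real (ln (2 * pi))) * (zeta_reg (1 - s) / (- s))))"
proof (rule has_bochner_integral_sums)
  let ?a = "\<lambda>k. 2 * pi * real (Suc k)"
  let ?f = "\<lambda>s k v. exp ((s + 1) * complex_of_real v) * of_real (2 / ((exp v)\<^sup>2 + (?a k)\<^sup>2))"
  let ?I = "\<lambda>s k. of_real pi / cos (of_real pi * s / 2) * exp ((s - 1) * complex_of_real (ln (?a k)))"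
  have n: "complex_of_real (norm (?f s k v)) = ?f (of_real (Re s)) k v" for k v
  proof -
    have "(exp v)\<^sup>2 + (?a k)\<^sup>2 \<ge> 0" by (intro add_nonneg_nonneg) auto
    then have "norm (complex_of_real (2 / ((exp v)\<^sup>2 + (?a k)\<^sup>2))) = 2 / ((exp v)\<^sup>2 + (?a k)\<^sup>2)"
      unfolding norm_of_real by (intro abs_of_nonneg) auto
    moreover have "norm (exp ((s + 1) * complex_of_real v)) = exp ((Re s + 1) * v)"
      by (simp add: norm_exp_eq_Re)
    moreover have "complex_of_real (exp ((Re s + 1) * v)) = exp ((of_real (Re s) + 1) * of_real v)"
      by (simp add: exp_of_real[symmetric])
    ultimately show ?thesis unfolding norm_mult of_real_mult by (simp only:)
  qed
  show "has_bochner_integral lborel (?f s k) (?I s k)" for k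
    using s by (intro has_bochner_integral_powr_over_quadratic) auto
  show "has_bochner_integral lborel (\<lambda>v. complex_of_real (norm (?f s k v))) (?I (of_real (Re s)) k)" for k
    unfolding n using s by (intro has_bochner_integral_powr_over_quadratic) auto
  have sumI: "?I s sums (of_real pi / cos (of_real pi * s / 2) * (exp ((s - 1) * of_real (ln (2 * pi))) * (zeta_reg (1 - s) / (- s))))"
    if s: "Re s < 0" for s
  proof -
    have e: "exp ((s - 1) * complex_of_real (ln (?a k))) = exp ((s - 1) * of_real (ln (2 * pi))) * (1 / of_nat (Suc k) powr (1 - s))" for k
    proof -
      have "ln (?a k) = ln (2 * pi) + ln (real (Suc k))" by (intro ln_mult_pos) (simp_all del: of_nat_Suc)
      then have "exp ((s - 1) * complex_of_real (ln (?a k))) = exp ((s - 1) * of_real (ln (2 * pi))) * exp ((s - 1) * of_real (ln (real (Suc k))))"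
        by (simp only: of_real_add distrib_left exp_add)
      also have "exp ((s - 1) * of_real (ln (real (Suc k)))) = of_real (real (Suc k)) powr (- (1 - s))"
        by (subst of_real_powr_eq_exp) auto
      also have "\<dots> = 1 / of_nat (Suc k) powr (1 - s)"
        unfolding powr_minus_divide of_real_of_nat_eq ..
      finally show ?thesis .
    qed
    have "(\<lambda>k. 1 / of_nat (Suc k) powr (1 - s)) sums (zeta_reg (1 - s) / (- s))"
      using zeta_reg_dirichlet_sums[of "1 - s"] s by simp
    then show ?thesis unfolding e by (intro sums_mult)
  qed
  show "summable (?I (of_real (Re s)))" using sumI[of "of_real (Re s)"] s by (simp add: sums_iff)
  show "?I s sums (of_real pi / cos (of_real pi * s / 2) * (exp ((s - 1) * of_real (ln (2 * pi))) * (zeta_reg (1 - s) / (- s))))"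
    using s by (intro sumI)
  have ts: "(\<lambda>k. exp v * (2 / ((exp v)\<^sup>2 + (?a k)\<^sup>2))) sums (1 / (exp (exp v) - 1) + 1 / 2 - 1 / exp v)" for v
    by (rule coth_partial_fractions) simp
  have fe: "?f s k v = exp (s * of_real v) * of_real (exp v * (2 / ((exp v)\<^sup>2 + (?a k)\<^sup>2)))" for k v
  proof -
    have "exp ((s + 1) * complex_of_real v) = exp (s * of_real v) * of_real (exp v)"
      by (simp only: distrib_right exp_add exp_of_real mult_1)
    then show ?thesis by simp
  qed
  show "(\<lambda>k. ?f s k v) sums (exp (s * of_real v) * of_real (1 / (exp (exp v) - 1) + 1 / 2 - 1 / exp v))" for v
    unfolding fe by (intro sums_mult sums_of_real ts)
  show "summable (\<lambda>k. norm (?f s k v))" for v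
  proof -
    have "\<bar>exp v * (2 / ((exp v)\<^sup>2 + (?a k)\<^sup>2))\<bar> = exp v * (2 / ((exp v)\<^sup>2 + (?a k)\<^sup>2))" for k
      by (intro abs_of_nonneg mult_nonneg_nonneg divide_nonneg_nonneg add_nonneg_nonneg) auto
    then show ?thesis
      unfolding fe norm_mult norm_of_real using ts[of v] by (intro summable_mult) (simp only: sums_iff)
  qed
qed

text \<open>On -1 < Re s < 0 two evaluations of one Mellin integral agree. With denominators
  cleared, and Gamma (s + 2) in place of Gamma s, both sides are holomorphic as long as s and 1 - s
  have real part above -1, which is the strip in the hypotheses.\<close>

theorem zeta_reg_reflection:
  assumes "-1 < Re s" "Re s < 2"
  shows "zeta_reg s * Gamma (s + 2) * cos (of_real pi * s / 2)
    = - ((s - 1) * (s + 1) * (of_real pi * (exp ((s - 1) * of_real (ln (2 * pi))) * zeta_reg (1 - s))))"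
proof (rule analytic_continuation_open[where f = "\<lambda>s. zeta_reg s * Gamma (s + 2) * cos (of_real pi * s / 2)"
      and g = "\<lambda>s. - ((s - 1) * (s + 1) * (of_real pi * (exp ((s - 1) * of_real (ln (2 * pi))) * zeta_reg (1 - s))))"
      and s = "{s. -1 < Re s} \<inter> {s. Re s < 0}" and s' = "{s. -1 < Re s} \<inter> {s. Re s < 2}"])
  show "open ({s. -1 < Re s} \<inter> {s. Re s < 0})" "open ({s. -1 < Re s} \<inter> {s. Re s < 2})"
    by (intro open_Int open_halfspace_Re_gt open_halfspace_Re_lt)+
  show "connected ({s. -1 < Re s} \<inter> {s. Re s < 2})"
    by (intro convex_connected convex_Int convex_halfspace_Re_gt convex_halfspace_Re_lt)
  have "- (1 / 2) \<in> {s. -1 < Re s} \<inter> {s. Re s < 0}" by simp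
  then show "{s. -1 < Re s} \<inter> {s. Re s < 0} \<noteq> {}" by blast
  show "{s. -1 < Re s} \<inter> {s. Re s < 0} \<subseteq> {s. -1 < Re s} \<inter> {s. Re s < 2}" by auto
  have nz: "s + 2 \<notin> \<int>\<^sub>\<le>\<^sub>0" if "-1 < Re s" for s :: complex
    using that by (auto elim!: nonpos_Ints_cases simp: complex_eq_iff)
  show "(\<lambda>s. zeta_reg s * Gamma (s + 2) * cos (of_real pi * s / 2)) holomorphic_on {s. -1 < Re s} \<inter> {s. Re s < 2}"
    by (intro holomorphic_intros nz) simp_all
  show "(\<lambda>s. - ((s - 1) * (s + 1) * (of_real pi * (exp ((s - 1) * of_real (ln (2 * pi))) * zeta_reg (1 - s)))))
      holomorphic_on {s. -1 < Re s} \<inter> {s. Re s < 2}"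
    by (intro holomorphic_intros) auto
  show "s \<in> {s. -1 < Re s} \<inter> {s. Re s < 2}" using assms by simp
  fix s assume "s \<in> {s. -1 < Re s} \<inter> {s. Re s < 0}"
  then have s: "-1 < Re s" "Re s < 0" by auto
  have "Gamma (s + 2) * (zeta_reg s / ((s - 1) * s * (s + 1)))
     = of_real pi / cos (of_real pi * s / 2) * (exp ((s - 1) * of_real (ln (2 * pi))) * (zeta_reg (1 - s) / (- s)))"
    using has_bochner_integral_eq[OF has_bochner_integral_bernoulli_mellin[OF s] has_bochner_integral_bernoulli_mellin_reflected[OF s]] .
  moreover have "cos (of_real pi * s / 2) \<noteq> 0" using s by (intro cos_half_pi_nonzero) auto
  moreover have "s - 1 \<noteq> 0" "s \<noteq> 0" "s + 1 \<noteq> 0" using strip_nonzero[OF s] by auto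
  moreover have "G * (z / (a * s * b)) = p / c * (e * (z' / (- s))) \<Longrightarrow> c \<noteq> 0 \<Longrightarrow> a \<noteq> 0 \<Longrightarrow> b \<noteq> 0 \<Longrightarrow> s \<noteq> 0 \<Longrightarrow>
      z * G * c = - (a * b * (p * (e * z')))" for G z a b p c e z' :: complex
    by (simp add: field_simps)
  ultimately show "zeta_reg s * Gamma (s + 2) * cos (of_real pi * s / 2)
    = - ((s - 1) * (s + 1) * (of_real pi * (exp ((s - 1) * of_real (ln (2 * pi))) * zeta_reg (1 - s))))"
    by blast
qed

section \<open>The zeta function and the divisor series\<close>

text \<open>What is chosen by \<open>SOME\<close> has its defining property only if something has
  it, so a continuation to the whole plane without 1 is exhibited:
  \<open>zeta_reg s / (s - 1)\<close> on the right, glued to the functional equation on the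
  left.\<close>

lemma riemann_zeta_spec:
  "riemann_zeta holomorphic_on (- {1}) \<and> (\<forall>s. Re s > 1 \<longrightarrow> (\<lambda>n. 1 / of_nat (Suc n) powr s) sums riemann_zeta s)"
proof -
  \<comment> \<open>The functional equation solved for zeta at s; for Re s < 0 the point 1 - s has
    real part above 1.\<close>
  define h where "h s = 2 * exp ((s - 1) * of_real (ln (2 * pi))) * sin (of_real pi * s / 2) * Gamma (1 - s) * (zeta_reg (1 - s) / (- s))" for s
  define f where "f s = (if Re s > -1 then zeta_reg s / (s - 1) else h s)" for s
  let ?A = "{s. Re s > -1} - {1}" and ?B = "{s :: complex. Re s < 0}"
  \<comment> \<open>On the overlap -1 < Re s < 0 the cosine form of the reflection becomes the sine
    form through Gamma s * Gamma (1 - s) = pi / sin (pi s) and the double angle formula. This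
    agreement makes the glued function holomorphic.\<close>
  have fh: "f s = h s" if s: "Re s < 0" for s
  proof (cases "Re s > -1")
    case True
    have ints: "s \<notin> \<int>\<^sub>\<le>\<^sub>0" "s + 1 \<notin> \<int>\<^sub>\<le>\<^sub>0"
      using True s by (auto elim!: nonpos_Ints_cases) (simp add: complex_eq_iff)
    have G: "Gamma (s + 2) = (s + 1) * (s * Gamma s)"
      using Gamma_plus1[OF ints(1)] Gamma_plus1[OF ints(2)] by (simp add: add.assoc)
    define S C where "S = sin (of_real pi * s / 2)" and "C = cos (of_real pi * s / 2)"
    have C0: "C \<noteq> 0" unfolding C_def using True s by (intro cos_half_pi_nonzero) auto
    have "sin (of_real pi * s) = 2 * S * C"
      using sin_double[of "of_real pi * s / 2"] by (simp add: S_def C_def)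
    then have R: "Gamma s * Gamma (1 - s) = of_real pi / (2 * S * C)"
      using Gamma_reflection_complex[of s] by simp
    have "Gamma s \<noteq> 0" using ints(1) by (simp add: Gamma_eq_zero_iff)
    moreover have "Gamma (1 - s) \<noteq> 0"
      unfolding Gamma_eq_zero_iff using s by (intro not_nonpos_Ints_if_Re_pos) simp
    ultimately have S0: "S \<noteq> 0" using R by auto
    have nz: "s - 1 \<noteq> 0" "s \<noteq> 0" "s + 1 \<noteq> 0" using strip_nonzero[of s] True s by auto
    define e where "e = exp ((s - 1) * complex_of_real (ln (2 * pi)))"
    have "zeta_reg s * ((s + 1) * (s * Gamma s)) * C = - ((s - 1) * (s + 1) * (of_real pi * (e * zeta_reg (1 - s))))"
      using zeta_reg_reflection[of s] True s by (simp add: G C_def e_def)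
    then have "zeta_reg s * ((s + 1) * (s * Gamma s)) * C * Gamma (1 - s) = - ((s - 1) * (s + 1) * (of_real pi * (e * zeta_reg (1 - s)))) * Gamma (1 - s)"
      by simp
    then have eq: "zeta_reg s * (s + 1) * s * C * (Gamma s * Gamma (1 - s)) = - ((s - 1) * (s + 1) * (of_real pi * (e * zeta_reg (1 - s)))) * Gamma (1 - s)"
      by (simp only: mult_ac)
    have "((s + 1) * of_real pi) * (zeta_reg s * s / (2 * S)) = zeta_reg s * (s + 1) * s * C * (of_real pi / (2 * S * C))"
      using C0 S0 by (simp add: field_simps)
    also have "\<dots> = - ((s - 1) * (s + 1) * (of_real pi * (e * zeta_reg (1 - s)))) * Gamma (1 - s)"
      unfolding R[symmetric] by (rule eq)
    also have "\<dots> = ((s + 1) * of_real pi) * (- ((s - 1) * e * zeta_reg (1 - s)) * Gamma (1 - s))"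
      by (simp add: mult_ac)
    finally have eq2: "((s + 1) * of_real pi) * (zeta_reg s * s / (2 * S)) = ((s + 1) * of_real pi) * (- ((s - 1) * e * zeta_reg (1 - s)) * Gamma (1 - s))" .
    have "(s + 1) * of_real pi \<noteq> 0" using nz by simp
    then have "zeta_reg s * s / (2 * S) = - ((s - 1) * e * zeta_reg (1 - s)) * Gamma (1 - s)"
      using eq2 by (rule mult_left_cancel[THEN iffD1])
    then have "zeta_reg s / (s - 1) = h s"
      unfolding h_def S_def[symmetric] e_def[symmetric] using nz S0 by (simp add: field_simps)
    then show ?thesis using True by (simp add: f_def)
  qed (simp add: f_def)
  have A: "open ?A" by (intro open_Diff open_halfspace_Re_gt) auto
  have B: "open ?B" by (rule open_halfspace_Re_lt)
  have "(\<lambda>s. zeta_reg s / (s - 1)) holomorphic_on ?A"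
    by (intro holomorphic_intros) auto
  then have fA: "f holomorphic_on ?A" by (rule holomorphic_transform) (simp add: f_def)
  have "h holomorphic_on ?B"
    unfolding h_def by (intro holomorphic_intros not_nonpos_Ints_if_Re_pos) auto
  then have fB: "f holomorphic_on ?B" by (rule holomorphic_transform) (simp add: fh)
  have "f holomorphic_on (?A \<union> ?B)" by (rule holomorphic_on_Un[OF fA fB A B])
  moreover have "?A \<union> ?B = - {1}" by auto
  ultimately have "f holomorphic_on (- {1})" by simp
  moreover have "(\<lambda>n. 1 / of_nat (Suc n) powr s) sums f s" if "Re s > 1" for s
    using zeta_reg_dirichlet_sums[OF that] that by (simp add: f_def)
  ultimately show ?thesis
    unfolding riemann_zeta_def
    by (intro someI[of "\<lambda>f. f holomorphic_on (- {1}) \<and> (\<forall>s. Re s > 1 \<longrightarrow> (\<lambda>n. 1 / of_nat (Suc n) powr s) sums f s)" f]) auto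
qed

lemma riemann_zeta_sums: "Re s > 1 \<Longrightarrow> (\<lambda>n. 1 / of_nat (Suc n) powr s) sums riemann_zeta s"
  using riemann_zeta_spec by blast

lemma holomorphic_riemann_zeta [holomorphic_intros]:
  assumes "f holomorphic_on A" "\<And>z. z \<in> A \<Longrightarrow> f z \<noteq> 1"
  shows "(\<lambda>z. riemann_zeta (f z)) holomorphic_on A"
proof -
  have "f ` A \<subseteq> - {1}" using assms(2) by auto
  then show ?thesis
    using holomorphic_on_compose_gen[OF assms(1), of riemann_zeta "- {1}"] riemann_zeta_spec
    by (simp add: o_def)
qed

text \<open>The identity theorem removes the ambiguity of the choice; a half-plane stays connected
  when a point is deleted.\<close>

lemma riemann_zeta_eq_zeta_reg:
  assumes "Re s > -1" "s \<noteq> 1"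
  shows "riemann_zeta s = zeta_reg s / (s - 1)"
proof (rule analytic_continuation_open[where f = riemann_zeta and g = "\<lambda>s. zeta_reg s / (s - 1)"
      and s = "{s. Re s > 1}" and s' = "{s. Re s > -1} - {1}"])
  show "open {s. Re s > 1}" by (rule open_halfspace_Re_gt)
  show "open ({s. Re s > -1} - {1})" by (intro open_Diff open_halfspace_Re_gt) auto
  have "2 \<in> {s. Re s > 1}" by simp
  then show "{s. Re s > 1} \<noteq> {}" by blast
  show "connected ({s. Re s > -1} - {1})"
    by (intro connected_open_delete open_halfspace_Re_gt convex_connected convex_halfspace_Re_gt) auto
  show "{s. Re s > 1} \<subseteq> {s. Re s > -1} - {1}" by auto
  show "riemann_zeta holomorphic_on {s. Re s > -1} - {1}"
    using holomorphic_riemann_zeta[OF holomorphic_on_id] by (auto simp: id_def)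
  show "(\<lambda>s. zeta_reg s / (s - 1)) holomorphic_on {s. Re s > -1} - {1}"
    by (intro holomorphic_intros) auto
  show "s \<in> {s. Re s > -1} - {1}" using assms by simp
  fix z :: complex assume "z \<in> {s. Re s > 1}"
  then show "riemann_zeta z = zeta_reg z / (z - 1)"
    using sums_unique2[OF riemann_zeta_sums zeta_reg_dirichlet_sums] by simp
qed

text \<open>Trades zeta (1 - s), which arises in a residue, for Gamma s * zeta s, which is how f is
  stated. At s = 0 both Gamma s and zeta (1 - s) have poles.\<close>

lemma riemann_zeta_reflection:
  assumes s: "-1 < Re s" "Re s < 1" "s \<noteq> 0"
  shows "riemann_zeta (1 - s) = 2 * exp (- s * of_real (ln (2 * pi))) * cos (of_real pi * s / 2) * Gamma s * riemann_zeta s"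
proof -
  have ints: "s \<notin> \<int>\<^sub>\<le>\<^sub>0" "s + 1 \<notin> \<int>\<^sub>\<le>\<^sub>0"
    using s by (auto elim!: nonpos_Ints_cases) (simp add: complex_eq_iff)
  have G: "Gamma (s + 2) = (s + 1) * (s * Gamma s)"
    using Gamma_plus1[OF ints(1)] Gamma_plus1[OF ints(2)] by (simp add: add.assoc)
  have nz: "s - 1 \<noteq> 0" "s \<noteq> 0" "s + 1 \<noteq> 0" using s ints by auto
  define e where "e = exp (s * complex_of_real (ln (2 * pi)))"
  have e0: "e \<noteq> 0" by (simp add: e_def)
  have e1: "exp ((s - 1) * complex_of_real (ln (2 * pi))) = e / of_real (2 * pi)"
    by (simp add: e_def left_diff_distrib exp_diff exp_of_real)
  have e2: "exp (- s * complex_of_real (ln (2 * pi))) = 1 / e"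
    by (simp add: e_def exp_minus inverse_eq_divide)
  have z1: "riemann_zeta s = zeta_reg s / (s - 1)" using s by (intro riemann_zeta_eq_zeta_reg) auto
  have z2: "riemann_zeta (1 - s) = zeta_reg (1 - s) / (- s)" using s riemann_zeta_eq_zeta_reg[of "1 - s"] by simp
  define C where "C = cos (of_real pi * s / 2)"
  have "zeta_reg s * ((s + 1) * (s * Gamma s)) * C = - ((s - 1) * (s + 1) * (of_real pi * (e / of_real (2 * pi) * zeta_reg (1 - s))))"
    using zeta_reg_reflection[of s] s by (simp add: G C_def e1)
  then have "(s + 1) * (zeta_reg s * s * Gamma s * C) = (s + 1) * (- ((s - 1) * (e / 2 * zeta_reg (1 - s))))"
    by (simp add: algebra_simps)
  then have "zeta_reg s * s * Gamma s * C = - ((s - 1) * (e / 2 * zeta_reg (1 - s)))"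
    by (rule mult_left_cancel[OF nz(3), THEN iffD1])
  then show ?thesis
    unfolding z1 z2 e2 C_def[symmetric] using nz e0 by (simp add: field_simps)
qed

text \<open>Duplication of Gamma at u / 2 makes the functional equation symmetric, and reflection at
  (1 + u) / 2 cancels the cosine. All powers of 2 and pi are written as exponentials, so that
  collecting them is a single identity of exponents.\<close>

lemma completed_zeta_reflection:
  fixes u :: complex
  assumes u: "0 < Re u" "Re u < 1"
  defines "L \<equiv> \<lambda>u. exp (- (u / 2) * of_real (ln pi)) * Gamma (u / 2) * riemann_zeta u"
  shows "L (1 - u) = L u"
proof -
  have "Gamma (u / 2) * Gamma (u / 2 + 1 / 2) = exp ((1 - 2 * (u / 2)) * of_real (ln 2)) * of_real (sqrt pi) * Gamma (2 * (u / 2))"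
    using u by (intro Gamma_legendre_duplication not_nonpos_Ints_if_Re_pos) auto
  then have dup: "Gamma (u / 2) * Gamma ((1 + u) / 2) = exp ((1 - u) * of_real (ln 2)) * of_real (sqrt pi) * Gamma u"
    by (simp add: add_divide_distrib add.commute)
  have sq: "of_real (sqrt pi) = exp (1 / 2 * complex_of_real (ln pi))"
  proof -
    have "exp (ln (sqrt pi)) = sqrt pi" by simp
    moreover have "ln (sqrt pi) = ln pi / 2" by (rule ln_sqrt) simp
    ultimately have "sqrt pi = exp (ln pi / 2)" by simp
    then show ?thesis by (simp add: exp_of_real[symmetric])
  qed
  have pi_exp: "of_real pi = exp (complex_of_real (ln pi))" by (simp add: exp_of_real)
  have l2: "complex_of_real (ln (2 * pi)) = of_real (ln 2) + of_real (ln pi)" by (simp add: ln_mult)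
  define c where "c = cos (of_real pi * u / 2)"
  have c0: "c \<noteq> 0" unfolding c_def using u by (intro cos_half_pi_nonzero) auto
  have refl: "Gamma ((1 + u) / 2) * Gamma ((1 - u) / 2) = of_real pi / c"
    unfolding c_def by (rule Gamma_half_reflection)
  have zr: "riemann_zeta (1 - u) = 2 * exp (- u * of_real (ln (2 * pi))) * c * Gamma u * riemann_zeta u"
    unfolding c_def using u by (intro riemann_zeta_reflection) auto
  have two: "(2 :: complex) = exp (of_real (ln 2))" by (simp add: exp_of_real)
  have "L (1 - u) = exp (- ((1 - u) / 2) * of_real (ln pi)) * Gamma ((1 - u) / 2) * (2 * exp (- u * of_real (ln (2 * pi))) * c * Gamma u * riemann_zeta u)"
    by (simp add: L_def zr)
  also have "\<dots> = exp (- ((1 - u) / 2) * of_real (ln pi)) * exp (of_real (ln 2)) * exp (- u * (of_real (ln 2) + of_real (ln pi))) * exp (- (1 - u) * of_real (ln 2)) * exp (- (1 / 2) * of_real (ln pi))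
      * (exp ((1 - u) * of_real (ln 2)) * of_real (sqrt pi) * Gamma u) * Gamma ((1 - u) / 2) * c * riemann_zeta u"
  proof -
    have "exp (- (1 - u) * of_real (ln 2)) * exp (- (1 / 2) * of_real (ln pi)) * (exp ((1 - u) * of_real (ln 2)) * of_real (sqrt pi)) = (1 :: complex)"
      unfolding sq mult.assoc[symmetric] exp_add[symmetric] by (simp add: algebra_simps)
    then show ?thesis unfolding l2 two[symmetric] by (simp add: algebra_simps)
  qed
  also have "\<dots> = exp (- ((1 - u) / 2) * of_real (ln pi)) * exp (of_real (ln 2)) * exp (- u * (of_real (ln 2) + of_real (ln pi))) * exp (- (1 - u) * of_real (ln 2)) * exp (- (1 / 2) * of_real (ln pi))
      * (Gamma (u / 2) * (Gamma ((1 + u) / 2) * Gamma ((1 - u) / 2))) * c * riemann_zeta u"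
    unfolding dup[symmetric] by (simp only: mult_ac)
  also have "\<dots> = exp (- ((1 - u) / 2) * of_real (ln pi)) * exp (of_real (ln 2)) * exp (- u * (of_real (ln 2) + of_real (ln pi))) * exp (- (1 - u) * of_real (ln 2)) * exp (- (1 / 2) * of_real (ln pi)) * exp (of_real (ln pi))
      * (Gamma (u / 2) * riemann_zeta u)"
    unfolding refl pi_exp[symmetric] using c0 by simp
  also have "exp (- ((1 - u) / 2) * of_real (ln pi)) * exp (of_real (ln 2)) * exp (- u * (of_real (ln 2) + of_real (ln pi))) * exp (- (1 - u) * of_real (ln 2)) * exp (- (1 / 2) * of_real (ln pi)) * exp (of_real (ln pi))
     = exp (- (u / 2) * complex_of_real (ln pi))"
    unfolding exp_add[symmetric] by (rule arg_cong[of _ _ exp]) (simp add: field_simps)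
  finally show ?thesis by (simp add: L_def)
qed

lemma norm_riemann_zeta_le:
  "\<exists>C>0. \<forall>s. Re s \<ge> 0 \<and> norm (s - 1) \<ge> 1 \<longrightarrow> norm (riemann_zeta s) \<le> C * (1 + norm s) ^ 3"
proof -
  obtain C where C: "C > 0" "\<And>s. Re s \<ge> 0 \<Longrightarrow> norm (zeta_reg s) \<le> C * (1 + norm s) ^ 3"
    using norm_zeta_reg_le by blast
  have "norm (riemann_zeta s) \<le> C * (1 + norm s) ^ 3" if "Re s \<ge> 0" "norm (s - 1) \<ge> 1" for s
  proof -
    have "s \<noteq> 1" using that by auto
    then have "norm (riemann_zeta s) = norm (zeta_reg s) / norm (s - 1)"
      using that by (simp add: riemann_zeta_eq_zeta_reg norm_divide)
    also have "\<dots> \<le> norm (zeta_reg s) / 1" using that by (intro divide_left_mono) auto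
    finally show ?thesis using C(2)[OF that(1)] by simp
  qed
  then show ?thesis using C(1) by blast
qed

text \<open>The two series multiply to an absolutely convergent sum over pairs (d, m), regrouped by
  n = d m: d powr (- u - s) * m powr (- u) = d powr (- s) * n powr (- u).\<close>

lemma divisor_sigma_sums:
  assumes u: "Re u > 1" "Re (u + s) > 1"
  shows "(\<lambda>n. divisor_sigma (- s) (Suc n) * of_nat (Suc n) powr (- u)) sums (riemann_zeta (u + s) * riemann_zeta u)"
proof -
  define p where "p s u = (\<lambda>(i, j). of_nat (Suc i) powr (- (u + s)) * of_nat (Suc j) powr (- u) :: complex)" for s u :: complex
  have zs: "((\<lambda>n. of_nat (Suc n) powr (- v)) has_sum riemann_zeta v) UNIV" if "Re v > 1" for v
  proof (rule norm_summable_imp_has_sum)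
    have e: "of_nat (Suc n) powr (- v) = (1 / of_nat (Suc n) powr v :: complex)" for n
      by (rule powr_minus_divide)
    show "(\<lambda>n. of_nat (Suc n) powr (- v)) sums riemann_zeta v"
      unfolding e using that by (rule riemann_zeta_sums)
    have "norm (of_nat (Suc n) powr (- v) :: complex) = real (Suc n) powr (- Re v)" for n
      by (subst norm_powr_real_powr) auto
    then show "summable (\<lambda>n. norm (of_nat (Suc n) powr (- v) :: complex))"
      using summable_Suc_powr[of "- Re v"] that by simp
  qed
  have zr: "((\<lambda>n. real (Suc n) powr (- r)) has_sum (\<Sum>n. real (Suc n) powr (- r))) UNIV" if "r > 1" for r
    using summable_Suc_powr[of "- r"] that by (intro sums_nonneg_imp_has_sum summable_sums) auto
  have np: "norm (p s u (i, j)) = real (Suc i) powr (- Re (u + s)) * real (Suc j) powr (- Re u)" for i j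
  proof -
    have "norm (of_nat (Suc k) powr (- v) :: complex) = real (Suc k) powr (- Re v)" for k v
      by (subst norm_powr_real_powr) auto
    then show ?thesis unfolding p_def by (simp only: norm_mult prod.case)
  qed
  have "(\<lambda>x. norm (p s u x)) summable_on (UNIV \<times> UNIV)"
  proof (rule summable_on_SigmaI)
    show "((\<lambda>j. norm (p s u (i, j))) has_sum (real (Suc i) powr (- Re (u + s)) * (\<Sum>n. real (Suc n) powr (- Re u)))) UNIV" for i
      unfolding np by (rule has_sum_cmult_right[OF zr[OF u(1)]])
    show "(\<lambda>i. real (Suc i) powr (- Re (u + s)) * (\<Sum>n. real (Suc n) powr (- Re u))) summable_on UNIV"
      using has_sum_cmult_left[OF zr[OF u(2)]] has_sum_imp_summable by blast
  qed auto
  then have "p s u summable_on (UNIV \<times> UNIV)" by (rule abs_summable_summable)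
  then have p: "(p s u has_sum (riemann_zeta (u + s) * riemann_zeta u)) (UNIV \<times> UNIV)"
  proof (rule has_sum_SigmaI[rotated 2])
    show "((\<lambda>j. p s u (i, j)) has_sum (of_nat (Suc i) powr (- (u + s)) * riemann_zeta u)) UNIV" for i
      unfolding p_def prod.case by (rule has_sum_cmult_right[OF zs[OF u(1)]])
    show "((\<lambda>i. of_nat (Suc i) powr (- (u + s)) * riemann_zeta u) has_sum (riemann_zeta (u + s) * riemann_zeta u)) UNIV"
      by (rule has_sum_cmult_left[OF zs[OF u(2)]])
  qed
  let ?T = "Sigma UNIV (\<lambda>n. {d. d dvd Suc n})"
  define q where "q = (\<lambda>(n, d). of_nat d powr (- s) * of_nat (Suc n) powr (- u) :: complex)"
  \<comment> \<open>Indices are predecessors: i and j stand for the factors Suc i and Suc j, and n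
    for the product Suc n, whereas d is the divisor itself.\<close>
  have "(q has_sum (riemann_zeta (u + s) * riemann_zeta u)) ?T"
  proof (rule has_sum_reindex_bij_witness[where j = "\<lambda>(i, j). (Suc i * Suc j - 1, Suc i)"
        and i = "\<lambda>(n, d). (d - 1, Suc n div d - 1)", THEN iffD1, OF _ _ _ _ _ _ p])
    let ?j = "\<lambda>(i, j). (Suc i * Suc j - 1, Suc i)"
    let ?i = "\<lambda>(n, d). (d - 1, Suc n div d - 1)"
    fix a :: "nat \<times> nat" assume "a \<in> UNIV \<times> UNIV"
    obtain i j where a: "a = (i, j)" by force
    have S: "Suc (Suc i * Suc j - 1) = Suc i * Suc j" by simp
    moreover have "Suc i * Suc j div Suc i = Suc j" by (rule nonzero_mult_div_cancel_left) simp
    ultimately show "?i (?j a) = a" unfolding a prod.case by (simp only: diff_Suc_1)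
    have "Suc i dvd Suc (Suc i * Suc j - 1)" unfolding S by (rule dvd_triv_left)
    then show "?j a \<in> ?T" unfolding a prod.case by blast
    have "of_nat (Suc (Suc i * Suc j - 1)) powr (- u) = (of_nat (Suc i) powr (- u) * of_nat (Suc j) powr (- u) :: complex)"
      unfolding S of_nat_mult by (rule powr_times_real) simp_all
    moreover have "of_nat (Suc i) powr (- s) * of_nat (Suc i) powr (- u) = (of_nat (Suc i) powr (- (u + s)) :: complex)"
      unfolding powr_add[symmetric] by (rule arg_cong[of _ _ "(powr) _"]) simp
    ultimately show "q (?j a) = p s u a"
      unfolding a p_def q_def prod.case by (simp only: mult.assoc[symmetric])
  next
    fix b assume b: "b \<in> ?T"
    let ?j = "\<lambda>(i, j). (Suc i * Suc j - 1, Suc i)"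
    let ?i = "\<lambda>(n, d). (d - 1, Suc n div d - 1)"
    obtain n d where nd: "b = (n, d)" "d dvd Suc n" using b by force
    then have "d > 0" "Suc n div d > 0" by (auto simp: dvd_div_eq_0_iff intro!: Nat.gr0I)
    then have "Suc (d - 1) = d" "Suc (Suc n div d - 1) = Suc n div d" by simp_all
    moreover have "d * (Suc n div d) = Suc n" using nd(2) by simp
    ultimately show "?j (?i b) = b" unfolding nd(1) prod.case by (simp only: diff_Suc_1)
    show "?i b \<in> UNIV \<times> UNIV" by simp
  qed simp
  then have "((\<lambda>n. divisor_sigma (- s) (Suc n) * of_nat (Suc n) powr (- u)) has_sum (riemann_zeta (u + s) * riemann_zeta u)) UNIV"
  proof (rule has_sum_SigmaD)
    fix n :: nat
    have "finite {d. d dvd Suc n}" by (rule finite_divisors_nat) simp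
    then show "((\<lambda>d. q (n, d)) has_sum (divisor_sigma (- s) (Suc n) * of_nat (Suc n) powr (- u))) {d. d dvd Suc n}"
      by (auto simp: q_def divisor_sigma_def sum_distrib_right simp del: of_nat_Suc intro!: has_sum_finiteI)
  qed
  then show ?thesis by (rule has_sum_imp_sums)
qed

lemma norm_divisor_sigma_le:
  "norm (divisor_sigma s n) \<le> Re (divisor_sigma (of_real (Re s)) n)"
proof -
  have "norm (divisor_sigma s n) \<le> (\<Sum>d | d dvd n. norm (of_nat d powr s :: complex))"
    unfolding divisor_sigma_def by (rule norm_sum)
  also have "\<dots> = (\<Sum>d | d dvd n. Re (of_nat d powr of_real (Re s)))"
  proof (rule sum.cong[OF refl])
    fix d
    have "of_nat d powr of_real (Re s) = complex_of_real (real d powr Re s)"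
      by (subst powr_of_real[symmetric]) auto
    then show "norm (of_nat d powr s :: complex) = Re (of_nat d powr of_real (Re s))"
      by (simp add: norm_powr_real_powr)
  qed
  finally show ?thesis by (simp add: divisor_sigma_def)
qed

text \<open>At the real parts of s and u the Dirichlet series above has nonnegative terms that
  dominate, and it converges there.\<close>

lemma summable_norm_divisor_sigma:
  assumes "Re u > 1" "Re (u + s) > 1"
  shows "summable (\<lambda>n. norm (divisor_sigma (- s) (Suc n)) * real (Suc n) powr (- Re u))"
proof -
  have "summable (\<lambda>n. Re (divisor_sigma (- of_real (Re s)) (Suc n) * of_nat (Suc n) powr (- of_real (Re u))))"
    using divisor_sigma_sums[of "of_real (Re u)" "of_real (Re s)"] assms by (intro summable_Re) (auto simp: sums_iff)
  then show ?thesis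
  proof (rule summable_comparison_test'[where N = 0])
    fix n
    have "of_nat (Suc n) powr (- of_real (Re u)) = complex_of_real (real (Suc n) powr (- Re u))"
      by (subst powr_of_real[symmetric]) auto
    then have "Re (divisor_sigma (- of_real (Re s)) (Suc n) * of_nat (Suc n) powr (- of_real (Re u)))
       = Re (divisor_sigma (- of_real (Re s)) (Suc n)) * real (Suc n) powr (- Re u)" by simp
    moreover have "norm (divisor_sigma (- s) (Suc n)) \<le> Re (divisor_sigma (- of_real (Re s)) (Suc n))"
      using norm_divisor_sigma_le[of "- s" "Suc n"] by simp
    ultimately show "norm (norm (divisor_sigma (- s) (Suc n)) * real (Suc n) powr (- Re u))
      \<le> Re (divisor_sigma (- of_real (Re s)) (Suc n) * of_nat (Suc n) powr (- of_real (Re u)))"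
      by (simp add: mult_right_mono abs_mult del: of_nat_Suc)
  qed
qed

section \<open>An integral for the Bessel function\<close>

lemma has_bochner_integral_derivative_Ioi:
  fixes F f :: "real \<Rightarrow> complex"
  assumes F: "\<And>x. (F has_vector_derivative f x) (at x)"
    and cont: "continuous_on UNIV f"
    and int: "integrable lborel (\<lambda>x. indicator {0<..} x *\<^sub>R f x)"
    and lim: "(F \<longlongrightarrow> 0) at_top"
  shows "has_bochner_integral lborel (\<lambda>x. indicator {0<..} x *\<^sub>R f x) (- F 0)"
proof -
  let ?g = "\<lambda>x. indicator {0<..} x *\<^sub>R f x"
  have "((\<lambda>y. \<integral>x. indicator {..y} x *\<^sub>R ?g x \<partial>lborel) \<longlongrightarrow> (\<integral>x. ?g x \<partial>lborel)) at_top"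
    by (rule tendsto_integral_at_top[OF _ int]) simp
  moreover have "((\<lambda>y. F y - F 0) \<longlongrightarrow> 0 - F 0) at_top"
    by (intro tendsto_intros lim)
  then have "((\<lambda>y. \<integral>x. indicator {..y} x *\<^sub>R ?g x \<partial>lborel) \<longlongrightarrow> 0 - F 0) at_top"
  proof (rule Lim_transform_eventually)
    show "\<forall>\<^sub>F y in at_top. F y - F 0 = (\<integral>x. indicator {..y} x *\<^sub>R ?g x \<partial>lborel)"
      using eventually_ge_at_top[of "0::real"]
    proof eventually_elim
      case (elim y)
      have "(\<integral>x. indicator {0..y} x *\<^sub>R f x \<partial>lborel) = F y - F 0"
        by (rule integral_FTC_Icc[OF elim])
          (auto intro: has_vector_derivative_at_within F continuous_on_subset[OF cont])
      moreover have "(\<integral>x. indicator {..y} x *\<^sub>R ?g x \<partial>lborel) = (\<integral>x. indicator {0..y} x *\<^sub>R f x \<partial>lborel)"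
      proof (rule integral_cong_AE)
        show "AE x in lborel. indicator {..y} x *\<^sub>R ?g x = indicator {0..y} x *\<^sub>R f x"
          using AE_lborel_singleton[of 0] by eventually_elim (auto simp: indicator_def)
        have [measurable]: "f \<in> borel_measurable borel" using cont by (rule borel_measurable_continuous_onI)
        show "(\<lambda>x. indicator {..y} x *\<^sub>R ?g x) \<in> borel_measurable lborel" "(\<lambda>x. indicator {0..y} x *\<^sub>R f x) \<in> borel_measurable lborel"
          by measurable
      qed
      ultimately show ?case by simp
    qed
  qed
  ultimately have "(\<integral>x. ?g x \<partial>lborel) = 0 - F 0" by (intro tendsto_unique) auto
  with int show ?thesis by (simp add: has_bochner_integral_iff)
qed

text \<open>On v > 0 adding N to the exponent only enlarges the integrand, and for N large the full
  Gamma integral converges; so every complex a is covered.\<close>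

lemma integrable_indicator_Gamma_exp:
  fixes a :: complex
  assumes y: "y > 0"
  shows "integrable lborel (\<lambda>v. indicator {0<..} v *\<^sub>R exp (a * of_real v - of_real (y * exp v)))"
proof -
  define N where "N = nat (\<lceil>\<bar>Re a\<bar>\<rceil> + 1)"
  have N: "Re a + real N > 0" unfolding N_def by linarith
  have "integrable lborel (\<lambda>v. exp ((a + of_nat N) * of_real v - of_real (y * exp v)))"
    using has_bochner_integral_Gamma_exp[of "a + of_nat N" y] N y by (simp add: has_bochner_integral_iff)
  then show ?thesis
  proof (rule Bochner_Integration.integrable_bound)
    show "(\<lambda>v. indicator {0<..} v *\<^sub>R exp (a * of_real v - of_real (y * exp v))) \<in> borel_measurable lborel"
      by (auto intro!: borel_measurable_continuous_on_indicator continuous_intros)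
    show "AE v in lborel. norm (indicator {0<..} v *\<^sub>R exp (a * of_real v - of_real (y * exp v)))
        \<le> norm (exp ((a + of_nat N) * of_real v - of_real (y * exp v)))"
    proof (intro AE_I2)
      fix v :: real
      have "Re a * v \<le> (Re a + real N) * v" if "v > 0" using that by (simp add: distrib_right)
      then show "norm (indicator {0<..} v *\<^sub>R exp (a * of_real v - of_real (y * exp v)))
        \<le> norm (exp ((a + of_nat N) * of_real v - of_real (y * exp v)))"
        by (simp add: norm_exp_eq_Re indicator_def)
    qed
  qed
qed

lemma exp_minus_mult_tendsto_0:
  fixes r :: real
  assumes "r > 0"
  shows "((\<lambda>v. exp (- r * v)) \<longlongrightarrow> 0) at_top"
  by (rule filterlim_compose[OF exp_at_bot filterlim_tendsto_neg_mult_at_bot[OF tendsto_const _ filterlim_ident]])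
    (use assms in simp)

lemma exp_linear_minus_exp_tendsto_0:
  fixes a y :: real
  assumes y: "y > 0"
  shows "((\<lambda>v. exp (a * v - y * exp v)) \<longlongrightarrow> 0) at_top"
proof (rule tendsto_sandwich[OF _ _ tendsto_const])
  show "((\<lambda>v. exp (- 1 * v)) \<longlongrightarrow> (0 :: real)) at_top" by (rule exp_minus_mult_tendsto_0) simp
  \<comment> \<open>Past the threshold a + 1 <= y v / 2, and v^2 / 2 <= exp v; together they give (a
    + 1) v <= y exp v.\<close>
  show "\<forall>\<^sub>F v in at_top. exp (a * v - y * exp v) \<le> exp (- 1 * v)"
    using eventually_ge_at_top[of "max 0 (2 * (a + 1) / y)"]
  proof eventually_elim
    case (elim v)
    have v: "v \<ge> 0" "a + 1 \<le> y * (v / 2)" using elim y by (simp_all add: field_simps)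
    have "(a + 1) * v \<le> y * (v / 2) * v" using v by (intro mult_right_mono) auto
    also have "\<dots> = y * (v\<^sup>2 / 2)" by (simp add: power2_eq_square)
    also have "v\<^sup>2 / 2 \<le> exp v" using exp_lower_Taylor_quadratic[OF v(1)] v(1) by linarith
    then have "y * (v\<^sup>2 / 2) \<le> y * exp v" using y by (intro mult_left_mono) auto
    finally show ?case by (simp add: distrib_right)
  qed
qed simp

lemma has_bochner_integral_exp_minus_Ioi:
  assumes b: "Re b > 0"
  shows "has_bochner_integral lborel (\<lambda>v. indicator {0<..} v *\<^sub>R exp (- b * of_real v)) (1 / b)"
proof -
  have b0: "b \<noteq> 0" using b by auto
  have "has_bochner_integral lborel (\<lambda>v. indicator {0<..} v *\<^sub>R exp (- b * of_real v)) (- (- exp (- b * of_real 0) / b))"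
  proof (rule has_bochner_integral_derivative_Ioi)
    show "((\<lambda>v. - exp (- b * of_real v) / b) has_vector_derivative exp (- b * of_real x)) (at x)" for x
    proof -
      have "((\<lambda>w. - exp (- b * w) / b) has_field_derivative exp (- b * of_real x)) (at (of_real x))"
        using b0 by (auto intro!: derivative_eq_intros)
      then show ?thesis by (rule has_vector_derivative_real_field)
    qed
    show "continuous_on UNIV (\<lambda>v. exp (- b * complex_of_real v))" by (intro continuous_intros)
    have "((\<lambda>v. exp (- Re b * v)) \<longlongrightarrow> 0) at_top"
      by (rule exp_minus_mult_tendsto_0[OF b])
    then have "((\<lambda>v. norm (exp (- b * complex_of_real v))) \<longlongrightarrow> 0) at_top" by (simp add: norm_exp_eq_Re)
    then have "((\<lambda>v. exp (- b * complex_of_real v)) \<longlongrightarrow> 0) at_top" by (rule tendsto_norm_zero_cancel)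
    then have "((\<lambda>v. - exp (- b * complex_of_real v) / b) \<longlongrightarrow> - 0 / b) at_top"
      by (intro tendsto_intros) (use b0 in auto)
    then show "((\<lambda>v. - exp (- b * complex_of_real v) / b) \<longlongrightarrow> 0) at_top" by simp
    have HK: "((\<lambda>v. exp (- Re b * v)) has_integral exp (- Re b * 0) / Re b) {0..}"
      using b by (rule has_integral_exp_minus_to_infinity)
    then have "(\<lambda>v. exp (- Re b * v)) absolutely_integrable_on {0..}"
      by (intro nonnegative_absolutely_integrable_1) (auto simp: integrable_on_def)
    then have "integrable lborel (\<lambda>v. indicator {0..} v *\<^sub>R exp (- Re b * v))"
      using has_bochner_integral_absolutely_integrable[where f = "\<lambda>v. exp (- Re b * v)" and S = "{0..}"]
      by (auto simp: has_bochner_integral_iff intro!: borel_measurable_continuous_on_indicator continuous_intros)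
    then show "integrable lborel (\<lambda>v. indicator {0<..} v *\<^sub>R exp (- b * complex_of_real v))"
      by (rule Bochner_Integration.integrable_bound)
        (auto simp: indicator_def norm_exp_eq_Re intro!: borel_measurable_continuous_on_indicator continuous_intros)
  qed
  then show ?thesis by simp
qed

text \<open>This is y powr (- a) times the lower incomplete gamma function, that is, the integral of
  t powr (a - 1) * exp (- y t) over [0, 1] when Re a > 0 and y > 0. The series continues it to all a
  outside the nonpositive integers.\<close>

definition lower_gamma_series :: "complex \<Rightarrow> real \<Rightarrow> complex" where
  "lower_gamma_series a y = (\<Sum>k. of_real (- y) ^ k / (fact k * (a + of_nat k)))"

lemma summable_lower_gamma_series: "summable (\<lambda>k. norm (of_real (- y) ^ k / (fact k * (a + of_nat k)) :: complex))"
proof (rule summable_comparison_test'[where N = "nat \<lceil>norm a\<rceil> + 1"])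
  show "summable (\<lambda>k. inverse (fact k) * \<bar>y\<bar> ^ k)" by (rule summable_exp)
  fix k assume k: "nat \<lceil>norm a\<rceil> + 1 \<le> k"
  have "real k - norm a \<le> norm (a + of_nat k)"
    using norm_triangle_ineq2[of "of_nat k" "- a"] by (simp add: add.commute)
  moreover have "real k \<ge> norm a + 1" using k by linarith
  ultimately have 1: "1 \<le> norm (a + of_nat k)" by linarith
  have "norm (of_real (- y) ^ k / (fact k * (a + of_nat k)) :: complex) = \<bar>y\<bar> ^ k / fact k / norm (a + of_nat k)"
    by (simp add: norm_divide norm_mult norm_power)
  also have "\<dots> \<le> \<bar>y\<bar> ^ k / fact k / 1"
    using 1 by (intro divide_left_mono) auto
  finally show "norm (norm (of_real (- y) ^ k / (fact k * (a + of_nat k)) :: complex)) \<le> inverse (fact k) * \<bar>y\<bar> ^ k"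
    by (simp add: field_simps)
qed

lemma lower_gamma_series_sums: "(\<lambda>k. of_real (- y) ^ k / (fact k * (a + of_nat k))) sums lower_gamma_series a y"
  unfolding lower_gamma_series_def by (rule summable_sums[OF summable_norm_cancel[OF summable_lower_gamma_series]])

text \<open>Integration by parts for the incomplete gamma function, done on the coefficients so that
  it also holds where the integral over [0, 1] diverges.\<close>

lemma lower_gamma_series_rec:
  assumes a: "a \<notin> \<int>\<^sub>\<le>\<^sub>0"
  shows "a * lower_gamma_series a y = exp (- of_real y) + of_real y * lower_gamma_series (a + 1) y"
proof -
  have ak: "a + of_nat k \<noteq> 0" for k
  proof
    assume "a + of_nat k = 0"
    then have "a = - of_nat k" by (simp add: add_eq_0_iff2)
    then show False using a by simp
  qed
  have 1: "(\<lambda>k. of_real y * (of_real (- y) ^ k / (fact k * (a + 1 + of_nat k)))) sums (of_real y * lower_gamma_series (a + 1) y)"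
    by (intro sums_mult lower_gamma_series_sums)
  define g where "g k = of_real (- y) ^ k / fact k - a * (of_real (- y) ^ k / (fact k * (a + of_nat k)))" for k
  have gS: "g (Suc k) = - (of_real y * (of_real (- y) ^ k / (fact k * (a + 1 + of_nat k))))" for k
  proof -
    define b where "b = a + of_nat (Suc k)"
    have b: "b \<noteq> 0" "a + 1 + of_nat k = b" using ak[of "Suc k"] by (simp_all add: b_def)
    have "g (Suc k) = of_real (- y) ^ Suc k / fact (Suc k) * (1 - a / b)"
      unfolding g_def b_def[symmetric] by (simp add: right_diff_distrib)
    also have "1 - a / b = (b - a) / b" using b(1) by (simp add: diff_divide_distrib)
    also have "b - a = of_nat (Suc k)" by (simp add: b_def)
    also have "of_real (- y) ^ Suc k / fact (Suc k) * (of_nat (Suc k) / b) = - (of_real y * (of_real (- y) ^ k / (fact k * b)))"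
    proof -
      have "- Y * P / (n * F) * (n / b) = - (Y * (P / (F * b)))" if "n \<noteq> 0" for Y P n F :: complex
        using that by simp
      from this[of "of_nat (Suc k)" "of_real y" "of_real (- y) ^ k" "fact k"] show ?thesis
        unfolding fact_Suc power_Suc of_real_minus by (simp del: of_nat_Suc)
    qed
    finally show ?thesis unfolding b(2) .
  qed
  have "(\<lambda>k. g (Suc k)) sums (- (of_real y * lower_gamma_series (a + 1) y))"
    unfolding gS by (rule sums_minus[OF 1])
  from sums_Suc[OF this] have "g sums (- (of_real y * lower_gamma_series (a + 1) y) + g 0)" .
  moreover have "g 0 = 0" using ak[of 0] by (simp add: g_def)
  ultimately have 2: "g sums (- (of_real y * lower_gamma_series (a + 1) y))" by simp
  have "(\<lambda>k. of_real (- y) ^ k / fact k) sums exp (complex_of_real (- y))"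
    using exp_converges[of "complex_of_real (- y)"] by (simp add: scaleR_conv_of_real divide_inverse mult.commute)
  then have "g sums (exp (complex_of_real (- y)) - a * lower_gamma_series a y)"
    unfolding g_def by (intro sums_diff sums_mult lower_gamma_series_sums)
  from sums_unique2[OF 2 this] show ?thesis by (simp add: algebra_simps)
qed

text \<open>With t = exp v this is the integral over t > 1: the full Gamma integral less the part
  over [0, 1]. That argument needs Re a > 0; an induction then lowers Re a by one unit at a time,
  because the Bessel kernel calls for a = \<mu> - k with k unbounded.\<close>

lemma has_bochner_integral_upper_gamma:
  assumes a: "a \<notin> \<int>\<^sub>\<le>\<^sub>0" and y: "y > 0"
  shows "has_bochner_integral lborel (\<lambda>v. indicator {0<..} v *\<^sub>R exp (a * of_real v - of_real (y * exp v)))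
     (exp (- a * of_real (ln y)) * Gamma a - lower_gamma_series a y)"
proof -
  let ?E = "\<lambda>a v. exp (a * complex_of_real v - of_real (y * exp v))"
  have base: "has_bochner_integral lborel (\<lambda>v. indicator {0<..} v *\<^sub>R ?E a v)
     (exp (- a * of_real (ln y)) * Gamma a - lower_gamma_series a y)" if a: "Re a > 0" for a
  proof -
    have full: "has_bochner_integral lborel (?E a) (Gamma a * exp (- a * of_real (ln y)))"
      by (rule has_bochner_integral_Gamma_exp[OF a y])
    let ?f = "\<lambda>k v. indicator {0<..} v *\<^sub>R (of_real (- y) ^ k / fact k * exp (- (a + of_nat k) * complex_of_real v))"
    have neg: "has_bochner_integral lborel (\<lambda>v. indicator {0<..} v *\<^sub>R ?E a (- v)) (lower_gamma_series a y)"
    proof (rule has_bochner_integral_sums[where f = ?f])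
      show "has_bochner_integral lborel (?f k) (of_real (- y) ^ k / (fact k * (a + of_nat k)))" for k
        using has_bochner_integral_mult_right[OF has_bochner_integral_exp_minus_Ioi[of "a + of_nat k"], of "of_real (- y) ^ k / fact k"] a
        by (simp add: mult_ac)
      have nf: "complex_of_real (norm (?f k v)) = indicator {0<..} v *\<^sub>R (of_real y ^ k / fact k * exp (- (of_real (Re a) + of_nat k) * complex_of_real v))" for k v
      proof -
        have "exp (- (of_real (Re a) + of_nat k) * complex_of_real v) = of_real (exp (- (Re a + real k) * v))"
          by (simp add: exp_of_real[symmetric])
        moreover have "norm (exp (- (a + of_nat k) * complex_of_real v)) = exp (- (Re a + real k) * v)"
          by (simp add: norm_exp_eq_Re)
        moreover have "norm (of_real (- y) ^ k / fact k :: complex) = y ^ k / fact k"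
          using y by (simp add: norm_divide norm_power)
        ultimately show ?thesis unfolding norm_scaleR norm_mult by (simp add: indicator_def)
      qed
      show "has_bochner_integral lborel (\<lambda>v. complex_of_real (norm (?f k v))) (of_real y ^ k / (fact k * (of_real (Re a) + of_nat k)))" for k
        unfolding nf
        using has_bochner_integral_mult_right[OF has_bochner_integral_exp_minus_Ioi[of "of_real (Re a) + of_nat k"], of "of_real y ^ k / fact k"] a
        by (simp add: mult_ac)
      show "summable (\<lambda>k. of_real y ^ k / (fact k * (of_real (Re a) + of_nat k)) :: complex)"
        using lower_gamma_series_sums[of "- y" "of_real (Re a)"] by (simp add: sums_iff)
      show "(\<lambda>k. of_real (- y) ^ k / (fact k * (a + of_nat k))) sums lower_gamma_series a y"
        by (rule lower_gamma_series_sums)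
      have fe: "?f k v = indicator {0<..} v *\<^sub>R (exp (- a * of_real v) * (of_real (- y * exp (- v)) ^ k /\<^sub>R fact k))" for k v
      proof -
        have e1: "exp (- (a + of_nat k) * complex_of_real v) = exp (- a * of_real v) * exp (- of_real v) ^ k"
          by (simp add: exp_of_nat_mult[symmetric] exp_add[symmetric] algebra_simps)
        have e2: "of_real (- y * exp (- v)) ^ k = (of_real (- y) ^ k * exp (- of_real v) ^ k :: complex)"
          by (simp only: of_real_mult power_mult_distrib exp_of_real[symmetric] of_real_minus)
        show ?thesis unfolding e1 e2 by (simp only: scaleR_conv_of_real divide_inverse of_real_inverse of_real_fact mult_ac)
      qed
      show "(\<lambda>k. ?f k v) sums (indicator {0<..} v *\<^sub>R ?E a (- v))" for v
      proof -
        have "(\<lambda>k. indicator {0<..} v *\<^sub>R (exp (- a * of_real v) * (of_real (- y * exp (- v)) ^ k /\<^sub>R fact k)))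
          sums (indicator {0<..} v *\<^sub>R (exp (- a * of_real v) * exp (of_real (- y * exp (- v)))))"
          by (intro sums_scaleR_right sums_mult exp_converges)
        also have "exp (- a * of_real v) * exp (of_real (- y * exp (- v))) = ?E a (- v)"
          by (simp add: exp_add[symmetric])
        finally show ?thesis unfolding fe .
      qed
      show "summable (\<lambda>k. norm (?f k v))" for v
        unfolding fe norm_scaleR norm_mult
        by (intro summable_mult) (use summable_norm_exp[of "complex_of_real (- y * exp (- v))"] in simp)
    qed
    have "has_bochner_integral lborel (\<lambda>v. indicator {0<..} (- v) *\<^sub>R ?E a v) (lower_gamma_series a y)"
      using neg lborel_has_bochner_integral_real_affine_iff[of "-1" "\<lambda>v. indicator {0<..} v *\<^sub>R ?E a (- v)" "lower_gamma_series a y" 0]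
      by simp
    from has_bochner_integral_diff[OF full this]
    have *: "has_bochner_integral lborel (\<lambda>v. ?E a v - indicator {0<..} (- v) *\<^sub>R ?E a v) (Gamma a * exp (- a * of_real (ln y)) - lower_gamma_series a y)" .
    have "AE v in lborel. ?E a v - indicator {0<..} (- v) *\<^sub>R ?E a v = indicator {0<..} v *\<^sub>R ?E a v"
      using AE_lborel_singleton[of 0] by eventually_elim (auto simp: indicator_def)
    then have "has_bochner_integral lborel (\<lambda>v. indicator {0<..} v *\<^sub>R ?E a v) (Gamma a * exp (- a * of_real (ln y)) - lower_gamma_series a y)"
      using * integrable_indicator_Gamma_exp[OF y, of a]
      by (subst (asm) has_bochner_integral_cong_AE) (auto simp: has_bochner_integral_iff)
    then show ?thesis by (simp add: mult.commute)
  qed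
  have "has_bochner_integral lborel (\<lambda>v. indicator {0<..} v *\<^sub>R ?E a v)
     (exp (- a * of_real (ln y)) * Gamma a - lower_gamma_series a y)" if "Re a + real n > 0" "a \<notin> \<int>\<^sub>\<le>\<^sub>0" for n
    using that
  proof (induction n arbitrary: a)
    case 0
    then show ?case using base by simp
  next
    case (Suc n)
    have a0: "a \<noteq> 0" "a + 1 \<notin> \<int>\<^sub>\<le>\<^sub>0" using Suc.prems(2) plus_one_in_nonpos_Ints_imp by auto
    let ?U = "\<lambda>a. exp (- a * of_real (ln y)) * Gamma a - lower_gamma_series a y"
    have IH: "has_bochner_integral lborel (\<lambda>v. indicator {0<..} v *\<^sub>R ?E (a + 1) v) (?U (a + 1))"
      using Suc.prems a0 by (intro Suc.IH) auto
    have int: "integrable lborel (\<lambda>v. indicator {0<..} v *\<^sub>R ?E a v)" by (rule integrable_indicator_Gamma_exp[OF y])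
    have E1: "?E (a + 1) v = of_real (exp v) * ?E a v" for v
      by (simp add: distrib_right exp_add exp_diff exp_of_real)
    \<comment> \<open>The derivative of \<open>?E a\<close> is a times \<open>?E a\<close> minus y
      times \<open>?E (a + 1)\<close>, which expresses the integral at a through the one at a + 1; a
      is nonzero, so it can be solved for.\<close>
    have FTC: "has_bochner_integral lborel (\<lambda>v. indicator {0<..} v *\<^sub>R (a * ?E a v - of_real y * ?E (a + 1) v)) (- ?E a 0)"
    proof (rule has_bochner_integral_derivative_Ioi)
      show "(?E a has_vector_derivative (a * ?E a x - of_real y * ?E (a + 1) x)) (at x)" for x
      proof -
        have "((\<lambda>w. exp (a * w - of_real y * exp w)) has_field_derivative
            (exp (a * of_real x - of_real y * exp (of_real x)) * (a - of_real y * exp (of_real x)))) (at (of_real x))"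
          by (auto intro!: derivative_eq_intros)
        from has_vector_derivative_real_field[OF this]
        show ?thesis unfolding E1 by (simp add: exp_of_real algebra_simps)
      qed
      show "continuous_on UNIV (\<lambda>v. a * ?E a v - of_real y * ?E (a + 1) v)" by (intro continuous_intros)
      show "integrable lborel (\<lambda>v. indicator {0<..} v *\<^sub>R (a * ?E a v - of_real y * ?E (a + 1) v))"
        using Bochner_Integration.integrable_diff[OF integrable_mult_right[of a, OF int] integrable_mult_right[of "of_real y", OF integrable_indicator_Gamma_exp[OF y, of "a + 1"]]]
        by (simp add: scaleR_diff_right)
      have "((\<lambda>v. exp (Re a * v - y * exp v)) \<longlongrightarrow> 0) at_top" by (rule exp_linear_minus_exp_tendsto_0[OF y])
      then have "((\<lambda>v. norm (?E a v)) \<longlongrightarrow> 0) at_top" by (simp add: norm_exp_eq_Re)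
      then show "(?E a \<longlongrightarrow> 0) at_top" by (rule tendsto_norm_zero_cancel)
    qed
    have "has_bochner_integral lborel (\<lambda>v. 1 / a * (indicator {0<..} v *\<^sub>R (a * ?E a v - of_real y * ?E (a + 1) v) + of_real y * (indicator {0<..} v *\<^sub>R ?E (a + 1) v)))
      (1 / a * (- ?E a 0 + of_real y * ?U (a + 1)))"
      by (intro has_bochner_integral_mult_right has_bochner_integral_add FTC IH)
    also have "(\<lambda>v. 1 / a * (indicator {0<..} v *\<^sub>R (a * ?E a v - of_real y * ?E (a + 1) v) + of_real y * (indicator {0<..} v *\<^sub>R ?E (a + 1) v)))
      = (\<lambda>v. indicator {0<..} v *\<^sub>R ?E a v)"
      using a0 by (auto simp: indicator_def fun_eq_iff)
    also have "1 / a * (- ?E a 0 + of_real y * ?U (a + 1)) = ?U a"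
    proof -
      have "of_real y * exp (- (a + 1) * of_real (ln y)) = exp (- a * of_real (ln y))"
      proof -
        have "exp (- complex_of_real (ln y)) = of_real (exp (- ln y))" by (simp add: exp_of_real[symmetric])
        also have "exp (- ln y) = 1 / y" using y by (simp add: exp_minus inverse_eq_divide)
        finally have "of_real y * exp (- complex_of_real (ln y)) = 1" using y by simp
        moreover have "exp (- (a + 1) * of_real (ln y)) = exp (- a * of_real (ln y)) * exp (- complex_of_real (ln y))"
          unfolding exp_add[symmetric] by (simp add: algebra_simps)
        ultimately show ?thesis by simp
      qed
      moreover have "Gamma (a + 1) = a * Gamma a" by (rule Gamma_plus1) fact
      ultimately have "of_real y * ?U (a + 1) = a * (exp (- a * of_real (ln y)) * Gamma a) - of_real y * lower_gamma_series (a + 1) y"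
        by (simp add: right_diff_distrib mult.assoc[symmetric])
      moreover have "?E a 0 = exp (- of_real y)" by simp
      ultimately have "- ?E a 0 + of_real y * ?U (a + 1) = a * ?U a"
        using lower_gamma_series_rec[OF Suc.prems(2), of y] by (simp add: right_diff_distrib)
      then show ?thesis using a0 by simp
    qed
    finally show ?case .
  qed
  moreover have "Re a + real (nat (\<lceil>\<bar>Re a\<bar>\<rceil> + 1)) > 0" by linarith
  ultimately show ?thesis using a by blast
qed


section \<open>The Bessel kernel over the whole line as two Gamma series\<close>

lemma not_Ints_distance:
  fixes \<nu> :: complex
  assumes "\<nu> \<notin> \<int>"
  obtains d where "d > 0" "\<And>n. n \<in> \<int> \<Longrightarrow> d \<le> norm (\<nu> - n)"
proof -
  have "open (- \<int> :: complex set)" using closed_Ints by (simp add: open_Compl)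
  then obtain d where d: "d > 0" "ball \<nu> d \<subseteq> - \<int>" using assms open_contains_ball by (metis ComplI)
  show ?thesis
  proof (rule that[OF d(1)])
    fix n :: complex assume "n \<in> \<int>"
    then have "n \<notin> ball \<nu> d" using d(2) by auto
    then show "d \<le> norm (\<nu> - n)" by (simp add: dist_norm)
  qed
qed

text \<open>The two families of lower incomplete gamma series below are the two orders of summation of one
  absolutely convergent double series, up to sign, so they cancel.\<close>

lemma lower_gamma_series_double_sum:
  fixes \<nu> :: complex and y :: real
  assumes \<nu>: "\<nu> \<notin> \<int>"
  shows "\<exists>T. (\<lambda>k. of_real (- y) ^ k / fact k * lower_gamma_series (- \<nu> - of_nat k) 1) sums T \<and>
     (\<lambda>j. (-1) ^ j / fact j * lower_gamma_series (\<nu> - of_nat j) y) sums (- T)"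
proof -
  obtain d where d: "d > 0" "\<And>n. n \<in> \<int> \<Longrightarrow> d \<le> norm (\<nu> - n)"
    using not_Ints_distance[OF \<nu>] by blast
  define F where "F = (\<lambda>(k, j). of_real (- y) ^ k * (-1) ^ j / (fact k * fact j * (of_nat j - \<nu> - of_nat k)) :: complex)"
  have ee: "((\<lambda>k. \<bar>y\<bar> ^ k / fact k) has_sum exp \<bar>y\<bar>) UNIV" for y :: real
    using exp_converges[of "\<bar>y\<bar>"] by (intro sums_nonneg_imp_has_sum) (auto simp: divide_inverse mult.commute)
  have "(\<lambda>(k, j). \<bar>y\<bar> ^ k / fact k * (\<bar>1\<bar> ^ j / fact j) / d) summable_on (UNIV \<times> UNIV)"
  proof (rule summable_on_SigmaI)
    fix k :: nat
    have "((\<lambda>j. \<bar>y\<bar> ^ k / fact k * (\<bar>1\<bar> ^ j / fact j) * (1 / d)) has_sum (\<bar>y\<bar> ^ k / fact k * exp \<bar>1\<bar> * (1 / d))) UNIV"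
      by (intro has_sum_cmult_left has_sum_cmult_right ee)
    then show "((\<lambda>j. case (k, j) of (k, j) \<Rightarrow> \<bar>y\<bar> ^ k / fact k * (\<bar>1\<bar> ^ j / fact j) / d) has_sum (\<bar>y\<bar> ^ k / fact k * exp \<bar>1\<bar> * (1 / d))) UNIV"
      by simp
  next
    have "((\<lambda>k. \<bar>y\<bar> ^ k / fact k * exp \<bar>1\<bar> * (1 / d)) has_sum (exp \<bar>y\<bar> * exp \<bar>1\<bar> * (1 / d))) UNIV"
      by (intro has_sum_cmult_left ee)
    then show "(\<lambda>k. \<bar>y\<bar> ^ k / fact k * exp \<bar>1\<bar> * (1 / d)) summable_on UNIV" by (rule has_sum_imp_summable)
  qed (use d in auto)
  then have "(\<lambda>x. norm (case x of (k, j) \<Rightarrow> \<bar>y\<bar> ^ k / fact k * (\<bar>1\<bar> ^ j / fact j) / d)) summable_on (UNIV \<times> UNIV)"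
    using d by (auto simp: case_prod_unfold abs_mult)
  then have "(\<lambda>x. norm (F x)) summable_on (UNIV \<times> UNIV)"
  proof (rule Infinite_Sum.abs_summable_on_comparison_test)
    fix x :: "nat \<times> nat" assume "x \<in> UNIV \<times> UNIV"
    obtain k j where x: "x = (k, j)" by force
    have "d \<le> norm (\<nu> - (of_nat j - of_nat k))" by (intro d(2)) auto
    also have "norm (\<nu> - (of_nat j - of_nat k)) = norm (of_nat j - \<nu> - of_nat k)"
      by (subst norm_minus_commute) (simp add: algebra_simps)
    finally have "\<bar>y\<bar> ^ k / fact k * (1 / fact j) / norm (of_nat j - \<nu> - of_nat k) \<le> \<bar>y\<bar> ^ k / fact k * (1 / fact j) / d"
      using d(1) by (intro divide_left_mono mult_pos_pos) auto
    then show "norm (F x) \<le> norm (case x of (k, j) \<Rightarrow> \<bar>y\<bar> ^ k / fact k * (\<bar>1\<bar> ^ j / fact j) / d)"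
      unfolding x F_def using d(1) by (simp add: norm_mult norm_divide norm_power abs_mult)
  qed
  then have "F summable_on (UNIV \<times> UNIV)" by (rule abs_summable_summable)
  then obtain T where T: "(F has_sum T) (UNIV \<times> UNIV)" by (auto simp: summable_on_def)
  have "((\<lambda>k. of_real (- y) ^ k / fact k * lower_gamma_series (- \<nu> - of_nat k) 1) has_sum T) UNIV"
  proof (rule has_sum_SigmaD[OF T])
    fix k
    have "((\<lambda>j. of_real (- 1) ^ j / (fact j * (- \<nu> - of_nat k + of_nat j))) has_sum lower_gamma_series (- \<nu> - of_nat k) 1) UNIV"
      using summable_lower_gamma_series lower_gamma_series_sums by (rule norm_summable_imp_has_sum)
    from has_sum_cmult_right[OF this, of "of_real (- y) ^ k / fact k"]
    show "((\<lambda>j. F (k, j)) has_sum (of_real (- y) ^ k / fact k * lower_gamma_series (- \<nu> - of_nat k) 1)) UNIV"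
      by (simp add: F_def algebra_simps)
  qed
  moreover have "bij_betw prod.swap (UNIV \<times> UNIV) (UNIV \<times> UNIV :: (nat \<times> nat) set)"
    by (rule bij_betwI[where g = prod.swap]) auto
  from has_sum_reindex_bij_betw[OF this, of F T] have "((\<lambda>x. F (prod.swap x)) has_sum T) (UNIV \<times> UNIV)"
    using T by blast
  then have "((\<lambda>j. - ((-1) ^ j / fact j * lower_gamma_series (\<nu> - of_nat j) y)) has_sum T) UNIV"
  proof (rule has_sum_SigmaD)
    fix j
    have "((\<lambda>k. of_real (- y) ^ k / (fact k * (\<nu> - of_nat j + of_nat k))) has_sum lower_gamma_series (\<nu> - of_nat j) y) UNIV"
      using summable_lower_gamma_series lower_gamma_series_sums by (rule norm_summable_imp_has_sum)
    from has_sum_cmult_right[OF this, of "- ((-1) ^ j / fact j)"]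
    have 1: "((\<lambda>k. - ((-1) ^ j / fact j) * (of_real (- y) ^ k / (fact k * (\<nu> - of_nat j + of_nat k)))) has_sum - ((-1) ^ j / fact j * lower_gamma_series (\<nu> - of_nat j) y)) UNIV"
      by simp
    have 2: "- ((-1) ^ j / fact j) * (of_real (- y) ^ k / (fact k * (\<nu> - of_nat j + of_nat k))) = F (prod.swap (j, k))" for k
    proof -
      have e: "\<nu> - of_nat j + of_nat k = - (of_nat j - \<nu> - of_nat k)" by simp
      have "- (J / D) * (P / (E * - b)) = P * J / (E * D * b)" for J D P E b :: complex
        by (simp add: mult_ac)
      then show ?thesis unfolding F_def swap_simp prod.case e by blast
    qed
    show "((\<lambda>k. F (prod.swap (j, k))) has_sum - ((-1) ^ j / fact j * lower_gamma_series (\<nu> - of_nat j) y)) UNIV"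
      using 1 unfolding 2 .
  qed
  from sums_minus[OF has_sum_imp_sums[OF this]]
  have "(\<lambda>j. (-1) ^ j / fact j * lower_gamma_series (\<nu> - of_nat j) y) sums (- T)" by simp
  ultimately show ?thesis using has_sum_imp_sums by blast
qed

lemma integral_tendsto_dominated:
  fixes f :: "complex \<Rightarrow> real \<Rightarrow> complex"
  assumes S: "open S" "a \<in> S"
    and meas: "\<And>z. z \<in> S \<Longrightarrow> f z \<in> borel_measurable lborel"
    and bound: "\<And>z v. z \<in> S \<Longrightarrow> norm (f z v) \<le> w v"
    and w: "integrable lborel w"
    and cont: "\<And>v. continuous_on S (\<lambda>z. f z v)"
  shows "((\<lambda>z. \<integral>v. f z v \<partial>lborel) \<longlongrightarrow> (\<integral>v. f a v \<partial>lborel)) (at a)"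
proof -
  have "((\<lambda>z. \<integral>v. f z v \<partial>lborel) \<longlongrightarrow> (\<integral>v. f a v \<partial>lborel)) (at a within S)"
    unfolding tendsto_at_iff_sequentially
  proof (intro allI impI)
    fix X :: "nat \<Rightarrow> complex" assume X: "\<forall>i. X i \<in> S - {a}" "X \<longlonglongrightarrow> a"
    have "(\<lambda>i. \<integral>v. f (X i) v \<partial>lborel) \<longlonglongrightarrow> (\<integral>v. f a v \<partial>lborel)"
    proof (rule integral_dominated_convergence)
      show "AE v in lborel. (\<lambda>i. f (X i) v) \<longlonglongrightarrow> f a v"
      proof (intro AE_I2)
        fix v
        have "((\<lambda>z. f z v) \<longlongrightarrow> f a v) (at a within S)" using cont[of v] S(2) unfolding continuous_on_def by blast
        then have "((\<lambda>z. f z v) \<circ> X) \<longlonglongrightarrow> f a v"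
          using X unfolding tendsto_at_iff_sequentially by blast
        then show "(\<lambda>i. f (X i) v) \<longlonglongrightarrow> f a v"
          by (simp only: o_def)
      qed
    next
      show "integrable lborel w" by (rule w)
      show "f a \<in> borel_measurable lborel" by (rule meas[OF S(2)])
      show "f (X i) \<in> borel_measurable lborel" for i using X(1) by (intro meas) blast
      show "AE v in lborel. norm (f (X i) v) \<le> w v" for i
        using X(1) by (intro AE_I2 bound) blast
    qed
    then show "((\<lambda>z. \<integral>v. f z v \<partial>lborel) \<circ> X) \<longlonglongrightarrow> (\<integral>v. f a v \<partial>lborel)" by (simp add: o_def)
  qed
  then show ?thesis by (simp only: at_within_open[OF S(2) S(1)])
qed

text \<open>For v > 0 the factor with c is at most 1 and is dropped; v \<mapsto> - v exchanges y and
  c and so covers the other half.\<close>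

lemma integrable_bessel_kernel:
  fixes \<mu> :: complex
  assumes y: "y > 0" and c: "c > 0"
  shows "integrable lborel (\<lambda>v. exp (\<mu> * of_real v - of_real (y * exp v + c * exp (- v))))"
    and integrable_bessel_kernel_Ioi: "integrable lborel (\<lambda>v. indicator {0<..} v *\<^sub>R exp (\<mu> * of_real v - of_real (y * exp v + c * exp (- v))))"
proof -
  have half: "integrable lborel (\<lambda>v. indicator {0<..} v *\<^sub>R exp (\<mu> * of_real v - of_real (y * exp v + c * exp (- v))))"
    if y: "y > 0" and c: "c > 0" for \<mu> :: complex and y c :: real
  proof (rule Bochner_Integration.integrable_bound[OF integrable_indicator_Gamma_exp[OF y, of \<mu>]])
    show "(\<lambda>v. indicator {0<..} v *\<^sub>R exp (\<mu> * of_real v - of_real (y * exp v + c * exp (- v)))) \<in> borel_measurable lborel"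
      by (auto intro!: borel_measurable_continuous_on_indicator continuous_intros)
    show "AE v in lborel. norm (indicator {0<..} v *\<^sub>R exp (\<mu> * of_real v - of_real (y * exp v + c * exp (- v))))
       \<le> norm (indicator {0<..} v *\<^sub>R exp (\<mu> * of_real v - of_real (y * exp v)))"
    proof (intro AE_I2)
      fix v :: real
      have "c * exp (- v) \<ge> 0" using c by simp
      then show "norm (indicator {0<..} v *\<^sub>R exp (\<mu> * of_real v - of_real (y * exp v + c * exp (- v))))
         \<le> norm (indicator {0<..} v *\<^sub>R exp (\<mu> * of_real v - of_real (y * exp v)))"
        unfolding norm_scaleR norm_exp_eq_Re by (intro mult_left_mono) auto
    qed
  qed
  show "integrable lborel (\<lambda>v. indicator {0<..} v *\<^sub>R exp (\<mu> * of_real v - of_real (y * exp v + c * exp (- v))))"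
    by (rule half[OF y c])
  let ?E = "\<lambda>v. exp (\<mu> * of_real v - of_real (y * exp v + c * exp (- v)))"
  let ?f = "\<lambda>v. indicator {0<..} v *\<^sub>R exp (- \<mu> * of_real v - of_real (c * exp v + y * exp (- v)))"
  have "integrable lborel (\<lambda>v. ?f (0 + - 1 * v))"
    by (rule lborel_integrable_real_affine[OF half[OF c y]]) simp
  also have "(\<lambda>v. ?f (0 + - 1 * v)) = (\<lambda>v. indicator {0<..} (- v) *\<^sub>R ?E v)"
  proof
    fix v :: real
    have "0 + - 1 * v = - v" "- (- v) = v" "c * exp (- v) + y * exp v = y * exp v + c * exp (- v)"
      "- \<mu> * of_real (- v) = \<mu> * of_real v" by simp_all
    then show "?f (0 + - 1 * v) = indicator {0<..} (- v) *\<^sub>R ?E v" by (simp only:)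
  qed
  finally have I1: "integrable lborel (\<lambda>v. indicator {0<..} v *\<^sub>R ?E v + indicator {0<..} (- v) *\<^sub>R ?E v)"
    by (intro Bochner_Integration.integrable_add half[OF y c])
  have I3: "AE v in lborel. indicator {0<..} v *\<^sub>R exp (\<mu> * of_real v - of_real (y * exp v + c * exp (- v)))
     + indicator {0<..} (- v) *\<^sub>R exp (\<mu> * of_real v - of_real (y * exp v + c * exp (- v)))
     = exp (\<mu> * of_real v - of_real (y * exp v + c * exp (- v)))"
    using AE_lborel_singleton[of 0] by eventually_elim (auto simp: indicator_def)
  have I2: "(\<lambda>v. exp (\<mu> * of_real v - of_real (y * exp v + c * exp (- v)))) \<in> borel_measurable lborel"
    by (simp only: measurable_lborel2) (intro borel_measurable_continuous_onI continuous_intros)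
  show "integrable lborel (\<lambda>v. exp (\<mu> * of_real v - of_real (y * exp v + c * exp (- v))))"
    by (rule integrable_cong_AE_imp[OF I1 I2 I3])
qed

text \<open>The factor exp (- c exp (- v)) is expanded in powers of exp (- v). These are at most 1
  on v > 0, so the terms are bounded by c^k / k! times one integrable function. Over the whole line
  single terms would diverge for large k, which is why the kernel is cut at v = 0.\<close>

lemma has_bochner_integral_bessel_kernel_Ioi:
  fixes \<mu> :: complex
  assumes \<mu>: "\<mu> \<notin> \<int>" and y: "y > 0" and c: "c > 0"
  shows "\<exists>L. (\<lambda>k. of_real (- c) ^ k / fact k * (exp (- (\<mu> - of_nat k) * of_real (ln y)) * Gamma (\<mu> - of_nat k) - lower_gamma_series (\<mu> - of_nat k) y)) sums L
    \<and> has_bochner_integral lborel (\<lambda>v. indicator {0<..} v *\<^sub>R exp (\<mu> * of_real v - of_real (y * exp v + c * exp (- v)))) L"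
proof -
  let ?f = "\<lambda>k v. of_real (- c) ^ k / fact k * (indicator {0<..} v *\<^sub>R exp ((\<mu> - of_nat k) * of_real v - of_real (y * exp v)))"
  let ?I = "\<lambda>k. of_real (- c) ^ k / fact k * (exp (- (\<mu> - of_nat k) * of_real (ln y)) * Gamma (\<mu> - of_nat k) - lower_gamma_series (\<mu> - of_nat k) y)"
  have nint: "\<mu> - of_nat k \<notin> \<int>\<^sub>\<le>\<^sub>0" for k
  proof
    assume "\<mu> - of_nat k \<in> \<int>\<^sub>\<le>\<^sub>0"
    then have "\<mu> - of_nat k \<in> \<int>" by (rule nonpos_Ints_Int)
    then have "\<mu> - of_nat k + of_nat k \<in> \<int>" by (intro Ints_add) auto
    then show False using \<mu> by simp
  qed
  have f: "has_bochner_integral lborel (?f k) (?I k)" for k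
    by (intro has_bochner_integral_mult_right has_bochner_integral_upper_gamma nint y)
  have int: "integrable lborel (?f k)" for k using f[of k] by (simp add: has_bochner_integral_iff)
  let ?g = "\<lambda>v. norm (indicator {0<..} v *\<^sub>R exp (\<mu> * of_real v - of_real (y * exp v)))"
  have g: "integrable lborel ?g" by (intro integrable_norm integrable_indicator_Gamma_exp y)
  let ?N = "\<lambda>k. \<integral>v. norm (?f k v) \<partial>lborel"
  have N: "?N k \<le> c ^ k / fact k * (\<integral>v. ?g v \<partial>lborel)" for k
  proof -
    have "?N k \<le> (\<integral>v. c ^ k / fact k * ?g v \<partial>lborel)"
    proof (rule integral_mono)
      show "integrable lborel (\<lambda>v. norm (?f k v))" by (intro integrable_norm int)
      show "integrable lborel (\<lambda>v. c ^ k / fact k * ?g v)" by (intro integrable_mult_right g)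
      fix v :: real
      have "norm (of_real (- c) ^ k / fact k :: complex) = c ^ k / fact k" using c by (simp add: norm_divide norm_power)
      moreover have "norm (indicator {0<..} v *\<^sub>R exp ((\<mu> - of_nat k) * of_real v - of_real (y * exp v))) \<le> ?g v"
        by (auto simp: indicator_def norm_exp_eq_Re left_diff_distrib)
      ultimately show "norm (?f k v) \<le> c ^ k / fact k * ?g v"
        unfolding norm_mult using c by (intro mult_mono) auto
    qed
    also have "\<dots> = c ^ k / fact k * (\<integral>v. ?g v \<partial>lborel)" by simp
    finally show ?thesis .
  qed
  have sN: "summable ?N"
  proof (rule summable_comparison_test'[where N = 0])
    show "summable (\<lambda>k. inverse (fact k) * c ^ k * (\<integral>v. ?g v \<partial>lborel))"
      by (intro summable_mult2 summable_exp)
    show "norm (?N k) \<le> inverse (fact k) * c ^ k * (\<integral>v. ?g v \<partial>lborel)" for k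
      using N[of k] by (simp add: divide_inverse mult_ac)
  qed
  have "norm (?I k) \<le> ?N k" for k
    using integral_norm_bound[of lborel "?f k"] f[of k] by (simp add: has_bochner_integral_iff)
  then have sI: "?I sums suminf ?I"
    by (intro summable_sums summable_comparison_test'[OF sN, of 0]) simp
  have "has_bochner_integral lborel (\<lambda>v. indicator {0<..} v *\<^sub>R exp (\<mu> * of_real v - of_real (y * exp v + c * exp (- v)))) (suminf ?I)"
  proof (rule has_bochner_integral_sums[where f = ?f, OF f _ _ _ _ sI])
    show "has_bochner_integral lborel (\<lambda>v. complex_of_real (norm (?f k v))) (of_real (?N k))" for k
      by (intro has_bochner_integral_of_real has_bochner_integral_integrable integrable_norm int)
    show "summable (\<lambda>k. complex_of_real (?N k))" using summable_of_real[OF sN] .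
    have fe: "?f k v = indicator {0<..} v *\<^sub>R (exp (\<mu> * of_real v - of_real (y * exp v)) * (of_real (- c * exp (- v)) ^ k /\<^sub>R fact k))" for k v
    proof -
      have e1: "exp ((\<mu> - of_nat k) * complex_of_real v - of_real (y * exp v)) = exp (\<mu> * of_real v - of_real (y * exp v)) * exp (- of_real v) ^ k"
        by (simp add: exp_of_nat_mult[symmetric] exp_add[symmetric] algebra_simps)
      have e2: "of_real (- c * exp (- v)) ^ k = (of_real (- c) ^ k * exp (- of_real v) ^ k :: complex)"
        by (simp only: of_real_mult power_mult_distrib exp_of_real[symmetric] of_real_minus)
      show ?thesis unfolding e1 e2 by (simp only: scaleR_conv_of_real divide_inverse of_real_inverse of_real_fact mult_ac)
    qed
    show "(\<lambda>k. ?f k v) sums (indicator {0<..} v *\<^sub>R exp (\<mu> * of_real v - of_real (y * exp v + c * exp (- v))))" for v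
    proof -
      have "(\<lambda>k. indicator {0<..} v *\<^sub>R (exp (\<mu> * of_real v - of_real (y * exp v)) * (of_real (- c * exp (- v)) ^ k /\<^sub>R fact k)))
        sums (indicator {0<..} v *\<^sub>R (exp (\<mu> * of_real v - of_real (y * exp v)) * exp (of_real (- c * exp (- v)))))"
        by (intro sums_scaleR_right sums_mult exp_converges)
      also have "exp (\<mu> * of_real v - of_real (y * exp v)) * exp (of_real (- c * exp (- v))) = exp (\<mu> * of_real v - of_real (y * exp v + c * exp (- v)))"
        unfolding exp_add[symmetric] by (simp add: algebra_simps)
      finally show ?thesis unfolding fe .
    qed
    show "summable (\<lambda>k. norm (?f k v))" for v
      unfolding fe norm_scaleR norm_mult
      by (intro summable_mult) (use summable_norm_exp[of "complex_of_real (- c * exp (- v))"] in simp)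
  qed
  with sI show ?thesis by blast
qed

text \<open>Reflecting the half v < 0 exchanges 1 and y and changes the sign of the order. Each half
  is a series of Gamma values minus a series of lower incomplete ones; the latter sum to T and - T
  and cancel. \<open>A\<close> and \<open>B\<close> are what becomes \<open>bessel_I\<close> at
  \<nu> and at - \<nu>.\<close>

lemma has_bochner_integral_bessel_kernel:
  fixes \<nu> :: complex
  assumes \<nu>: "\<nu> \<notin> \<int>" and y: "y > 0"
  shows "\<exists>A B. (\<lambda>k. of_real (- y) ^ k / fact k * Gamma (- \<nu> - of_nat k)) sums A
    \<and> (\<lambda>k. (-1) ^ k / fact k * (exp ((of_nat k - \<nu>) * of_real (ln y)) * Gamma (\<nu> - of_nat k))) sums B
    \<and> has_bochner_integral lborel (\<lambda>v. exp (- \<nu> * of_real v - of_real (exp v + y * exp (- v)))) (A + B)"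
proof -
  have \<nu>': "- \<nu> \<notin> \<int>" using \<nu> by (metis Ints_minus minus_minus)
  obtain L1 where L1: "(\<lambda>k. of_real (- y) ^ k / fact k * (exp (- (- \<nu> - of_nat k) * of_real (ln 1)) * Gamma (- \<nu> - of_nat k) - lower_gamma_series (- \<nu> - of_nat k) 1)) sums L1"
    "has_bochner_integral lborel (\<lambda>v. indicator {0<..} v *\<^sub>R exp (- \<nu> * of_real v - of_real (1 * exp v + y * exp (- v)))) L1"
    using has_bochner_integral_bessel_kernel_Ioi[OF \<nu>' zero_less_one y] by blast
  obtain L2 where L2: "(\<lambda>k. of_real (- 1) ^ k / fact k * (exp (- (\<nu> - of_nat k) * of_real (ln y)) * Gamma (\<nu> - of_nat k) - lower_gamma_series (\<nu> - of_nat k) y)) sums L2"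
    "has_bochner_integral lborel (\<lambda>v. indicator {0<..} v *\<^sub>R exp (\<nu> * of_real v - of_real (y * exp v + 1 * exp (- v)))) L2"
    using has_bochner_integral_bessel_kernel_Ioi[OF \<nu> y zero_less_one] by blast
  obtain T where T: "(\<lambda>k. of_real (- y) ^ k / fact k * lower_gamma_series (- \<nu> - of_nat k) 1) sums T"
     "(\<lambda>j. (-1) ^ j / fact j * lower_gamma_series (\<nu> - of_nat j) y) sums (- T)"
    using lower_gamma_series_double_sum[OF \<nu>] by blast
  have A: "(\<lambda>k. of_real (- y) ^ k / fact k * Gamma (- \<nu> - of_nat k)) sums (L1 + T)"
    using sums_add[OF L1(1) T(1)] by (simp add: right_diff_distrib)
  have B: "(\<lambda>k. (-1) ^ k / fact k * (exp ((of_nat k - \<nu>) * of_real (ln y)) * Gamma (\<nu> - of_nat k))) sums (L2 - T)"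
    using sums_add[OF L2(1) T(2)] by (simp add: right_diff_distrib)
  let ?E = "\<lambda>v. exp (- \<nu> * of_real v - of_real (exp v + y * exp (- v)))"
  have "has_bochner_integral lborel (\<lambda>v. indicator {0<..} (- v) *\<^sub>R ?E v) L2"
    using L2(2) lborel_has_bochner_integral_real_affine_iff[of "-1" "\<lambda>v. indicator {0<..} v *\<^sub>R exp (\<nu> * of_real v - of_real (y * exp v + 1 * exp (- v)))" L2 0]
    by (simp add: add.commute)
  then have "has_bochner_integral lborel (\<lambda>v. indicator {0<..} v *\<^sub>R ?E v + indicator {0<..} (- v) *\<^sub>R ?E v) (L1 + L2)"
    using L1(2) by (intro has_bochner_integral_add) auto
  moreover have "AE v in lborel. indicator {0<..} v *\<^sub>R ?E v + indicator {0<..} (- v) *\<^sub>R ?E v = ?E v"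
    using AE_lborel_singleton[of 0] by eventually_elim (auto simp: indicator_def)
  ultimately have "has_bochner_integral lborel ?E (L1 + L2)"
    using integrable_bessel_kernel[OF zero_less_one y, of "- \<nu>"]
    by (subst (asm) has_bochner_integral_cong_AE) (auto simp: has_bochner_integral_iff)
  then have "has_bochner_integral lborel ?E ((L1 + T) + (L2 - T))" by simp
  with A B show ?thesis by blast
qed


section \<open>Comparison of the integral with the Bessel series\<close>

lemma sin_shift_of_nat_pi: "sin (of_real pi * (z + of_nat k)) = (-1) ^ k * sin (of_real pi * z)" for z :: complex
proof (induction k)
  case (Suc k)
  have "of_real pi * (z + of_nat (Suc k)) = of_real pi * (z + of_nat k) + of_real pi" by (simp add: algebra_simps)
  then show ?case using Suc by (simp add: sin_add)
qed simp

text \<open>The value is \<open>K\<^sub>\<nu>(2h)\<close>: this is the usual integral over the exponential variable, translated by \<open>ln h\<close>.\<close>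

definition bessel_K_int :: "complex \<Rightarrow> real \<Rightarrow> complex" where
  "bessel_K_int \<nu> h = 1 / 2 * exp (\<nu> * of_real (ln h)) *
     (\<integral>v. exp (- \<nu> * of_real v - of_real (exp v + h\<^sup>2 * exp (- v))) \<partial>lborel)"

text \<open>Reflection turns \<open>rGamma (\<nu> + of_nat k + 1)\<close> into Gamma (- \<nu> - k)
  times - (-1)^k sin (pi \<nu>) / pi; the alternating sign goes into the powers of - h^2.\<close>

lemma bessel_I_eq_Gamma_series:
  assumes h: "h > 0" and \<nu>: "\<nu> \<notin> \<int>"
    and A: "(\<lambda>k. of_real (- (h\<^sup>2)) ^ k / fact k * Gamma (- \<nu> - of_nat k)) sums A"
  shows "bessel_I \<nu> (of_real (2 * h)) = - (sin (of_real pi * \<nu>) / of_real pi) * exp (\<nu> * of_real (ln h)) * A"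
proof -
  have tm: "(of_real (2 * h) / 2) powr (\<nu> + 2 * of_nat k) * rGamma (\<nu> + of_nat k + 1) / fact k
    = - (sin (of_real pi * \<nu>) / of_real pi) * exp (\<nu> * of_real (ln h)) * (of_real (- (h\<^sup>2)) ^ k / fact k * Gamma (- \<nu> - of_nat k))" for k
  proof -
    have ni: "\<nu> + of_nat k \<notin> \<int>"
    proof
      assume "\<nu> + of_nat k \<in> \<int>"
      then have "\<nu> + of_nat k - of_nat k \<in> \<int>" by (intro Ints_diff) auto
      then show False using \<nu> by simp
    qed
    have ni2: "- \<nu> - of_nat k \<notin> \<int>\<^sub>\<le>\<^sub>0"
    proof
      assume "- \<nu> - of_nat k \<in> \<int>\<^sub>\<le>\<^sub>0"
      then have "- (- \<nu> - of_nat k) \<in> \<int>" by (intro Ints_minus nonpos_Ints_Int)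
      then show False using ni by (simp add: add.commute)
    qed
    have s: "sin (of_real pi * (- \<nu> - of_nat k)) = - ((-1) ^ k * sin (of_real pi * \<nu>))"
    proof -
      have "of_real pi * (- \<nu> - of_nat k) = - (of_real pi * (\<nu> + of_nat k))" by (simp add: algebra_simps)
      then show ?thesis by (simp only: sin_minus sin_shift_of_nat_pi)
    qed
    have "rGamma (- \<nu> - of_nat k) * rGamma (1 - (- \<nu> - of_nat k)) = sin (of_real pi * (- \<nu> - of_nat k)) / of_real pi"
      by (rule rGamma_reflection_complex)
    moreover have "1 - (- \<nu> - of_nat k) = \<nu> + of_nat k + 1" by simp
    ultimately have "Gamma (- \<nu> - of_nat k) * (rGamma (- \<nu> - of_nat k) * rGamma (\<nu> + of_nat k + 1))
       = Gamma (- \<nu> - of_nat k) * (- ((-1) ^ k * sin (of_real pi * \<nu>)) / of_real pi)"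
      by (simp add: s)
    moreover have "Gamma (- \<nu> - of_nat k) * rGamma (- \<nu> - of_nat k) = 1"
      using ni2 by (simp add: rGamma_inverse_Gamma Gamma_eq_zero_iff)
    then have "Gamma (- \<nu> - of_nat k) * (rGamma (- \<nu> - of_nat k) * R) = R" for R
      by (simp only: mult.assoc[symmetric] mult_1)
    ultimately have rG: "rGamma (\<nu> + of_nat k + 1) = Gamma (- \<nu> - of_nat k) * (- ((-1) ^ k * sin (of_real pi * \<nu>)) / of_real pi)"
      by (simp only:)
    have "of_real (2 * h) / 2 = complex_of_real h" by simp
    then have "(of_real (2 * h) / 2) powr (\<nu> + 2 * of_nat k) = exp ((\<nu> + 2 * of_nat k) * complex_of_real (ln h))"
      using of_real_powr_eq_exp[OF h] by simp
    also have "\<dots> = exp (\<nu> * of_real (ln h)) * of_real (h\<^sup>2) ^ k"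
    proof -
      have "complex_of_real (h\<^sup>2) = exp (of_real (ln h)) ^ 2" using h by (simp add: exp_of_real)
      also have "\<dots> = exp (2 * of_real (ln h))" by (simp add: exp_double)
      finally have hk: "of_real (h\<^sup>2) ^ k = exp (of_nat k * (2 * complex_of_real (ln h)))" by (simp add: exp_of_nat_mult)
      show ?thesis unfolding hk exp_add[symmetric] by (simp add: algebra_simps)
    qed
    finally have pw: "(of_real (2 * h) / 2) powr (\<nu> + 2 * of_nat k) = exp (\<nu> * of_real (ln h)) * of_real (h\<^sup>2) ^ k" .
    have m: "of_real (- (h\<^sup>2)) ^ k = ((-1) ^ k * of_real (h\<^sup>2) ^ k :: complex)"
      unfolding power_mult_distrib[symmetric] by simp
    show ?thesis unfolding pw rG m by simp
  qed
  have "(\<lambda>k. - (sin (of_real pi * \<nu>) / of_real pi) * exp (\<nu> * of_real (ln h)) * (of_real (- (h\<^sup>2)) ^ k / fact k * Gamma (- \<nu> - of_nat k)))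
     sums (- (sin (of_real pi * \<nu>) / of_real pi) * exp (\<nu> * of_real (ln h)) * A)"
    by (intro sums_mult A)
  then show ?thesis unfolding bessel_I_def tm by (simp add: sums_iff)
qed

text \<open>\<open>A\<close> gives \<open>bessel_I\<close> at \<nu> directly; \<open>B\<close> gives
  it at - \<nu> after multiplication by \<open>e\<^sup>2\<close>, which is h powr (2 \<nu>). The
  common sine then cancels against the denominator of the quotient.\<close>

lemma bessel_K_quotient_eq_int:
  assumes h: "h > 0" and \<nu>: "\<nu> \<notin> \<int>"
  shows "bessel_K_quotient \<nu> (of_real (2 * h)) = bessel_K_int \<nu> h"
proof -
  have h2: "h\<^sup>2 > 0" using h by simp
  obtain A B where A: "(\<lambda>k. of_real (- (h\<^sup>2)) ^ k / fact k * Gamma (- \<nu> - of_nat k)) sums A"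
    and B: "(\<lambda>k. (-1) ^ k / fact k * (exp ((of_nat k - \<nu>) * of_real (ln (h\<^sup>2))) * Gamma (\<nu> - of_nat k))) sums B"
    and I: "has_bochner_integral lborel (\<lambda>v. exp (- \<nu> * of_real v - of_real (exp v + h\<^sup>2 * exp (- v)))) (A + B)"
    using has_bochner_integral_bessel_kernel[OF \<nu> h2] by blast
  have \<nu>': "- \<nu> \<notin> \<int>" using \<nu> by (metis Ints_minus minus_minus)
  define e where "e = exp (\<nu> * complex_of_real (ln h))"
  have e0: "e \<noteq> 0" by (simp add: e_def)
  have em: "exp (- \<nu> * complex_of_real (ln h)) = 1 / e" by (simp add: e_def exp_minus inverse_eq_divide)
  have "(\<lambda>k. e\<^sup>2 * ((-1) ^ k / fact k * (exp ((of_nat k - \<nu>) * of_real (ln (h\<^sup>2))) * Gamma (\<nu> - of_nat k)))) sums (e\<^sup>2 * B)"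
    by (intro sums_mult B)
  also have "(\<lambda>k. e\<^sup>2 * ((-1) ^ k / fact k * (exp ((of_nat k - \<nu>) * of_real (ln (h\<^sup>2))) * Gamma (\<nu> - of_nat k))))
      = (\<lambda>k. of_real (- (h\<^sup>2)) ^ k / fact k * Gamma (- (- \<nu>) - of_nat k))"
  proof
    fix k
    have "e\<^sup>2 = exp (2 * (\<nu> * complex_of_real (ln h)))" by (simp add: e_def exp_double)
    moreover have "ln (h\<^sup>2) = 2 * ln h" using h by (simp add: ln_realpow)
    ultimately have "e\<^sup>2 * exp ((of_nat k - \<nu>) * of_real (ln (h\<^sup>2))) = exp (of_nat k * of_real (ln (h\<^sup>2)))"
      by (simp add: exp_add[symmetric] algebra_simps)
    also have "\<dots> = of_real (h\<^sup>2) ^ k"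
      using h2 by (simp only: exp_of_nat_mult exp_of_real exp_ln)
    finally have 1: "e\<^sup>2 * exp ((of_nat k - \<nu>) * of_real (ln (h\<^sup>2))) = of_real (h\<^sup>2) ^ k" .
    have m: "of_real (- (h\<^sup>2)) ^ k = ((-1) ^ k * of_real (h\<^sup>2) ^ k :: complex)"
      unfolding power_mult_distrib[symmetric] by simp
    show "e\<^sup>2 * ((-1) ^ k / fact k * (exp ((of_nat k - \<nu>) * of_real (ln (h\<^sup>2))) * Gamma (\<nu> - of_nat k)))
        = of_real (- (h\<^sup>2)) ^ k / fact k * Gamma (- (- \<nu>) - of_nat k)"
      unfolding m 1[symmetric] minus_minus by (simp add: mult_ac)
  qed
  finally have B': "(\<lambda>k. of_real (- (h\<^sup>2)) ^ k / fact k * Gamma (- (- \<nu>) - of_nat k)) sums (e\<^sup>2 * B)" .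
  have I1: "bessel_I \<nu> (of_real (2 * h)) = - (sin (of_real pi * \<nu>) / of_real pi) * e * A"
    unfolding e_def by (rule bessel_I_eq_Gamma_series[OF h \<nu> A])
  have I2: "bessel_I (- \<nu>) (of_real (2 * h)) = - (sin (of_real pi * (- \<nu>)) / of_real pi) * (1 / e) * (e\<^sup>2 * B)"
    unfolding em[symmetric] by (rule bessel_I_eq_Gamma_series[OF h \<nu>' B'])
  have sn: "sin (of_real pi * \<nu>) \<noteq> 0" using \<nu> by (auto simp: sin_eq_0 Ints_def)
  have "bessel_K_quotient \<nu> (of_real (2 * h)) = 1 / 2 * e * (A + B)"
    unfolding bessel_K_quotient_def I1 I2 using sn e0 by (simp add: field_simps power2_eq_square)
  then show ?thesis
    unfolding bessel_K_int_def e_def[symmetric] using I by (simp add: has_bochner_integral_iff)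
qed

text \<open>At order 0 \<open>bessel_K\<close> is a limit in the order, so the integral must be
  continuous there. For |Re \<nu>| <= 1 the kernels of orders 1 and -1 together dominate.\<close>

lemma bessel_K_int_tendsto_0:
  assumes h: "h > 0"
  shows "((\<lambda>\<nu>. bessel_K_int \<nu> h) \<longlongrightarrow> bessel_K_int 0 h) (at 0)"
proof -
  let ?E = "\<lambda>\<nu> v. exp (- \<nu> * complex_of_real v - of_real (exp v + h\<^sup>2 * exp (- v)))"
  have h2: "h\<^sup>2 > 0" using h by simp
  have int: "integrable lborel (?E \<nu>)" for \<nu>
    using integrable_bessel_kernel[OF zero_less_one h2, of "- \<nu>"] by simp
  have "((\<lambda>\<nu>. \<integral>v. ?E \<nu> v \<partial>lborel) \<longlongrightarrow> (\<integral>v. ?E 0 v \<partial>lborel)) (at 0)"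
  proof (rule integral_tendsto_dominated[where S = "ball 0 1" and w = "\<lambda>v. norm (?E 1 v) + norm (?E (- 1) v)"])
    show "?E \<nu> \<in> borel_measurable lborel" for \<nu> using int[of \<nu>] by (rule borel_measurable_integrable)
    show "integrable lborel (\<lambda>v. norm (?E 1 v) + norm (?E (- 1) v))"
      by (rule Bochner_Integration.integrable_add[OF integrable_norm[OF int] integrable_norm[OF int]])
    show "continuous_on (ball 0 1) (\<lambda>\<nu>. ?E \<nu> v)" for v by (intro continuous_intros)
    fix \<nu> :: complex and v :: real assume "\<nu> \<in> ball 0 1"
    then have "\<bar>Re \<nu>\<bar> \<le> 1" using abs_Re_le_cmod[of \<nu>] by simp
    then have "- Re \<nu> * v \<le> \<bar>v\<bar>"
      by (metis abs_ge_self abs_minus_cancel abs_mult abs_ge_zero mult_left_le_one_le order_trans)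
    then have "exp (- Re \<nu> * v - (exp v + h\<^sup>2 * exp (- v))) \<le> exp (\<bar>v\<bar> - (exp v + h\<^sup>2 * exp (- v)))" by simp
    also have "\<dots> \<le> exp (- 1 * v - (exp v + h\<^sup>2 * exp (- v))) + exp (1 * v - (exp v + h\<^sup>2 * exp (- v)))"
      by (cases "v \<ge> 0") auto
    finally show "norm (?E \<nu> v) \<le> norm (?E 1 v) + norm (?E (- 1) v)"
      by (simp add: norm_exp_eq_Re)
  qed auto
  then show ?thesis
    unfolding bessel_K_int_def by (intro tendsto_mult tendsto_const tendsto_intros)
qed

text \<open>The bound on Re \<nu>, which \<nu> = s / 2 satisfies, leaves 0 as the only integer
  order; the limit is then read off from the integral on a punctured ball.\<close>

lemma bessel_K_eq_int:
  assumes h: "h > 0" and \<nu>: "\<bar>Re \<nu>\<bar> < 1"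
  shows "bessel_K \<nu> (of_real (2 * h)) = bessel_K_int \<nu> h"
proof (cases "\<nu> \<in> \<int>")
  case False
  then show ?thesis by (simp only: bessel_K_def if_False bessel_K_quotient_eq_int[OF h False])
next
  case True
  then obtain n where n: "\<nu> = of_int n" by (auto elim: Ints_cases)
  have \<nu>0: "\<nu> = 0" using \<nu> unfolding n by simp
  have "\<forall>\<^sub>F \<mu> in at 0. bessel_K_int \<mu> h = bessel_K_quotient \<mu> (of_real (2 * h))"
    unfolding eventually_at
  proof (intro exI[of _ 1] conjI ballI impI)
    fix \<mu> :: complex assume "\<mu> \<noteq> 0 \<and> dist \<mu> 0 < 1"
    then have "\<mu> \<notin> \<int>" by (auto elim!: Ints_cases)
    then show "bessel_K_int \<mu> h = bessel_K_quotient \<mu> (of_real (2 * h))"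
      by (rule bessel_K_quotient_eq_int[OF h, symmetric])
  qed simp
  with bessel_K_int_tendsto_0[OF h]
  have "((\<lambda>\<mu>. bessel_K_quotient \<mu> (of_real (2 * h))) \<longlongrightarrow> bessel_K_int 0 h) (at 0)"
    by (rule Lim_transform_eventually)
  then have "Lim (at 0) (\<lambda>\<mu>. bessel_K_quotient \<mu> (of_real (2 * h))) = bessel_K_int 0 h"
    by (intro tendsto_Lim) auto
  then show ?thesis by (simp add: bessel_K_def \<nu>0)
qed

text \<open>For fixed v the integral over u, in the variable 2 u - v, gives Gamma ((w + \<nu>) / 2);
  the remaining integral over v gives Gamma ((w - \<nu>) / 2). The condition on Re w makes both
  converge.\<close>

lemma has_bochner_integral_bessel_K_int_mellin:
  assumes b: "b > 0" and w: "Re w > \<bar>Re \<nu>\<bar>"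
  shows "has_bochner_integral lborel (\<lambda>u. exp (w * of_real u) * bessel_K_int \<nu> (b * exp u))
    (1 / 4 * exp (- w * of_real (ln b)) * Gamma ((w + \<nu>) / 2) * Gamma ((w - \<nu>) / 2))"
proof -
  define f where "f w \<nu> v u = 1 / 2 * exp (\<nu> * of_real (ln b + u) + w * of_real u) *
      exp (- \<nu> * of_real v - of_real (exp v + (b * exp u)\<^sup>2 * exp (- v)))" for w \<nu> :: complex and v u :: real
  define g where "g w \<nu> v = 1 / 4 * exp (- w * of_real (ln b)) * Gamma ((w + \<nu>) / 2) *
      exp ((w - \<nu>) / 2 * of_real v - of_real (1 * exp v))" for w \<nu> :: complex and v :: real
  have fg: "has_bochner_integral lborel (f w \<nu> v) (g w \<nu> v)" if "Re w > \<bar>Re \<nu>\<bar>" for w \<nu> v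
  proof -
    have b2: "b\<^sup>2 > 0" using b by simp
    have "has_bochner_integral lborel (\<lambda>q. exp ((w + \<nu>) / 2 * of_real q - of_real (b\<^sup>2 * exp q)))
       (Gamma ((w + \<nu>) / 2) * exp (- ((w + \<nu>) / 2) * of_real (ln (b\<^sup>2))))"
      using that b2 by (intro has_bochner_integral_Gamma_exp) auto
    then have "has_bochner_integral lborel (\<lambda>u. exp ((w + \<nu>) / 2 * of_real (- v + 2 * u) - of_real (b\<^sup>2 * exp (- v + 2 * u))))
       (Gamma ((w + \<nu>) / 2) * exp (- ((w + \<nu>) / 2) * of_real (ln (b\<^sup>2))) /\<^sub>R \<bar>2\<bar>)"
      by (subst (asm) lborel_has_bochner_integral_real_affine_iff[where c = 2 and t = "- v"]) auto
    from has_bochner_integral_mult_right[OF this, of "1 / 2 * exp (\<nu> * of_real (ln b)) * exp ((w - \<nu>) / 2 * of_real v - of_real (exp v))"]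
    have "has_bochner_integral lborel (\<lambda>u. 1 / 2 * exp (\<nu> * of_real (ln b)) * exp ((w - \<nu>) / 2 * of_real v - of_real (exp v)) *
       exp ((w + \<nu>) / 2 * of_real (- v + 2 * u) - of_real (b\<^sup>2 * exp (- v + 2 * u))))
      (1 / 2 * exp (\<nu> * of_real (ln b)) * exp ((w - \<nu>) / 2 * of_real v - of_real (exp v)) *
       (Gamma ((w + \<nu>) / 2) * exp (- ((w + \<nu>) / 2) * of_real (ln (b\<^sup>2))) /\<^sub>R \<bar>2\<bar>))" .
    also have "(\<lambda>u. 1 / 2 * exp (\<nu> * of_real (ln b)) * exp ((w - \<nu>) / 2 * of_real v - of_real (exp v)) *
       exp ((w + \<nu>) / 2 * of_real (- v + 2 * u) - of_real (b\<^sup>2 * exp (- v + 2 * u)))) = f w \<nu> v"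
    proof
      fix u :: real
      have e: "b\<^sup>2 * exp (- v + 2 * u) = (b * exp u)\<^sup>2 * exp (- v)"
        by (simp only: exp_add exp_double power_mult_distrib) (simp only: mult_ac)
      define p q where "p = (w + \<nu>) / 2" and "q = (w - \<nu>) / 2"
      have pq: "w = p + q" "\<nu> = p - q" by (simp_all add: p_def q_def field_simps)
      show "1 / 2 * exp (\<nu> * of_real (ln b)) * exp ((w - \<nu>) / 2 * of_real v - of_real (exp v)) *
       exp ((w + \<nu>) / 2 * of_real (- v + 2 * u) - of_real (b\<^sup>2 * exp (- v + 2 * u))) = f w \<nu> v u"
        unfolding f_def e mult.assoc exp_add[symmetric] p_def[symmetric] q_def[symmetric]
        unfolding pq by (simp add: algebra_simps)
    qed
    also have "1 / 2 * exp (\<nu> * of_real (ln b)) * exp ((w - \<nu>) / 2 * of_real v - of_real (exp v)) *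
       (Gamma ((w + \<nu>) / 2) * exp (- ((w + \<nu>) / 2) * of_real (ln (b\<^sup>2))) /\<^sub>R \<bar>2\<bar>) = g w \<nu> v"
    proof -
      have "- ((w + \<nu>) / 2) * of_real (ln (b\<^sup>2)) = - w * of_real (ln b) - \<nu> * of_real (ln b)"
        using b by (simp add: ln_realpow field_simps)
      then have "exp (\<nu> * of_real (ln b)) * exp (- ((w + \<nu>) / 2) * of_real (ln (b\<^sup>2))) = exp (- w * of_real (ln b))"
        unfolding exp_add[symmetric] by simp
      then show ?thesis unfolding g_def by (simp add: scaleR_conv_of_real mult_ac)
    qed
    finally show ?thesis .
  qed
  have gI: "has_bochner_integral lborel (g w \<nu>) (1 / 4 * exp (- w * of_real (ln b)) * Gamma ((w + \<nu>) / 2) * Gamma ((w - \<nu>) / 2))"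
    if "Re w > \<bar>Re \<nu>\<bar>" for w \<nu>
  proof -
    have "has_bochner_integral lborel (\<lambda>v. exp ((w - \<nu>) / 2 * of_real v - of_real (1 * exp v))) (Gamma ((w - \<nu>) / 2) * exp (- ((w - \<nu>) / 2) * of_real (ln 1)))"
      using that by (intro has_bochner_integral_Gamma_exp) auto
    from has_bochner_integral_mult_right[OF this, of "1 / 4 * exp (- w * of_real (ln b)) * Gamma ((w + \<nu>) / 2)"]
    show ?thesis by (simp add: g_def[abs_def])
  qed
  have fn: "complex_of_real (norm (f w \<nu> v u)) = f (of_real (Re w)) (of_real (Re \<nu>)) v u" for w \<nu> v u
  proof -
    have "f (of_real (Re w)) (of_real (Re \<nu>)) v u = of_real (1 / 2 * exp (Re \<nu> * (ln b + u) + Re w * u) * exp (- Re \<nu> * v - (exp v + (b * exp u)\<^sup>2 * exp (- v))))"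
      unfolding f_def by (simp only: of_real_mult exp_of_real[symmetric] of_real_add of_real_diff of_real_minus) simp
    moreover have "norm (f w \<nu> v u) = 1 / 2 * exp (Re \<nu> * (ln b + u) + Re w * u) * exp (- Re \<nu> * v - (exp v + (b * exp u)\<^sup>2 * exp (- v)))"
      by (simp add: f_def norm_mult norm_exp_eq_Re)
    ultimately show ?thesis by (simp only:)
  qed
  show ?thesis
  proof (rule fubini_of_real_norm[where f = "f w \<nu>" and g = "g w \<nu>" and n = "g (of_real (Re w)) (of_real (Re \<nu>))"])
    show "(\<lambda>p. f w \<nu> (fst p) (snd p)) \<in> borel_measurable borel"
      unfolding f_def by (intro borel_measurable_continuous_onI continuous_intros)
    show "has_bochner_integral lborel (f w \<nu> v) (g w \<nu> v)" for v using w by (intro fg)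
    show "has_bochner_integral lborel (\<lambda>u. complex_of_real (norm (f w \<nu> v u))) (g (of_real (Re w)) (of_real (Re \<nu>)) v)" for v
      unfolding fn using fg[of "of_real (Re \<nu>)" "of_real (Re w)" v] w by simp
    show "integrable lborel (g (of_real (Re w)) (of_real (Re \<nu>)))"
      using gI[of "of_real (Re \<nu>)" "of_real (Re w)"] w by (simp add: has_bochner_integral_iff)
    show "has_bochner_integral lborel (g w \<nu>) (1 / 4 * exp (- w * of_real (ln b)) * Gamma ((w + \<nu>) / 2) * Gamma ((w - \<nu>) / 2))"
      by (rule gI[OF w])
    fix u :: real
    have h2: "(b * exp u)\<^sup>2 > 0" using b by simp
    let ?E = "\<lambda>v. exp (- \<nu> * complex_of_real v - of_real (exp v + (b * exp u)\<^sup>2 * exp (- v)))"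
    have "integrable lborel ?E" using integrable_bessel_kernel[OF zero_less_one h2, of "- \<nu>"] by simp
    then have "has_bochner_integral lborel ?E (\<integral>v. ?E v \<partial>lborel)" by (rule has_bochner_integral_integrable)
    from has_bochner_integral_mult_right[OF this, of "1 / 2 * exp (\<nu> * of_real (ln b + u) + w * of_real u)"]
    have "has_bochner_integral lborel (\<lambda>v. f w \<nu> v u) (1 / 2 * exp (\<nu> * of_real (ln b + u) + w * of_real u) * (\<integral>v. ?E v \<partial>lborel))"
      unfolding f_def .
    moreover have "ln (b * exp u) = ln b + u" using b by (simp add: ln_mult_pos)
    ultimately show "has_bochner_integral lborel (\<lambda>v. f w \<nu> v u) (exp (w * of_real u) * bessel_K_int \<nu> (b * exp u))"
      unfolding bessel_K_int_def by (simp only: exp_add mult_ac)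
  qed
qed

section \<open>Contour shifts between vertical lines\<close>

lemma integrable_exp_minus_abs: "integrable lborel (\<lambda>t. exp (- \<bar>t\<bar>) :: real)"
proof -
  have 1: "has_bochner_integral lborel (\<lambda>v. indicator {0<..} v *\<^sub>R exp (- 1 * of_real v) :: complex) (1 / 1)"
    by (rule has_bochner_integral_exp_minus_Ioi) simp
  then have a: "integrable lborel (\<lambda>v. norm (indicator {0<..} v *\<^sub>R exp (- 1 * of_real v) :: complex))"
    by (intro integrable_norm) (simp add: has_bochner_integral_iff)
  have b: "integrable lborel (\<lambda>v. norm (indicator {0<..} (0 + - 1 * v) *\<^sub>R exp (- 1 * of_real (0 + - 1 * v)) :: complex))"
    by (rule lborel_integrable_real_affine[OF a]) simp
  have c: "integrable lborel (\<lambda>v. norm (indicator {0<..} v *\<^sub>R exp (- 1 * of_real v) :: complex)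
     + norm (indicator {0<..} (0 + - 1 * v) *\<^sub>R exp (- 1 * of_real (0 + - 1 * v)) :: complex))"
    by (rule Bochner_Integration.integrable_add[OF a b])
  show ?thesis
  proof (rule integrable_cong_AE_imp[OF c])
    show "(\<lambda>t. exp (- \<bar>t\<bar>) :: real) \<in> borel_measurable lborel" by measurable
    show "AE v in lborel. norm (indicator {0<..} v *\<^sub>R exp (- 1 * of_real v) :: complex)
     + norm (indicator {0<..} (0 + - 1 * v) *\<^sub>R exp (- 1 * of_real (0 + - 1 * v)) :: complex) = exp (- \<bar>v\<bar>)"
      using AE_lborel_singleton[of 0]
      by eventually_elim (auto simp: indicator_def norm_exp_eq_Re)
  qed
qed

lemma exp_decay_bound:
  fixes g :: "real \<Rightarrow> complex"
  assumes cont: "continuous_on UNIV g"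
    and bound: "\<And>t. \<bar>t\<bar> \<ge> T \<Longrightarrow> norm (g t) \<le> C * exp (- \<bar>t\<bar>)"
  shows "\<exists>K\<ge>0. \<forall>t. norm (g t) \<le> K * exp (- \<bar>t\<bar>)"
proof -
  have "compact ((\<lambda>t. norm (g t) * exp \<bar>t\<bar>) ` {- \<bar>T\<bar>..\<bar>T\<bar>})"
    by (intro compact_continuous_image continuous_intros continuous_on_subset[OF cont]) auto
  from compact_imp_bounded[OF this]
  obtain B where "\<forall>x\<in>(\<lambda>t. norm (g t) * exp \<bar>t\<bar>) ` {- \<bar>T\<bar>..\<bar>T\<bar>}. norm x \<le> B"
    unfolding bounded_iff by blast
  then have B: "norm (norm (g t) * exp \<bar>t\<bar>) \<le> B" if "t \<in> {- \<bar>T\<bar>..\<bar>T\<bar>}" for t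
    using that by blast
  have "norm (g t) \<le> max \<bar>C\<bar> \<bar>B\<bar> * exp (- \<bar>t\<bar>)" for t
  proof (cases "\<bar>t\<bar> \<ge> T")
    case True
    have "C * exp (- \<bar>t\<bar>) \<le> max \<bar>C\<bar> \<bar>B\<bar> * exp (- \<bar>t\<bar>)" by (intro mult_right_mono) auto
    then show ?thesis using bound[OF True] by linarith
  next
    case False
    then have "norm (norm (g t) * exp \<bar>t\<bar>) \<le> B" by (intro B) auto
    then have "norm (g t) * exp \<bar>t\<bar> \<le> max \<bar>C\<bar> \<bar>B\<bar>" by (simp add: abs_mult)
    then have "norm (g t) * exp \<bar>t\<bar> * exp (- \<bar>t\<bar>) \<le> max \<bar>C\<bar> \<bar>B\<bar> * exp (- \<bar>t\<bar>)" by (intro mult_right_mono) auto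
    then show ?thesis by (simp add: mult.assoc exp_add[symmetric])
  qed
  then show ?thesis by (intro exI[of _ "max \<bar>C\<bar> \<bar>B\<bar>"]) auto
qed

lemma integrable_if_exp_decay:
  fixes g :: "real \<Rightarrow> complex"
  assumes cont: "continuous_on UNIV g"
    and bound: "\<And>t. \<bar>t\<bar> \<ge> T \<Longrightarrow> norm (g t) \<le> C * exp (- \<bar>t\<bar>)"
  shows "integrable lborel g"
proof -
  obtain K where K: "K \<ge> 0" "\<And>t. norm (g t) \<le> K * exp (- \<bar>t\<bar>)"
    using exp_decay_bound[OF cont bound] by blast
  show ?thesis
  proof (rule Bochner_Integration.integrable_bound)
    show "integrable lborel (\<lambda>t. K * exp (- \<bar>t\<bar>))" by (intro integrable_mult_right integrable_exp_minus_abs)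
    show "g \<in> borel_measurable lborel" using borel_measurable_continuous_onI[OF cont] by simp
    show "AE t in lborel. norm (g t) \<le> norm (K * exp (- \<bar>t\<bar>))"
      using K by (intro AE_I2) (simp add: abs_mult)
  qed
qed

lemma Complex_eq_of_real: "Complex a t = of_real a + \<i> * of_real t"
  by (simp add: complex_eq_iff)

lemma integral_Icc_tendsto:
  fixes g :: "real \<Rightarrow> complex"
  assumes cont: "continuous_on UNIV g" and int: "integrable lborel g"
  shows "(\<lambda>n. integral {- real n..real n} g) \<longlonglongrightarrow> (\<integral>t. g t \<partial>lborel)"
proof -
  have eq: "integral {- real n..real n} g = (\<integral>t. indicator {- real n..real n} t *\<^sub>R g t \<partial>lborel)" for n
  proof -
    have "g absolutely_integrable_on {- real n..real n}"
      by (intro absolutely_integrable_continuous_real continuous_on_subset[OF cont]) auto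
    moreover have "(\<lambda>t. indicator {- real n..real n} t *\<^sub>R g t) \<in> borel_measurable borel"
      by (intro borel_measurable_continuous_on_indicator continuous_on_subset[OF cont]) auto
    ultimately have "has_bochner_integral lborel (\<lambda>t. indicator {- real n..real n} t *\<^sub>R g t) (integral {- real n..real n} g)"
      by (rule has_bochner_integral_absolutely_integrable)
    then show ?thesis by (simp add: has_bochner_integral_iff)
  qed
  show ?thesis unfolding eq
  proof (rule integral_dominated_convergence)
    show gm: "g \<in> borel_measurable lborel" using borel_measurable_continuous_onI[OF cont] by simp
    show "(\<lambda>t. indicator {- real n..real n} t *\<^sub>R g t) \<in> borel_measurable lborel" for n
      using gm by measurable
    show "integrable lborel (\<lambda>t. norm (g t))" using int by (rule integrable_norm)
    show "AE t in lborel. (\<lambda>n. indicator {- real n..real n} t *\<^sub>R g t) \<longlonglongrightarrow> g t"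
    proof (intro AE_I2 tendsto_eventually)
      fix t :: real
      show "\<forall>\<^sub>F n in sequentially. indicator {- real n..real n} t *\<^sub>R g t = g t"
        using eventually_ge_at_top[of "nat \<lceil>\<bar>t\<bar>\<rceil>"]
      proof eventually_elim
        case (elim n)
        then have "\<bar>t\<bar> \<le> real n" by linarith
        then show ?case by (simp add: indicator_def abs_le_iff)
      qed
    qed
    show "AE t in lborel. norm (indicator {- real n..real n} t *\<^sub>R g t) \<le> norm (g t)" for n
      by (intro AE_I2) (auto simp: indicator_def)
  qed
qed

text \<open>The residue theorem on rectangles between heights - n and n, then n to infinity: the
  horizontal sides are of order exp (- n). The convex set \<open>S\<close> contains the closed
  strip, so points outside \<open>S\<close> have winding number 0.\<close>

theorem vertical_contour_shift:
  fixes h :: "complex \<Rightarrow> complex" and a b :: real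
  assumes ab: "a < b" and S: "open S" "convex S" "{w. a \<le> Re w \<and> Re w \<le> b} \<subseteq> S"
    and P: "finite P" "\<And>p. p \<in> P \<Longrightarrow> a < Re p \<and> Re p < b"
    and h: "h holomorphic_on S - P"
    and bound: "\<And>w. a \<le> Re w \<Longrightarrow> Re w \<le> b \<Longrightarrow> \<bar>Im w\<bar> \<ge> T \<Longrightarrow> norm (h w) \<le> C * exp (- \<bar>Im w\<bar>)"
  shows "integrable lborel (\<lambda>t. h (Complex a t))" "integrable lborel (\<lambda>t. h (Complex b t))"
    and "(\<integral>t. h (Complex b t) \<partial>lborel) - (\<integral>t. h (Complex a t) \<partial>lborel) = 2 * of_real pi * (\<Sum>p\<in>P. residue h p)"
proof -
  have hc: "continuous_on (S - P) h" using h by (rule holomorphic_on_imp_continuous_on)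
  have cont: "continuous_on UNIV (\<lambda>t. h (Complex c t))" if "c = a \<or> c = b" for c
    unfolding Complex_eq_of_real
  proof (rule continuous_on_compose2[OF hc])
    show "continuous_on UNIV (\<lambda>t. complex_of_real c + \<i> * of_real t)" by (intro continuous_intros)
    show "(\<lambda>t. complex_of_real c + \<i> * of_real t) ` UNIV \<subseteq> S - P"
      using that S(3) P(2) ab by force
  qed
  show int: "integrable lborel (\<lambda>t. h (Complex a t))" "integrable lborel (\<lambda>t. h (Complex b t))"
  proof -
    have bd: "norm (h (Complex c t)) \<le> C * exp (- \<bar>t\<bar>)" if "c = a \<or> c = b" "\<bar>t\<bar> \<ge> T" for c t
      using bound[of "Complex c t"] that ab by auto
    show "integrable lborel (\<lambda>t. h (Complex a t))"
      by (rule integrable_if_exp_decay[where T = T and C = C, OF cont bd]) simp_all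
    show "integrable lborel (\<lambda>t. h (Complex b t))"
      by (rule integrable_if_exp_decay[where T = T and C = C, OF cont bd]) simp_all
  qed
  \<comment> \<open>Above this height the decay bound applies and no pole is left, so taller
    rectangles enclose all of \<open>P\<close>.\<close>
  define M where "M = Max (insert T ((\<lambda>p. \<bar>Im p\<bar>) ` P))"
  have M: "T \<le> M" "\<And>p. p \<in> P \<Longrightarrow> \<bar>Im p\<bar> \<le> M" unfolding M_def using P(1) by auto
  define hor where "hor n = contour_integral (linepath (Complex a (- real n)) (Complex b (- real n))) h
     + contour_integral (linepath (Complex b (real n)) (Complex a (real n))) h" for n
  have ev: "\<forall>\<^sub>F n in sequentially. real n > M \<and> n > 0"
    using eventually_gt_at_top[of "nat \<lceil>\<bar>M\<bar>\<rceil> + 1"]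
  proof eventually_elim
    case (elim n)
    then have "real n > \<bar>M\<bar>" by linarith
    then show ?case using elim by auto
  qed
  have key: "\<i> * (integral {- real n..real n} (\<lambda>t. h (Complex b t)) - integral {- real n..real n} (\<lambda>t. h (Complex a t))) + hor n
      = 2 * of_real pi * \<i> * (\<Sum>p\<in>P. residue h p)
      \<and> norm (hor n) \<le> 2 * (\<bar>C\<bar> * exp (- real n) * (b - a))" if n: "real n > M \<and> n > 0" for n
  proof -
    let ?n = "real n"
    define z1 z2 z3 z4 where "z1 = Complex a (- ?n)" and "z2 = Complex b (- ?n)" and "z3 = Complex b ?n" and "z4 = Complex a ?n"
    let ?R = "rectpath z1 z3"
    have n0: "?n > 0" using n by simp
    have seg: "closed_segment z1 z2 \<subseteq> {w. a \<le> Re w \<and> Re w \<le> b \<and> Im w = - ?n}"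
      "closed_segment z2 z3 \<subseteq> {w. Re w = b}" "closed_segment z3 z4 \<subseteq> {w. a \<le> Re w \<and> Re w \<le> b \<and> Im w = ?n}" "closed_segment z4 z1 \<subseteq> {w. Re w = a}"
      using ab n0 by (auto simp: z1_def z2_def z3_def z4_def closed_segment_same_Im closed_segment_same_Re closed_segment_eq_real_ivl)
    have nP: "w \<notin> P" if "a \<le> Re w \<and> Re w \<le> b \<and> (\<bar>Im w\<bar> = ?n \<or> Re w = a \<or> Re w = b)" for w
    proof
      assume "w \<in> P"
      then have "a < Re w" "Re w < b" "\<bar>Im w\<bar> \<le> M" using P(2) M(2) by auto
      then show False using that n by auto
    qed
    have sub0: "X \<subseteq> S - P" if "X \<subseteq> {w. a \<le> Re w \<and> Re w \<le> b \<and> (\<bar>Im w\<bar> = ?n \<or> Re w = a \<or> Re w = b)}" for X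
      using that S(3) nP by blast
    have sub: "closed_segment z1 z2 \<subseteq> S - P" "closed_segment z2 z3 \<subseteq> S - P" "closed_segment z3 z4 \<subseteq> S - P" "closed_segment z4 z1 \<subseteq> S - P"
    proof -
      show "closed_segment z1 z2 \<subseteq> S - P" by (rule sub0) (use seg(1) n0 in auto)
      show "closed_segment z2 z3 \<subseteq> S - P" by (rule sub0) (use seg(2) ab in auto)
      show "closed_segment z3 z4 \<subseteq> S - P" by (rule sub0) (use seg(3) n0 in auto)
      show "closed_segment z4 z1 \<subseteq> S - P" by (rule sub0) (use seg(4) ab in auto)
    qed
    have ci: "h contour_integrable_on linepath u v" if "closed_segment u v \<subseteq> S - P" for u v
      using hc that by (intro contour_integrable_continuous_linepath continuous_on_subset[OF hc])
    have path: "path_image ?R \<subseteq> S - P"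
      using sub by (auto simp: rectpath_def Let_def z1_def z2_def z3_def z4_def path_image_join)
    have "contour_integral ?R h = 2 * pi * \<i> * (\<Sum>p\<in>P. winding_number ?R p * residue h p)"
    proof (rule Residue_theorem[OF S(1) convex_connected[OF S(2)] P(1) h])
      show "valid_path ?R" "pathfinish ?R = pathstart ?R" by simp_all
      show "path_image ?R \<subseteq> S - P" by (rule path)
      show "\<forall>z. z \<notin> S \<longrightarrow> winding_number ?R z = 0"
      proof (intro allI impI)
        fix z assume "z \<notin> S"
        then have "z \<notin> cbox z1 z3" using S(3) by (auto simp: in_cbox_complex_iff z1_def z3_def)
        then show "winding_number ?R z = 0"
          by (intro winding_number_rectpath_outside) (use ab n0 in \<open>auto simp: z1_def z3_def\<close>)
      qed
    qed
    also have "(\<Sum>p\<in>P. winding_number ?R p * residue h p) = (\<Sum>p\<in>P. residue h p)"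
    proof (rule sum.cong[OF refl])
      fix p assume p: "p \<in> P"
      have "p \<in> box z1 z3" using P(2)[OF p] M(2)[OF p] n by (auto simp: in_box_complex_iff z1_def z3_def)
      then show "winding_number ?R p * residue h p = residue h p" by (simp add: winding_number_rectpath)
    qed
    finally have R: "contour_integral ?R h = 2 * pi * \<i> * (\<Sum>p\<in>P. residue h p)" .
    have split: "contour_integral ?R h = contour_integral (linepath z1 z2) h + (contour_integral (linepath z2 z3) h
       + (contour_integral (linepath z3 z4) h + contour_integral (linepath z4 z1) h))"
    proof -
      have "?R = linepath z1 z2 +++ linepath z2 z3 +++ linepath z3 z4 +++ linepath z4 z1"
        by (simp add: rectpath_def Let_def z1_def z2_def z3_def z4_def)
      then show ?thesis using ci[OF sub(1)] ci[OF sub(2)] ci[OF sub(3)] ci[OF sub(4)]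
        by (simp add: valid_path_join contour_integrable_join)
    qed
    have v1: "contour_integral (linepath z2 z3) h = \<i> * integral {- ?n..?n} (\<lambda>t. h (Complex b t))"
      by (rule contour_integral_linepath_same_Re) (use n0 in \<open>auto simp: z2_def z3_def\<close>)
    have "contour_integral (linepath z1 z4) h = \<i> * integral {- ?n..?n} (\<lambda>t. h (Complex a t))"
      by (rule contour_integral_linepath_same_Re) (use n0 in \<open>auto simp: z1_def z4_def\<close>)
    then have v2: "contour_integral (linepath z4 z1) h = - \<i> * integral {- ?n..?n} (\<lambda>t. h (Complex a t))"
      using contour_integral_reverse_linepath[of z4 z1 h] continuous_on_subset[OF hc sub(4)] by simp
    have hn: "hor n = contour_integral (linepath z1 z2) h + contour_integral (linepath z3 z4) h"
      by (simp add: hor_def z1_def z2_def z3_def z4_def)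
    have eq: "\<i> * (integral {- ?n..?n} (\<lambda>t. h (Complex b t)) - integral {- ?n..?n} (\<lambda>t. h (Complex a t))) + hor n
      = 2 * of_real pi * \<i> * (\<Sum>p\<in>P. residue h p)"
      using R unfolding split v1 v2 hn by (simp add: algebra_simps)
    have B: "norm (h w) \<le> \<bar>C\<bar> * exp (- ?n)" if "a \<le> Re w \<and> Re w \<le> b \<and> \<bar>Im w\<bar> = ?n" for w
    proof -
      have "norm (h w) \<le> C * exp (- \<bar>Im w\<bar>)" using that M(1) n by (intro bound) auto
      also have "\<dots> \<le> \<bar>C\<bar> * exp (- \<bar>Im w\<bar>)" by (intro mult_right_mono) auto
      finally show ?thesis using that by simp
    qed
    have "norm (contour_integral (linepath z1 z2) h) \<le> \<bar>C\<bar> * exp (- ?n) * norm (z2 - z1)"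
    proof (rule contour_integral_bound_linepath[OF ci[OF sub(1)]])
      show "norm (h w) \<le> \<bar>C\<bar> * exp (- ?n)" if "w \<in> closed_segment z1 z2" for w
        using that seg(1) n0 by (intro B) auto
    qed simp
    moreover have "norm (contour_integral (linepath z3 z4) h) \<le> \<bar>C\<bar> * exp (- ?n) * norm (z4 - z3)"
    proof (rule contour_integral_bound_linepath[OF ci[OF sub(3)]])
      show "norm (h w) \<le> \<bar>C\<bar> * exp (- ?n)" if "w \<in> closed_segment z3 z4" for w
        using that seg(3) n0 by (intro B) auto
    qed simp
    moreover have "z2 - z1 = of_real (b - a)" "z4 - z3 = - of_real (b - a)"
      by (simp_all add: z1_def z2_def z3_def z4_def complex_eq_iff)
    then have "norm (z2 - z1) = b - a" "norm (z4 - z3) = b - a"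
      using ab by (simp_all only: norm_minus_cancel norm_of_real)
    ultimately have "norm (hor n) \<le> 2 * (\<bar>C\<bar> * exp (- ?n) * (b - a))"
      unfolding hn using norm_triangle_ineq[of "contour_integral (linepath z1 z2) h" "contour_integral (linepath z3 z4) h"] by simp
    with eq show ?thesis by blast
  qed
  have "(\<lambda>n. 2 * (\<bar>C\<bar> * exp (- real n) * (b - a))) \<longlonglongrightarrow> 2 * (\<bar>C\<bar> * 0 * (b - a))"
  proof (intro tendsto_intros)
    have "((\<lambda>v. exp (- 1 * v)) \<longlongrightarrow> (0 :: real)) at_top" by (rule exp_minus_mult_tendsto_0) simp
    from filterlim_compose[OF this filterlim_real_sequentially] show "(\<lambda>n. exp (- real n)) \<longlonglongrightarrow> 0" by simp
  qed
  then have "(\<lambda>n. 2 * (\<bar>C\<bar> * exp (- real n) * (b - a))) \<longlonglongrightarrow> 0" by simp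
  then have "hor \<longlonglongrightarrow> 0"
    by (rule Lim_null_comparison[rotated]) (use ev key in \<open>auto elim!: eventually_mono\<close>)
  then have "(\<lambda>n. \<i> * (integral {- real n..real n} (\<lambda>t. h (Complex b t)) - integral {- real n..real n} (\<lambda>t. h (Complex a t))) + hor n)
     \<longlonglongrightarrow> \<i> * ((\<integral>t. h (Complex b t) \<partial>lborel) - (\<integral>t. h (Complex a t) \<partial>lborel)) + 0"
    by (intro tendsto_intros integral_Icc_tendsto cont int) auto
  moreover have "(\<lambda>n. \<i> * (integral {- real n..real n} (\<lambda>t. h (Complex b t)) - integral {- real n..real n} (\<lambda>t. h (Complex a t))) + hor n)
     \<longlonglongrightarrow> 2 * of_real pi * \<i> * (\<Sum>p\<in>P. residue h p)"
    by (rule tendsto_eventually) (use ev key in \<open>auto elim!: eventually_mono\<close>)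
  ultimately have "\<i> * ((\<integral>t. h (Complex b t) \<partial>lborel) - (\<integral>t. h (Complex a t) \<partial>lborel)) + 0 = 2 * of_real pi * \<i> * (\<Sum>p\<in>P. residue h p)"
    by (rule LIMSEQ_unique)
  then have "\<i> * ((\<integral>t. h (Complex b t) \<partial>lborel) - (\<integral>t. h (Complex a t) \<partial>lborel)) = \<i> * (2 * of_real pi * (\<Sum>p\<in>P. residue h p))"
    by (simp add: mult_ac)
  then show "(\<integral>t. h (Complex b t) \<partial>lborel) - (\<integral>t. h (Complex a t) \<partial>lborel) = 2 * of_real pi * (\<Sum>p\<in>P. residue h p)"
    by (simp only: mult_cancel_left) simp
qed

text \<open>One of exp (i z) and exp (- i z) has modulus exp |Im z|, the other the reciprocal, which
  is at most half of it once |Im z| >= 1; half the difference is at least exp |Im z| / 4.\<close>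

lemma norm_cos_sin_ge:
  assumes "\<bar>Im z\<bar> \<ge> 1"
  shows "norm (cos z) \<ge> exp \<bar>Im z\<bar> / 4" "norm (sin z) \<ge> exp \<bar>Im z\<bar> / 4"
proof -
  define y where "y = \<bar>Im z\<bar>"
  have y: "y \<ge> 1" using assms by (simp add: y_def)
  have e: "exp (- y) \<le> exp y / 2"
  proof -
    have "2 \<le> exp (1 :: real)" using exp_ge_add_one_self[of "1::real"] by simp
    also have "\<dots> \<le> exp (2 * y)" using y by simp
    finally have "2 * exp (- y) \<le> exp (2 * y) * exp (- y)" by (intro mult_right_mono) auto
    then show ?thesis by (simp add: exp_add[symmetric])
  qed
  have n: "{norm (exp (\<i> * z)), norm (exp (- (\<i> * z)))} = {exp y, exp (- y)}"
  proof (cases "Im z \<ge> 0")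
    case True
    then have "norm (exp (\<i> * z)) = exp (- y)" "norm (exp (- (\<i> * z))) = exp y"
      by (simp_all add: norm_exp_eq_Re y_def)
    then show ?thesis by (simp add: insert_commute)
  next
    case False
    then have "norm (exp (\<i> * z)) = exp y" "norm (exp (- (\<i> * z))) = exp (- y)"
      by (simp_all add: norm_exp_eq_Re y_def)
    then show ?thesis by simp
  qed
  have tri: "exp y - exp (- y) \<le> norm (u + v)" "exp y - exp (- y) \<le> norm (u - v)" if "{norm u, norm v} = {exp y, exp (- y)}" for u v :: complex
  proof -
    have "norm u = exp y \<and> norm v = exp (- y) \<or> norm u = exp (- y) \<and> norm v = exp y"
      using that by (simp only: doubleton_eq_iff)
    then have "exp y - exp (- y) \<le> \<bar>norm u - norm v\<bar>" by (elim disjE) simp_all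
    then show "exp y - exp (- y) \<le> norm (u + v)" "exp y - exp (- y) \<le> norm (u - v)"
      using norm_triangle_ineq3[of u "- v"] norm_triangle_ineq3[of u v] by simp_all
  qed
  have "norm (cos z) = norm (exp (\<i> * z) + exp (- (\<i> * z))) / 2" by (simp add: cos_exp_eq norm_divide)
  then show "norm (cos z) \<ge> exp \<bar>Im z\<bar> / 4" using tri(1)[OF n] e unfolding y_def[symmetric] by simp
  have "norm (sin z) = norm (exp (\<i> * z) - exp (- (\<i> * z))) / 2" by (simp add: sin_exp_eq norm_divide norm_mult)
  then show "norm (sin z) \<ge> exp \<bar>Im z\<bar> / 4" using tri(2)[OF n] e unfolding y_def[symmetric] by simp
qed

section \<open>Evaluation of the trigonometric kernel\<close>

definition trig_kernel :: "complex \<Rightarrow> complex \<Rightarrow> complex" where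
  "trig_kernel s w = 1 / (cos (of_real pi * (w + s / 2) / 2) * sin (of_real pi * (w - s / 2) / 2))"

text \<open>Both factors of the denominator are at least exp (pi d / 2) / 4, with d a lower bound
  for |Im (w + s / 2)| and |Im (w - s / 2)|; hence the 16 and the rate pi. The margin 1 in the
  hypothesis ensures pi d / 2 >= 1.\<close>

lemma norm_trig_kernel_le:
  assumes w: "\<bar>Im w\<bar> \<ge> \<bar>Im s\<bar> / 2 + 1"
  shows "norm (trig_kernel s w) \<le> 16 * exp (pi * \<bar>Im s\<bar> / 2) * exp (- pi * \<bar>Im w\<bar>)"
proof -
  define A where "A = of_real pi * (w + s / 2) / 2"
  define B where "B = of_real pi * (w - s / 2) / 2"
  define d where "d = \<bar>Im w\<bar> - \<bar>Im s\<bar> / 2"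
  have d: "d \<ge> 1" using w by (simp add: d_def)
  have ge: "\<bar>Im w + Im s / 2\<bar> \<ge> d" "\<bar>Im w - Im s / 2\<bar> \<ge> d" unfolding d_def by linarith+
  have im: "Im A = pi / 2 * (Im w + Im s / 2)" "Im B = pi / 2 * (Im w - Im s / 2)"
    by (simp_all add: A_def B_def)
  have f: "pi / 2 * d \<le> \<bar>pi / 2 * x\<bar>" if "\<bar>x\<bar> \<ge> d" for x
  proof -
    have "pi / 2 * d \<le> pi / 2 * \<bar>x\<bar>" using that by (intro mult_left_mono) auto
    then show ?thesis by (simp add: abs_mult)
  qed
  have AB: "\<bar>Im A\<bar> \<ge> pi / 2 * d" "\<bar>Im B\<bar> \<ge> pi / 2 * d"
    unfolding im by (rule f[OF ge(1)], rule f[OF ge(2)])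
  have "1 * 1 \<le> pi / 2 * d" using d pi_ge_two by (intro mult_mono) auto
  then have AB1: "\<bar>Im A\<bar> \<ge> 1" "\<bar>Im B\<bar> \<ge> 1" using AB by linarith+
  have "exp (pi / 2 * d) / 4 \<le> exp \<bar>Im A\<bar> / 4" "exp (pi / 2 * d) / 4 \<le> exp \<bar>Im B\<bar> / 4"
    using AB by simp_all
  then have ex: "exp (pi / 2 * d) / 4 \<le> norm (cos A)" "exp (pi / 2 * d) / 4 \<le> norm (sin B)"
    using norm_cos_sin_ge(1)[OF AB1(1)] norm_cos_sin_ge(2)[OF AB1(2)] by (blast intro: order_trans)+
  have e0: "0 < exp (pi / 2 * d) / 4" by simp
  have pos: "0 < norm (cos A)" "0 < norm (sin B)"
    by (rule less_le_trans[OF e0 ex(1)], rule less_le_trans[OF e0 ex(2)])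
  have "exp (pi * d) = exp (pi / 2 * d) * exp (pi / 2 * d)"
    unfolding exp_add[symmetric] by (rule arg_cong[of _ _ exp]) simp
  then have "exp (pi * d) / 16 = exp (pi / 2 * d) / 4 * (exp (pi / 2 * d) / 4)" by simp
  also have "\<dots> \<le> norm (cos A) * norm (sin B)"
    using e0 pos by (intro mult_mono ex) (rule less_imp_le, assumption)+
  finally have "1 / (norm (cos A) * norm (sin B)) \<le> 1 / (exp (pi * d) / 16)"
    by (rule divide_left_mono) (simp, intro mult_pos_pos pos, simp)
  also have "\<dots> = 16 * exp (- (pi * d))" by (simp only: exp_minus divide_inverse inverse_mult_distrib inverse_inverse_eq mult_1 mult.commute)
  also have "- (pi * d) = pi * \<bar>Im s\<bar> / 2 + - pi * \<bar>Im w\<bar>" by (simp add: d_def algebra_simps)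
  finally have "1 / (norm (cos A) * norm (sin B)) \<le> 16 * (exp (pi * \<bar>Im s\<bar> / 2) * exp (- pi * \<bar>Im w\<bar>))"
    unfolding exp_add .
  moreover have "norm (trig_kernel s w) = 1 / (norm (cos A) * norm (sin B))"
    unfolding trig_kernel_def A_def[symmetric] B_def[symmetric] norm_divide norm_mult by simp
  ultimately show ?thesis by (simp only: mult.assoc)
qed

lemma sin_half_pi_eq_0: "sin (of_real pi * z / 2) = 0 \<Longrightarrow> \<exists>n::int. z = of_int (2 * n)" for z :: complex
proof -
  assume "sin (of_real pi * z / 2) = 0"
  then obtain n :: int where "of_real pi * z / 2 = of_real (of_int n * pi)" by (auto simp: sin_eq_0)
  then have "of_real pi * z = of_real pi * of_int (2 * n)" by (simp add: field_simps)
  then show ?thesis by (intro exI[of _ n]) (simp only: mult_cancel_left, simp)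
qed

lemma cos_half_pi_eq_0: "cos (of_real pi * z / 2) = 0 \<Longrightarrow> \<exists>n::int. z = of_int (2 * n - 1)" for z :: complex
proof -
  assume *: "cos (of_real pi * z / 2) = 0"
  have "sin (of_real pi * (z + 1) / 2) = cos (of_real pi * z / 2)"
  proof -
    have "of_real pi * (z + 1) / 2 = of_real pi / 2 - (- (of_real pi * z / 2))" by (simp add: field_simps)
    then show ?thesis using cos_sin_eq[of "- (of_real pi * z / 2)"] by (metis cos_minus)
  qed
  then obtain n where "z + 1 = of_int (2 * n)" using * sin_half_pi_eq_0 by metis
  then have "z = of_int (2 * n) - 1" by (metis add_diff_cancel_right')
  then show ?thesis by (intro exI[of _ n]) simp
qed

lemma sin_half_pi_nonzero:
  assumes "0 < Re z" "Re z < 4" "z \<noteq> 2"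
  shows "sin (of_real pi * z / 2) \<noteq> 0"
proof
  assume "sin (of_real pi * z / 2) = 0"
  then obtain n :: int where n: "z = of_int (2 * n)" using sin_half_pi_eq_0 by blast
  have "0 < real_of_int (2 * n)" "real_of_int (2 * n) < 4" using assms unfolding n by simp_all
  then have "n = 1" by linarith
  then show False using n assms by simp
qed

lemma cos_half_pi_nonzero_strip:
  assumes "-1 < Re z" "Re z < 5" "z \<noteq> 1" "z \<noteq> 3"
  shows "cos (of_real pi * z / 2) \<noteq> 0"
proof
  assume "cos (of_real pi * z / 2) = 0"
  then obtain n :: int where n: "z = of_int (2 * n - 1)" using cos_half_pi_eq_0 by blast
  have "-1 < real_of_int (2 * n - 1)" "real_of_int (2 * n - 1) < 5" using assms unfolding n by simp_all
  then have "n = 1 \<or> n = 2" by linarith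
  then show False using n assms by auto
qed

lemma tendsto_over_sin:
  "((\<lambda>w. (w - p) / sin (of_real pi * (w - p) / 2)) \<longlongrightarrow> 2 / of_real pi) (at p)" for p :: complex
proof -
  have "((\<lambda>w. sin (of_real pi * (w - p) / 2)) has_field_derivative of_real pi / 2) (at p)"
    by (auto intro!: derivative_eq_intros)
  then have "((\<lambda>w. (sin (of_real pi * (w - p) / 2) - sin (of_real pi * (p - p) / 2)) / (w - p)) \<longlongrightarrow> of_real pi / 2) (at p)"
    unfolding has_field_derivative_iff .
  then have "((\<lambda>w. inverse (sin (of_real pi * (w - p) / 2) / (w - p))) \<longlongrightarrow> inverse (of_real pi / 2)) (at p)"
    by (intro tendsto_inverse) simp_all
  then show ?thesis by (simp add: inverse_eq_divide)
qed

lemma trig_kernel_periodic: "trig_kernel s (w + 2) = trig_kernel s w"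
proof -
  have e: "of_real pi * (w + 2 + s / 2) / 2 = of_real pi * (w + s / 2) / 2 + of_real pi"
    "of_real pi * (w + 2 - s / 2) / 2 = of_real pi * (w - s / 2) / 2 + of_real pi" by (simp_all add: field_simps)
  have "cos (z + of_real pi) = - cos z" "sin (z + of_real pi) = - sin z" for z :: complex
    by (simp_all add: cos_add sin_add)
  then show ?thesis unfolding trig_kernel_def e by simp
qed

text \<open>The kernel has period 2 in \<open>w\<close>. For \<open>g w = exp (L w)\<close> the two integrals below are therefore proportional,
  and the residues between the lines determine both.\<close>

lemma trig_kernel_shift:
  fixes g :: "complex \<Rightarrow> complex"
  assumes s: "-1 < Re s" "Re s < 1" and c: "1 - Re s / 2 < c" "c < 2 + Re s / 2"
    and g: "g holomorphic_on UNIV"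
    and bound: "\<And>w. c \<le> Re w \<Longrightarrow> Re w \<le> c + 2 \<Longrightarrow> norm (g w) \<le> C * exp (2 * \<bar>Im w\<bar>)"
  shows "integrable lborel (\<lambda>t. trig_kernel s (Complex c t) * g (Complex c t))"
    and "integrable lborel (\<lambda>t. trig_kernel s (Complex c t) * g (Complex (c + 2) t))"
    and "(\<integral>t. trig_kernel s (Complex c t) * g (Complex (c + 2) t) \<partial>lborel) - (\<integral>t. trig_kernel s (Complex c t) * g (Complex c t) \<partial>lborel)
      = 4 / cos (of_real pi * s / 2) * (g (2 + s / 2) - g (3 - s / 2))"
proof -
  \<comment> \<open>The zeros of the denominator between the two lines: w - s / 2 = 2 for the sine,
    w + s / 2 = 3 for the cosine. The bounds on c place the left line between the preceding zero 1 -
    s / 2 of the cosine and \<open>w1\<close>.\<close>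
  define w1 w2 where "w1 = 2 + s / 2" and "w2 = 3 - s / 2"
  define h where "h w = trig_kernel s w * g w" for w
  define cv where "cv = cos (of_real pi * s / 2)"
  have cv0: "cv \<noteq> 0" unfolding cv_def using s by (intro cos_half_pi_nonzero) auto
  define S where "S = {w. 1 - Re s / 2 < Re w} \<inter> {w. Re w < 4 + Re s / 2}"
  have S: "open S" "convex S"
    unfolding S_def by (intro open_Int open_halfspace_Re_gt open_halfspace_Re_lt convex_Int convex_halfspace_Re_gt convex_halfspace_Re_lt)+
  have Sc: "{w. c \<le> Re w \<and> Re w \<le> c + 2} \<subseteq> S" using c by (auto simp: S_def)
  have wS: "w1 \<in> S" "w2 \<in> S" using s by (auto simp: w1_def w2_def S_def)
  have w12: "w1 \<noteq> w2" using s by (auto simp: w1_def w2_def complex_eq_iff)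
  have nz: "sin (of_real pi * (w - s / 2) / 2) \<noteq> 0" if "w \<in> S" "w \<noteq> w1" for w
    using that s by (intro sin_half_pi_nonzero) (auto simp: S_def w1_def algebra_simps)
  have nz': "cos (of_real pi * (w + s / 2) / 2) \<noteq> 0" if "w \<in> S" "w \<noteq> w2" for w
  proof -
    have re: "1 < Re (w + s / 2)" "Re (w + s / 2) < 5" using that s by (simp_all add: S_def)
    have "w + s / 2 \<noteq> 3" using that(2) by (auto simp: w2_def algebra_simps)
    moreover have "w + s / 2 \<noteq> 1" using re(1) by force
    ultimately show ?thesis using re by (intro cos_half_pi_nonzero_strip) auto
  qed
  have gS: "g holomorphic_on A" for A using g by (rule holomorphic_on_subset) auto
  have holo: "h holomorphic_on S - {w1, w2}"
    unfolding h_def trig_kernel_def using nz nz' by (intro holomorphic_intros gS) auto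
  have sinB: "sin (of_real pi * (w - s / 2) / 2) = - sin (of_real pi * (w - w1) / 2)" for w
  proof -
    have e: "of_real pi * (w - s / 2) / 2 = of_real pi * (w - w1) / 2 + of_real pi" by (simp add: w1_def field_simps)
    show ?thesis unfolding e by (simp add: sin_add)
  qed
  have cosA: "cos (of_real pi * (w + s / 2) / 2) = sin (of_real pi * (w - w2) / 2)" for w
  proof -
    have e: "of_real pi * (w + s / 2) / 2 = of_real pi / 2 - (- (of_real pi * (w - w2) / 2)) + of_real pi"
      by (simp add: w2_def field_simps)
    have "cos (z + of_real pi) = - cos z" for z :: complex by (simp add: cos_add)
    then have "cos (of_real pi * (w + s / 2) / 2) = - cos (of_real pi / 2 - (- (of_real pi * (w - w2) / 2)))"
      unfolding e .
    also have "\<dots> = - sin (- (of_real pi * (w - w2) / 2))" by (simp only: sin_cos_eq)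
    finally show ?thesis by simp
  qed
  have cos1: "cos (of_real pi * (w1 + s / 2) / 2) = - cv"
  proof -
    have e: "of_real pi * (w1 + s / 2) / 2 = of_real pi * s / 2 + of_real pi" by (simp add: w1_def field_simps)
    show ?thesis unfolding e by (simp add: cos_add cv_def)
  qed
  have sin2: "sin (of_real pi * (w2 - s / 2) / 2) = - cv"
  proof -
    have e: "of_real pi * (w2 - s / 2) / 2 = of_real pi / 2 - of_real pi * s / 2 + of_real pi" by (simp add: w2_def field_simps)
    have "sin (z + of_real pi) = - sin z" for z :: complex by (simp add: sin_add)
    then have "sin (of_real pi * (w2 - s / 2) / 2) = - sin (of_real pi / 2 - of_real pi * s / 2)" unfolding e .
    also have "\<dots> = - cv" by (simp only: cos_sin_eq cv_def)
    finally show ?thesis .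
  qed
  have gc: "isCont g w" for w using g holomorphic_on_imp_continuous_on continuous_on_eq_continuous_at open_UNIV by blast
  have r1: "residue h w1 = 2 / (of_real pi * cv) * g w1"
  proof (rule residue_simple')
    show "open (S - {w2})" "w1 \<in> S - {w2}" using S wS w12 by auto
    show "h holomorphic_on S - {w2} - {w1}" by (rule holomorphic_on_subset[OF holo]) auto
    have "((\<lambda>w. - ((w - w1) / sin (of_real pi * (w - w1) / 2)) * (g w / cos (of_real pi * (w + s / 2) / 2))) \<longlongrightarrow> - (2 / of_real pi) * (g w1 / cos (of_real pi * (w1 + s / 2) / 2))) (at w1)"
      by (intro tendsto_mult tendsto_minus tendsto_over_sin tendsto_divide isContD[OF gc] tendsto_intros) (use cos1 cv0 in simp_all)
    also have "- (2 / of_real pi) * (g w1 / cos (of_real pi * (w1 + s / 2) / 2)) = 2 / (of_real pi * cv) * g w1"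
      unfolding cos1 using cv0 by (simp add: field_simps)
    finally show "((\<lambda>w. h w * (w - w1)) \<longlongrightarrow> 2 / (of_real pi * cv) * g w1) (at w1)"
      unfolding h_def trig_kernel_def sinB by (simp add: mult_ac)
  qed
  have r2: "residue h w2 = - 2 / (of_real pi * cv) * g w2"
  proof (rule residue_simple')
    show "open (S - {w1})" "w2 \<in> S - {w1}" using S wS w12 by auto
    show "h holomorphic_on S - {w1} - {w2}" by (rule holomorphic_on_subset[OF holo]) auto
    have "((\<lambda>w. (w - w2) / sin (of_real pi * (w - w2) / 2) * (g w / sin (of_real pi * (w - s / 2) / 2))) \<longlongrightarrow> 2 / of_real pi * (g w2 / sin (of_real pi * (w2 - s / 2) / 2))) (at w2)"
      by (intro tendsto_mult tendsto_over_sin tendsto_divide isContD[OF gc] tendsto_intros) (use sin2 cv0 in simp_all)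
    also have "2 / of_real pi * (g w2 / sin (of_real pi * (w2 - s / 2) / 2)) = - 2 / (of_real pi * cv) * g w2"
      unfolding sin2 using cv0 by (simp add: field_simps)
    finally show "((\<lambda>w. h w * (w - w2)) \<longlongrightarrow> - 2 / (of_real pi * cv) * g w2) (at w2)"
      unfolding h_def trig_kernel_def cosA by (simp add: mult_ac)
  qed
  define K where "K = 16 * exp (pi * \<bar>Im s\<bar> / 2)"
  have hb: "norm (h w) \<le> (K * \<bar>C\<bar>) * exp (- \<bar>Im w\<bar>)" if "c \<le> Re w" "Re w \<le> c + 2" "\<bar>Im w\<bar> \<ge> \<bar>Im s\<bar> / 2 + 1" for w
  proof -
    have "norm (g w) \<le> \<bar>C\<bar> * exp (2 * \<bar>Im w\<bar>)"
      using bound[OF that(1,2)] by (rule order_trans) (intro mult_right_mono, auto)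
    moreover have "norm (trig_kernel s w) \<le> K * exp (- pi * \<bar>Im w\<bar>)"
      unfolding K_def by (rule norm_trig_kernel_le[OF that(3)])
    ultimately have "norm (h w) \<le> K * exp (- pi * \<bar>Im w\<bar>) * (\<bar>C\<bar> * exp (2 * \<bar>Im w\<bar>))"
      unfolding h_def norm_mult by (intro mult_mono) (auto simp: K_def)
    also have "\<dots> = K * \<bar>C\<bar> * exp (- pi * \<bar>Im w\<bar> + 2 * \<bar>Im w\<bar>)" by (simp only: exp_add mult_ac)
    also have "\<dots> \<le> K * \<bar>C\<bar> * exp (- \<bar>Im w\<bar>)"
    proof -
      \<comment> \<open>Here pi > 3 pays for the growth exp (2 |Im w|) allowed to g and leaves exp
        (- |Im w|).\<close>
      have "3 * \<bar>Im w\<bar> \<le> pi * \<bar>Im w\<bar>" using pi_gt3 by (intro mult_right_mono) auto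
      then have "exp (- pi * \<bar>Im w\<bar> + 2 * \<bar>Im w\<bar>) \<le> exp (- \<bar>Im w\<bar>)" by simp
      then show ?thesis by (intro mult_left_mono) (auto simp: K_def)
    qed
    finally show ?thesis .
  qed
  have P: "finite {w1, w2}" "\<And>p. p \<in> {w1, w2} \<Longrightarrow> c < Re p \<and> Re p < c + 2"
    using c s by (auto simp: w1_def w2_def)
  have cc: "c < c + 2" by simp
  note shift = vertical_contour_shift[where T = "\<bar>Im s\<bar> / 2 + 1", OF cc S Sc P holo hb]
  have per: "h (Complex (c + 2) t) = trig_kernel s (Complex c t) * g (Complex (c + 2) t)" for t
  proof -
    have "Complex (c + 2) t = Complex c t + 2" by (simp add: complex_eq_iff)
    then show ?thesis unfolding h_def using trig_kernel_periodic[of s "Complex c t"] by simp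
  qed
  show "integrable lborel (\<lambda>t. trig_kernel s (Complex c t) * g (Complex c t))"
    using shift(1) by (simp add: h_def)
  show "integrable lborel (\<lambda>t. trig_kernel s (Complex c t) * g (Complex (c + 2) t))"
    using shift(2) unfolding per .
  have "(\<integral>t. trig_kernel s (Complex c t) * g (Complex (c + 2) t) \<partial>lborel) - (\<integral>t. trig_kernel s (Complex c t) * g (Complex c t) \<partial>lborel)
      = 2 * of_real pi * (\<Sum>p\<in>{w1, w2}. residue h p)"
    using shift(3) unfolding per h_def[of "Complex c _"] .
  also have "(\<Sum>p\<in>{w1, w2}. residue h p) = residue h w1 + residue h w2" using w12 by simp
  also have "2 * of_real pi * (residue h w1 + residue h w2) = 4 / cv * (g w1 - g w2)"
    unfolding r1 r2 using cv0 by (simp add: field_simps)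
  finally show "(\<integral>t. trig_kernel s (Complex c t) * g (Complex (c + 2) t) \<partial>lborel) - (\<integral>t. trig_kernel s (Complex c t) * g (Complex c t) \<partial>lborel)
      = 4 / cos (of_real pi * s / 2) * (g (2 + s / 2) - g (3 - s / 2))"
    by (simp add: cv_def w1_def w2_def)
qed

text \<open>For g w = exp (w L) the shift by 2 multiplies g by exp (2 L), so the difference of the
  two integrals determines them. At L = 0 this is 0 = 0; there g w = w is used, which grows by the
  constant 2. That case is x = n in the series.\<close>

lemma trig_kernel_exp_integral:
  assumes s: "-1 < Re s" "Re s < 1" and c: "1 - Re s / 2 < c" "c < 2 + Re s / 2"
  shows "integrable lborel (\<lambda>t. trig_kernel s (Complex c t) * exp (Complex c t * of_real L))"
    and "of_real (exp (2 * L) - 1) * (\<integral>t. trig_kernel s (Complex c t) * exp (Complex c t * of_real L) \<partial>lborel)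
      = 4 / cos (of_real pi * s / 2) * (exp ((2 + s / 2) * of_real L) - exp ((3 - s / 2) * of_real L))"
    and "(\<integral>t. trig_kernel s (Complex c t) \<partial>lborel) = 2 * (s - 1) / cos (of_real pi * s / 2)"
proof -
  have b: "norm (exp (w * complex_of_real L)) \<le> exp (\<bar>c + 2\<bar> * \<bar>L\<bar>) * exp (2 * \<bar>Im w\<bar>)" if "c \<le> Re w" "Re w \<le> c + 2" for w
  proof -
    have c0: "c > 0" using c s by linarith
    have "Re w * L \<le> \<bar>Re w\<bar> * \<bar>L\<bar>" by (metis abs_ge_self abs_mult)
    also have "\<dots> \<le> \<bar>c + 2\<bar> * \<bar>L\<bar>" using that c0 by (intro mult_right_mono) auto
    finally have "norm (exp (w * complex_of_real L)) \<le> exp (\<bar>c + 2\<bar> * \<bar>L\<bar>) * 1" by (simp add: norm_exp_eq_Re)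
    also have "\<dots> \<le> exp (\<bar>c + 2\<bar> * \<bar>L\<bar>) * exp (2 * \<bar>Im w\<bar>)" by (intro mult_left_mono) auto
    finally show ?thesis .
  qed
  have h: "(\<lambda>w. exp (w * complex_of_real L)) holomorphic_on UNIV" by (intro holomorphic_intros)
  note T = trig_kernel_shift[OF s c h b]
  show "integrable lborel (\<lambda>t. trig_kernel s (Complex c t) * exp (Complex c t * of_real L))" by (rule T(1))
  have e: "trig_kernel s (Complex c t) * exp (Complex (c + 2) t * of_real L) = of_real (exp (2 * L)) * (trig_kernel s (Complex c t) * exp (Complex c t * of_real L))" for t
  proof -
    have "Complex (c + 2) t * of_real L = Complex c t * of_real L + of_real (2 * L)" by (simp add: complex_eq_iff algebra_simps)
    then show ?thesis by (simp only: exp_add exp_of_real mult_ac)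
  qed
  show "of_real (exp (2 * L) - 1) * (\<integral>t. trig_kernel s (Complex c t) * exp (Complex c t * of_real L) \<partial>lborel)
      = 4 / cos (of_real pi * s / 2) * (exp ((2 + s / 2) * of_real L) - exp ((3 - s / 2) * of_real L))"
    using T(3) unfolding e by (simp add: left_diff_distrib)
  have b2: "norm w \<le> (\<bar>c + 2\<bar> + 1) * exp (2 * \<bar>Im w\<bar>)" if "c \<le> Re w" "Re w \<le> c + 2" for w
  proof -
    have c0: "c > 0" using c s by linarith
    have "norm w \<le> \<bar>Re w\<bar> + \<bar>Im w\<bar>" by (rule cmod_le)
    also have "\<dots> \<le> \<bar>c + 2\<bar> * 1 + 1 * exp (2 * \<bar>Im w\<bar>)"
    proof -
      have "\<bar>Im w\<bar> \<le> exp (2 * \<bar>Im w\<bar>)"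
        using exp_ge_add_one_self[of "2 * \<bar>Im w\<bar>"] abs_ge_zero[of "Im w"] by linarith
      moreover have "\<bar>Re w\<bar> \<le> \<bar>c + 2\<bar>" using that c0 by auto
      ultimately show ?thesis by simp
    qed
    also have "\<dots> \<le> \<bar>c + 2\<bar> * exp (2 * \<bar>Im w\<bar>) + 1 * exp (2 * \<bar>Im w\<bar>)" by (intro add_mono mult_left_mono) auto
    finally show ?thesis by (simp add: distrib_right)
  qed
  have b3: "norm (1::complex) \<le> 1 * exp (2 * \<bar>Im w\<bar>)" for w by simp
  have h2: "(\<lambda>w::complex. w) holomorphic_on UNIV" by (intro holomorphic_intros)
  have h3: "(\<lambda>w::complex. 1) holomorphic_on UNIV" by (intro holomorphic_intros)
  note T2 = trig_kernel_shift[OF s c h2 b2]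
  have i1: "integrable lborel (\<lambda>t. trig_kernel s (Complex c t))"
    using trig_kernel_shift(1)[OF s c h3 b3] by simp
  have e2: "trig_kernel s (Complex c t) * Complex (c + 2) t = trig_kernel s (Complex c t) * Complex c t + 2 * trig_kernel s (Complex c t)" for t
  proof -
    have "Complex (c + 2) t = Complex c t + 2" by (simp add: complex_eq_iff)
    then show ?thesis by (simp add: algebra_simps)
  qed
  have i2: "(\<integral>t. trig_kernel s (Complex c t) * Complex c t + 2 * trig_kernel s (Complex c t) \<partial>lborel)
     = (\<integral>t. trig_kernel s (Complex c t) * Complex c t \<partial>lborel) + (\<integral>t. 2 * trig_kernel s (Complex c t) \<partial>lborel)"
    by (rule Bochner_Integration.integral_add[OF T2(1) integrable_mult_right[OF i1]])
  have "2 * (\<integral>t. trig_kernel s (Complex c t) \<partial>lborel) = 4 / cos (of_real pi * s / 2) * (2 + s / 2 - (3 - s / 2))"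
    using T2(3) unfolding e2 i2 by simp
  also have "2 + s / 2 - (3 - s / 2) = s - 1" by (simp add: field_simps)
  finally have "2 * (\<integral>t. trig_kernel s (Complex c t) \<partial>lborel) = 2 * (2 * (s - 1) / cos (of_real pi * s / 2))" by simp
  then show "(\<integral>t. trig_kernel s (Complex c t) \<partial>lborel) = 2 * (s - 1) / cos (of_real pi * s / 2)"
    by (simp only: mult_cancel_left) simp
qed

text \<open>With L = ln x - ln n the factor exp (2 L) - 1 is (x^2 - n^2) / n^2, the source of the
  denominator of \<open>power_quotient\<close>; the two residues give its two powers. The 1 / (4 pi)
  is that of \<open>f_integral\<close>.\<close>

lemma trig_kernel_mellin_term:
  assumes s: "-1 < Re s" "Re s < 1" and c: "1 - Re s / 2 < c" "c < 2 + Re s / 2" and x: "x > 0" and n: "n > 0"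
  shows "of_nat n powr (s / 2) * (exp (- of_real (ln x)) * (\<integral>t. trig_kernel s (Complex c t) * exp (Complex c t * of_real (ln x - ln (real n))) \<partial>lborel)) / (4 * of_real pi)
    = of_real x powr (2 - s / 2) / (of_real pi * cos (of_real pi * s / 2)) * power_quotient x s n"
proof -
  define X N where "X = ln x" and "N = ln (real n)"
  define cv where "cv = cos (of_real pi * s / 2)"
  have cv0: "cv \<noteq> 0" unfolding cv_def using s by (intro cos_half_pi_nonzero) auto
  define J where "J = (\<integral>t. trig_kernel s (Complex c t) * exp (Complex c t * of_real (X - N)) \<partial>lborel)"
  have np: "of_nat n powr z = exp (z * of_real N)" for z :: complex
    using of_real_powr_eq_exp[of "real n" z] n by (simp add: N_def)
  have xp: "of_real x powr z = exp (z * of_real X)" for z :: complex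
    using of_real_powr_eq_exp[OF x] by (simp add: X_def)
  show ?thesis
  proof (cases "x = real n")
    case True
    then have XN: "X = N" by (simp add: X_def N_def)
    have J: "J = 2 * (s - 1) / cv"
      unfolding J_def XN cv_def using trig_kernel_exp_integral(3)[OF s c] by simp
    have E: "exp (s / 2 * of_real N) * exp (- complex_of_real N) = exp ((2 - s / 2) * of_real N) * exp ((s - 3) * of_real N)"
      unfolding exp_add[symmetric] by (rule arg_cong[of _ _ exp]) (simp add: algebra_simps add_divide_distrib)
    have "exp (s / 2 * of_real N) * (exp (- of_real N) * J) / (4 * of_real pi)
       = exp (s / 2 * of_real N) * exp (- complex_of_real N) * (2 * (s - 1) / cv) / (4 * of_real pi)"
      unfolding J by (simp only: mult.assoc)
    also have "\<dots> = exp ((2 - s / 2) * of_real N) / (of_real pi * cv) * ((s - 1) / 2 * exp ((s - 3) * of_real N))"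
      unfolding E using cv0 by (simp add: field_simps)
    finally show ?thesis
      unfolding X_def[symmetric] N_def[symmetric] J_def[symmetric] cv_def[symmetric] np xp power_quotient_def if_P[OF True]
      unfolding XN .
  next
    case False
    have nx: "(real n)\<^sup>2 - x\<^sup>2 \<noteq> 0" using False x n by (auto simp: power2_eq_iff)
    have e2: "exp (2 * (X - N)) = x\<^sup>2 / (real n)\<^sup>2"
      using x n by (simp add: X_def N_def exp_diff exp_double right_diff_distrib)
    have J: "of_real (exp (2 * (X - N)) - 1) * J = 4 / cv * (exp ((2 + s / 2) * of_real (X - N)) - exp ((3 - s / 2) * of_real (X - N)))"
      unfolding J_def cv_def by (rule trig_kernel_exp_integral(2)[OF s c])
    define D where "D = complex_of_real ((real n)\<^sup>2 - x\<^sup>2)"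
    have D0: "D \<noteq> 0" using nx unfolding D_def of_real_eq_0_iff .
    have nn: "complex_of_real ((real n)\<^sup>2) = exp (2 * of_real N)"
      using n by (simp add: N_def exp_double exp_of_real)
    have n2: "exp (2 * complex_of_real N) \<noteq> 0" by simp
    have "complex_of_real (exp (2 * (X - N)) - 1) = - D / exp (2 * of_real N)"
    proof -
      have "exp (2 * (X - N)) - 1 = - ((real n)\<^sup>2 - x\<^sup>2) / (real n)\<^sup>2" unfolding e2 using n by (simp add: field_simps)
      then have "complex_of_real (exp (2 * (X - N)) - 1) = - complex_of_real ((real n)\<^sup>2 - x\<^sup>2) / complex_of_real ((real n)\<^sup>2)"
        by (simp only: of_real_divide of_real_minus)
      then show ?thesis unfolding nn D_def .
    qed
    with J have "- D / exp (2 * of_real N) * J = 4 / cv * (exp ((2 + s / 2) * of_real (X - N)) - exp ((3 - s / 2) * of_real (X - N)))"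
      by simp
    then have J': "J = - (4 / (cv * D)) * exp (2 * of_real N) * (exp ((2 + s / 2) * of_real (X - N)) - exp ((3 - s / 2) * of_real (X - N)))"
      using D0 cv0 n2 by (simp add: field_simps)
    define r where "r = s / 2"
    have s2: "s = 2 * r" by (simp add: r_def)
    have ex1: "exp (s / 2 * of_real N) * (exp (- of_real X) * (exp (2 * of_real N) * exp ((2 + s / 2) * of_real (X - N)))) = exp ((2 - s / 2) * of_real X) * exp ((s - 1) * complex_of_real X)"
      unfolding exp_add[symmetric] s2 by (rule arg_cong[of _ _ exp]) (simp add: algebra_simps)
    have ex2: "exp (s / 2 * of_real N) * (exp (- of_real X) * (exp (2 * of_real N) * exp ((3 - s / 2) * of_real (X - N)))) = exp ((2 - s / 2) * of_real X) * exp ((s - 1) * complex_of_real N)"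
      unfolding exp_add[symmetric] s2 by (rule arg_cong[of _ _ exp]) (simp add: algebra_simps)
    have "exp (s / 2 * of_real N) * (exp (- of_real X) * J) / (4 * of_real pi)
      = - (1 / (of_real pi * (cv * D))) * (exp (s / 2 * of_real N) * (exp (- of_real X) * (exp (2 * of_real N) * exp ((2 + s / 2) * of_real (X - N))))
         - exp (s / 2 * of_real N) * (exp (- of_real X) * (exp (2 * of_real N) * exp ((3 - s / 2) * of_real (X - N)))))"
      unfolding J' by (simp add: algebra_simps diff_divide_distrib)
    also have "\<dots> = exp ((2 - s / 2) * of_real X) / (of_real pi * cv) * ((exp ((s - 1) * of_real N) - exp ((s - 1) * of_real X)) / D)"
      unfolding ex1 ex2 using D0 cv0 by (simp add: field_simps)
    finally show ?thesis
      unfolding X_def[symmetric] N_def[symmetric] J_def[symmetric] cv_def[symmetric] np xp power_quotient_def if_not_P[OF False] D_def .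
  qed
qed

text \<open>For a series of integrals whose sum is not known in advance: it is identified only as
  the integral of the product of the zeta functions.\<close>

lemma has_bochner_integral_sums_ex:
  fixes f :: "nat \<Rightarrow> real \<Rightarrow> complex"
  assumes f: "\<And>i. has_bochner_integral lborel (f i) (I i)"
    and s: "\<And>x. summable (\<lambda>i. norm (f i x))"
    and n: "summable (\<lambda>i. \<integral>x. norm (f i x) \<partial>lborel)"
    and F: "\<And>x. (\<lambda>i. f i x) sums F x"
  shows "\<exists>L. I sums L \<and> has_bochner_integral lborel F L"
proof -
  have int: "integrable lborel (f i)" for i using f by (simp add: has_bochner_integral_iff)
  have F': "F = (\<lambda>x. \<Sum>i. f i x)" using F by (simp add: sums_iff fun_eq_iff)
  have I': "I = (\<lambda>i. integral\<^sup>L lborel (f i))" using f by (simp add: has_bochner_integral_iff fun_eq_iff)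
  have "integrable lborel F"
    unfolding F' by (rule integrable_suminf[OF int _ n]) (use s in simp)
  moreover have "I sums integral\<^sup>L lborel F"
    unfolding F' I' by (rule sums_integral[OF int _ n]) (use s in simp)
  ultimately show ?thesis by (intro exI[of _ "integral\<^sup>L lborel F"]) (simp add: has_bochner_integral_iff)
qed

section \<open>The function \<open>f\<close> as a contour integral\<close>

definition zeta_kernel :: "complex \<Rightarrow> complex \<Rightarrow> complex" where
  "zeta_kernel s w = riemann_zeta (w + s / 2) * riemann_zeta (w - s / 2) * trig_kernel s w"

definition f_integral :: "real \<Rightarrow> complex \<Rightarrow> complex" where
  "f_integral x s = (\<integral>t. zeta_kernel s (Complex (1 / 2) t) * exp ((Complex (1 / 2) t - 1) * of_real (ln x)) \<partial>lborel) / (4 * of_real pi)"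

lemma power_le_fact_exp: "x ^ k \<le> fact k * exp x" if "x \<ge> 0" for x :: real
proof -
  have "(\<Sum>n\<in>{k}. inverse (fact n) * x ^ n) \<le> (\<Sum>n. inverse (fact n) * x ^ n)"
    using that by (intro sum_le_suminf summable_exp) auto
  then have "x ^ k / fact k \<le> exp x" by (simp add: exp_def divide_inverse mult.commute)
  then show ?thesis by (simp add: field_simps)
qed

text \<open>Two cubic bounds make degree 6, absorbed by x^6 <= 6! exp x, and pi >= 2 leaves exp (-
  |Im w|). The margin R / 2 + 1 keeps w + s / 2 and w - s / 2 at distance at least 1 from the pole
  of zeta. Uniformity in s serves the limit at s = 0.\<close>

lemma zeta_kernel_bound:
  assumes R: "R \<ge> 0"
  shows "\<exists>K\<ge>0. \<forall>s w. norm s \<le> R \<and> Re (w + s / 2) \<ge> 0 \<and> Re (w - s / 2) \<ge> 0 \<and> Re w \<le> 3 \<and> \<bar>Im w\<bar> \<ge> R / 2 + 1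
    \<longrightarrow> norm (zeta_kernel s w) \<le> K * exp (- \<bar>Im w\<bar>)"
proof -
  obtain C where C: "C > 0" "\<And>s. Re s \<ge> 0 \<and> norm (s - 1) \<ge> 1 \<Longrightarrow> norm (riemann_zeta s) \<le> C * (1 + norm s) ^ 3"
    using norm_riemann_zeta_le by blast
  \<comment> \<open>From 1 + |w| + |s / 2| <= 1 + (3 + |Im w|) + R.\<close>
  define M where "M = 4 + R"
  define K where "K = C ^ 2 * (fact 6 * exp M) * (16 * exp (pi * R / 2))"
  have K0: "K \<ge> 0" unfolding K_def using C(1) by simp
  have "norm (zeta_kernel s w) \<le> K * exp (- \<bar>Im w\<bar>)"
    if h: "norm s \<le> R" "Re (w + s / 2) \<ge> 0" "Re (w - s / 2) \<ge> 0" "Re w \<le> 3" "\<bar>Im w\<bar> \<ge> R / 2 + 1" for s w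
  proof -
    define \<tau> where "\<tau> = \<bar>Im w\<bar>"
    have ims: "\<bar>Im s\<bar> \<le> R" using abs_Im_le_cmod[of s] h(1) by linarith
    have rew: "Re w \<ge> 0" using h(2,3) by simp
    have z: "norm (riemann_zeta u) \<le> C * (M + \<tau>) ^ 3" if u: "u = w + s / 2 \<or> u = w - s / 2" for u
    proof -
      have "\<bar>Im u\<bar> \<ge> 1" using u ims h(5) by (auto simp: abs_if split: if_splits)
      then have "norm (u - 1) \<ge> 1" using abs_Im_le_cmod[of "u - 1"] by simp
      moreover have "Re u \<ge> 0" using u h(2,3) by auto
      ultimately have 1: "norm (riemann_zeta u) \<le> C * (1 + norm u) ^ 3" by (intro C(2)) simp
      have "norm u \<le> norm w + norm (s / 2)" using u norm_triangle_ineq[of w "s / 2"] norm_triangle_ineq4[of w "s / 2"] by auto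
      also have "norm (s / 2) \<le> R" using h(1) R by (simp add: norm_divide)
      also have "norm w \<le> 3 + \<tau>" using cmod_le[of w] rew h(4) by (simp add: \<tau>_def)
      finally have "1 + norm u \<le> M + \<tau>" by (simp add: M_def)
      then have "(1 + norm u) ^ 3 \<le> (M + \<tau>) ^ 3" by (intro power_mono) auto
      then have "C * (1 + norm u) ^ 3 \<le> C * (M + \<tau>) ^ 3" using C(1) by (intro mult_left_mono) auto
      with 1 show ?thesis by linarith
    qed
    have Mt: "M + \<tau> \<ge> 0" using R by (simp add: M_def \<tau>_def)
    have "norm (riemann_zeta (w + s / 2) * riemann_zeta (w - s / 2)) \<le> C * (M + \<tau>) ^ 3 * (C * (M + \<tau>) ^ 3)"
      unfolding norm_mult using Mt C(1) by (intro mult_mono z) auto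
    also have "\<dots> = C ^ 2 * (M + \<tau>) ^ 6" by (simp add: power_add[symmetric] power2_eq_square mult_ac)
    also have "\<dots> \<le> C ^ 2 * (fact 6 * exp (M + \<tau>))" by (intro mult_left_mono power_le_fact_exp Mt) auto
    finally have 1: "norm (riemann_zeta (w + s / 2) * riemann_zeta (w - s / 2)) \<le> C ^ 2 * (fact 6 * exp (M + \<tau>))" .
    have "\<bar>Im w\<bar> \<ge> \<bar>Im s\<bar> / 2 + 1" using ims h(5) by linarith
    then have "norm (trig_kernel s w) \<le> 16 * exp (pi * \<bar>Im s\<bar> / 2) * exp (- pi * \<tau>)"
      unfolding \<tau>_def by (rule norm_trig_kernel_le)
    also have "\<dots> \<le> 16 * exp (pi * R / 2) * exp (- pi * \<tau>)"
      using ims by (intro mult_right_mono mult_left_mono) auto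
    finally have 2: "norm (trig_kernel s w) \<le> 16 * exp (pi * R / 2) * exp (- pi * \<tau>)" .
    have "norm (zeta_kernel s w) \<le> C ^ 2 * (fact 6 * exp (M + \<tau>)) * (16 * exp (pi * R / 2) * exp (- pi * \<tau>))"
      unfolding zeta_kernel_def norm_mult[of "riemann_zeta (w + s / 2) * riemann_zeta (w - s / 2)"]
      using 1 2 by (intro mult_mono) auto
    also have "\<dots> = K * exp (\<tau> + - pi * \<tau>)" unfolding K_def exp_add by (simp only: mult_ac)
    also have "\<dots> \<le> K * exp (- \<tau>)"
    proof -
      have "2 * \<tau> \<le> pi * \<tau>" using pi_ge_two by (intro mult_right_mono) (auto simp: \<tau>_def)
      then have "exp (\<tau> + - pi * \<tau>) \<le> exp (- \<tau>)" by simp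
      then show ?thesis using K0 by (rule mult_left_mono)
    qed
    finally show ?thesis unfolding \<tau>_def .
  qed
  with K0 show ?thesis by blast
qed

section \<open>Residues at the two poles to the right of Re w = 1/2\<close>

lemma riemann_zeta_mult_eq_zeta_reg: "riemann_zeta u * (u - 1) = zeta_reg u" if "Re u > -1" "u \<noteq> 1" for u
  using riemann_zeta_eq_zeta_reg[OF that] that by simp

text \<open>Only zeta (w - s / 2) is singular here; as a quotient with numerator
  \<open>zeta_reg\<close> it contributes the value 1. The condition s \<noteq> 0 separates this
  point from the other pole, where the cosine vanishes.\<close>

lemma residue_zeta_kernel_simple:
  assumes s: "-1 < Re s" "Re s < 1" "s \<noteq> 0"
  shows "residue (\<lambda>w. zeta_kernel s w * exp ((w - 1) * of_real X)) (1 + s / 2)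
    = - (riemann_zeta (1 + s) * exp (s / 2 * of_real X) / sin (of_real pi * s / 2))"
proof -
  let ?p = "1 + s / 2"
  define H where "H w = riemann_zeta (w + s / 2) * zeta_reg (w - s / 2) * trig_kernel s w * exp ((w - 1) * of_real X)" for w
  define A where "A = ({w. \<bar>Re s\<bar> / 2 < Re w} \<inter> {w. Re w < 2 + Re s / 2}) - {1 - s / 2}"
  have A: "open A" unfolding A_def by (intro open_Diff open_Int open_halfspace_Re_gt open_halfspace_Re_lt) auto
  have pA: "?p \<in> A" using s by (auto simp: A_def complex_eq_iff)
  have zne: "w + s / 2 \<noteq> 1" if "w \<in> A" for w using that by (auto simp: A_def algebra_simps)
  have re: "0 < Re (w - s / 2)" "Re (w - s / 2) < 2" "0 < Re (w + s / 2)" "Re (w + s / 2) < 3" if "w \<in> A" for w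
    using that s by (auto simp: A_def)
  have nz: "sin (of_real pi * (w - s / 2) / 2) \<noteq> 0" if "w \<in> A" for w
  proof -
    have "w - s / 2 \<noteq> 2"
    proof
      assume "w - s / 2 = 2"
      then have "Re (w - s / 2) = 2" by (simp only: complex_Re_numeral)
      then show False using re(2)[OF that] by linarith
    qed
    then show ?thesis using re[OF that] by (intro sin_half_pi_nonzero) auto
  qed
  have nz': "cos (of_real pi * (w + s / 2) / 2) \<noteq> 0" if "w \<in> A" for w
  proof -
    have "w + s / 2 \<noteq> 3"
    proof
      assume "w + s / 2 = 3"
      then have "Re (w + s / 2) = 3" by (simp only: complex_Re_numeral)
      then show False using re(4)[OF that] by linarith
    qed
    then show ?thesis using re[OF that] zne[OF that] by (intro cos_half_pi_nonzero_strip) auto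
  qed
  have reZ: "-1 < Re (w - s / 2)" if "w \<in> A" for w using re(1)[OF that] by linarith
  have HA: "H holomorphic_on A"
    unfolding H_def trig_kernel_def using nz nz' zne reZ by (intro holomorphic_intros) auto
  have "residue (\<lambda>w. zeta_kernel s w * exp ((w - 1) * of_real X)) ?p = residue (\<lambda>w. H w / (w - ?p)) ?p"
  proof (rule residue_cong[OF _ refl])
    have "\<forall>\<^sub>F w in at ?p. w \<in> A" using A pA by (rule eventually_at_in_open')
    moreover have "\<forall>\<^sub>F w in at ?p. w \<noteq> ?p" by (rule eventually_neq_at_within)
    ultimately show "\<forall>\<^sub>F w in at ?p. zeta_kernel s w * exp ((w - 1) * of_real X) = H w / (w - ?p)"
    proof eventually_elim
      case (elim w)
      have wp: "w - ?p \<noteq> 0" using elim by simp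
      have "w - s / 2 \<noteq> 1" using elim(2) by (auto simp: algebra_simps)
      then have "riemann_zeta (w - s / 2) * (w - ?p) = zeta_reg (w - s / 2)"
        using riemann_zeta_mult_eq_zeta_reg[OF reZ[OF elim(1)]] by (simp add: algebra_simps)
      then have z: "riemann_zeta (w - s / 2) = zeta_reg (w - s / 2) / (w - ?p)" by (rule iffD2[OF nonzero_eq_divide_eq[OF wp]])
      show ?case unfolding H_def zeta_kernel_def z by (simp only: times_divide_eq_left times_divide_eq_right)
    qed
  qed
  also have "\<dots> = H ?p" by (rule residue_simple[OF A pA HA])
  also have "H ?p = - (riemann_zeta (1 + s) * exp (s / 2 * of_real X) / sin (of_real pi * s / 2))"
  proof -
    have c: "cos (of_real pi * (?p + s / 2) / 2) = - sin (of_real pi * s / 2)"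
    proof -
      have e: "of_real pi * (?p + s / 2) / 2 = of_real pi / 2 - (- (of_real pi * s / 2))" by (simp add: field_simps)
      show ?thesis unfolding e sin_cos_eq[symmetric] by simp
    qed
    have e1: "?p + s / 2 = 1 + s" "?p - s / 2 = 1" "(?p - 1) * of_real X = s / 2 * of_real X" by simp_all
    have sn: "sin (of_real pi * 1 / 2) = (1 :: complex)"
    proof -
      have "of_real pi * 1 / 2 = complex_of_real (pi / 2)" by simp
      then have "sin (of_real pi * 1 / 2) = complex_of_real (sin (pi / 2))" by (simp only: sin_of_real)
      then show ?thesis by (simp only: sin_pi_half of_real_1)
    qed
    show ?thesis unfolding H_def trig_kernel_def c unfolding e1 sn by (simp add: zeta_reg_1)
  qed
  finally show ?thesis .
qed

text \<open>The pole of zeta (w + s / 2) meets a zero of the cosine. With both divided out,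
  \<open>H\<close> is holomorphic at the point and the residue is its derivative, which collects
  Euler's constant from \<open>zeta_reg\<close>, X from the exponential and the tangent from 1 /
  sin.\<close>

lemma residue_zeta_kernel_double:
  assumes s: "-1 < Re s" "Re s < 1" "s \<noteq> 0"
  defines "cv \<equiv> cos (of_real pi * s / 2)"
  shows "residue (\<lambda>w. zeta_kernel s w * exp ((w - 1) * of_real X)) (1 - s / 2)
    = - (2 / (of_real pi * cv)) * exp (- s / 2 * of_real X) * (deriv riemann_zeta (1 - s)
        + riemann_zeta (1 - s) * (euler_mascheroni + of_real X - of_real pi / 2 * tan (of_real pi * s / 2)))"
proof -
  let ?p = "1 - s / 2"
  have cv0: "cv \<noteq> 0" unfolding cv_def using s by (intro cos_half_pi_nonzero) auto
  \<comment> \<open>By reflection for Gamma this is (w - \<open>?p\<close>) / cos (pi (w + s / 2) /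
    2) near \<open>?p\<close>; the Gamma form is holomorphic at \<open>?p\<close> itself.\<close>
  define E where "E w = - (2 / of_real pi) * (Gamma (1 + (w - ?p) / 2) * Gamma (1 - (w - ?p) / 2))" for w
  define F where "F w = riemann_zeta (w - s / 2) / sin (of_real pi * (w - s / 2) / 2)" for w
  define H where "H w = zeta_reg (w + s / 2) * (E w * (F w * exp ((w - 1) * of_real X)))" for w
  define A where "A = ({w. \<bar>Re s\<bar> / 2 < Re w} \<inter> {w. Re w < 2 + Re s / 2}) \<inter> (ball ?p 1 - {1 + s / 2})"
  have A: "open A" unfolding A_def by (intro open_Diff open_Int open_halfspace_Re_gt open_halfspace_Re_lt) auto
  have pA: "?p \<in> A" using s by (auto simp: A_def complex_eq_iff)
  have zne: "w - s / 2 \<noteq> 1" if "w \<in> A" for w using that by (auto simp: A_def algebra_simps)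
  have re: "0 < Re (w - s / 2)" "Re (w - s / 2) < 2" "0 < Re (w + s / 2)" "Re (w + s / 2) < 3" if "w \<in> A" for w
    using that s by (auto simp: A_def)
  have nz: "sin (of_real pi * (w - s / 2) / 2) \<noteq> 0" if "w \<in> A" for w
  proof -
    have "w - s / 2 \<noteq> 2"
    proof
      assume "w - s / 2 = 2"
      then have "Re (w - s / 2) = 2" by (simp only: complex_Re_numeral)
      then show False using re(2)[OF that] by linarith
    qed
    then show ?thesis using re[OF that] by (intro sin_half_pi_nonzero) auto
  qed
  have ball: "\<bar>Re (w - ?p)\<bar> < 1" if "w \<in> A" for w
  proof -
    have "dist ?p w < 1" using that unfolding A_def by (simp only: Int_iff Diff_iff mem_ball)
    then have "norm (w - ?p) < 1" unfolding dist_norm norm_minus_commute[of w] .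
    then show ?thesis using abs_Re_le_cmod[of "w - ?p"] by linarith
  qed
  have G: "1 + (w - ?p) / 2 \<notin> \<int>\<^sub>\<le>\<^sub>0" "1 - (w - ?p) / 2 \<notin> \<int>\<^sub>\<le>\<^sub>0" if "w \<in> A" for w
  proof -
    have r: "Re ((w - ?p) / 2) = Re (w - ?p) / 2" by (rule Re_divide_numeral)
    have "Re (1 + (w - ?p) / 2) = 1 + Re (w - ?p) / 2" "Re (1 - (w - ?p) / 2) = 1 - Re (w - ?p) / 2"
      unfolding plus_complex.sel(1)[of 1] minus_complex.sel(1)[of 1] one_complex.sel(1) r by (rule refl)+
    then have pos: "Re (1 + (w - ?p) / 2) > 0" "Re (1 - (w - ?p) / 2) > 0"
      using ball[OF that] by linarith+
    show "1 + (w - ?p) / 2 \<notin> \<int>\<^sub>\<le>\<^sub>0" by (rule not_nonpos_Ints_if_Re_pos[OF pos(1)])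
    show "1 - (w - ?p) / 2 \<notin> \<int>\<^sub>\<le>\<^sub>0" by (rule not_nonpos_Ints_if_Re_pos[OF pos(2)])
  qed
  have reZ: "-1 < Re (w + s / 2)" if "w \<in> A" for w using re(3)[OF that] by linarith
  have HA: "H holomorphic_on A"
    unfolding H_def E_def F_def using nz zne reZ G by (intro holomorphic_intros) auto
  have Ecos: "1 / cos (of_real pi * (w + s / 2) / 2) = E w / (w - ?p)" if w: "w \<in> A" "w \<noteq> ?p" for w
  proof -
    define z where "z = (w - ?p) / 2"
    have z0: "z \<noteq> 0" using w by (simp add: z_def)
    have zn: "z \<notin> \<int>\<^sub>\<le>\<^sub>0"
    proof
      assume "z \<in> \<int>\<^sub>\<le>\<^sub>0"
      then obtain n :: int where n: "z = of_int n" "n \<le> 0" by (auto elim!: nonpos_Ints_cases)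
      have w2: "w - ?p = 2 * z" by (simp add: z_def)
      have "Re (w - ?p) = 2 * real_of_int n" unfolding w2 n(1) by simp
      then have "n = 0" using ball[OF w(1)] by linarith
      then show False using n z0 by simp
    qed
    have GG: "Gamma (1 + z) * Gamma (1 - z) = z * (of_real pi / sin (of_real pi * z))"
      unfolding add.commute[of 1 z] Gamma_plus1[OF zn] mult.assoc Gamma_reflection_complex ..
    have Ew: "E w = - (2 * z / sin (of_real pi * z))"
      unfolding E_def z_def[symmetric] GG by simp
    have w2: "w - ?p = 2 * z" by (simp add: z_def)
    have wz: "w + s / 2 = 1 + 2 * z" unfolding w2[symmetric] by simp
    have e: "of_real pi * (w + s / 2) / 2 = of_real pi / 2 - (- (of_real pi * z))"
      unfolding wz by (simp add: distrib_left add_divide_distrib)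
    have c: "cos (of_real pi * (w + s / 2) / 2) = - sin (of_real pi * z)"
      unfolding e sin_cos_eq[symmetric] by (rule sin_minus)
    show ?thesis unfolding Ew w2 c using z0 by simp
  qed
  have "residue (\<lambda>w. zeta_kernel s w * exp ((w - 1) * of_real X)) ?p = residue (\<lambda>w. H w / (w - ?p) ^ Suc 1) ?p"
  proof (rule residue_cong[OF _ refl])
    have "\<forall>\<^sub>F w in at ?p. w \<in> A" using A pA by (rule eventually_at_in_open')
    moreover have "\<forall>\<^sub>F w in at ?p. w \<noteq> ?p" by (rule eventually_neq_at_within)
    ultimately show "\<forall>\<^sub>F w in at ?p. zeta_kernel s w * exp ((w - 1) * of_real X) = H w / (w - ?p) ^ Suc 1"
    proof eventually_elim
      case (elim w)
      have wp: "w - ?p \<noteq> 0" using elim by simp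
      have "w + s / 2 \<noteq> 1" using elim(2) by (auto simp: algebra_simps)
      then have "riemann_zeta (w + s / 2) * (w - ?p) = zeta_reg (w + s / 2)"
        using riemann_zeta_mult_eq_zeta_reg[OF reZ[OF elim(1)]] by (simp add: algebra_simps)
      then have z: "riemann_zeta (w + s / 2) = zeta_reg (w + s / 2) / (w - ?p)" by (rule iffD2[OF nonzero_eq_divide_eq[OF wp]])
      have t: "trig_kernel s w = E w / (w - ?p) * (1 / sin (of_real pi * (w - s / 2) / 2))"
        unfolding Ecos[OF elim, symmetric] trig_kernel_def by simp
      have pw: "(w - ?p) ^ Suc 1 = (w - ?p) * (w - ?p)" by simp
      show ?case unfolding H_def F_def zeta_kernel_def z t pw by (simp add: mult_ac)
    qed
  qed
  also have "\<dots> = (deriv ^^ 1) H ?p / fact 1" by (rule residue_holomorphic_over_power[OF A pA HA])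
  also have "\<dots> = deriv H ?p" by simp
  also have "deriv H ?p = - (2 / (of_real pi * cv)) * exp (- s / 2 * of_real X) * (deriv riemann_zeta (1 - s)
        + riemann_zeta (1 - s) * (euler_mascheroni + of_real X - of_real pi / 2 * tan (of_real pi * s / 2)))"
  proof (rule DERIV_imp_deriv)
    define sv where "sv = sin (of_real pi * s / 2)"
    have dZ: "((\<lambda>w. zeta_reg (w + s / 2)) has_field_derivative euler_mascheroni * 1) (at ?p)"
    proof (rule DERIV_chain2[where f = zeta_reg and g = "\<lambda>w. w + s / 2"])
      show "(zeta_reg has_field_derivative euler_mascheroni) (at (?p + s / 2))" using has_field_derivative_zeta_reg_1 by simp
      show "((\<lambda>w. w + s / 2) has_field_derivative 1) (at ?p)" by (auto intro!: derivative_eq_intros)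
    qed
    \<comment> \<open>The Gamma product is even in w - \<open>?p\<close>, so its derivative there is
      0: the two contributions with \<open>Digamma 1\<close> cancel.\<close>
    have dE: "(E has_field_derivative 0) (at ?p)"
    proof -
      have g1: "((\<lambda>w. Gamma (1 + (w - ?p) / 2)) has_field_derivative (Gamma 1 * Digamma 1) * (1 / 2)) (at ?p)"
      proof (rule DERIV_chain2[where f = Gamma and g = "\<lambda>w. 1 + (w - ?p) / 2"])
        show "(Gamma has_field_derivative (Gamma 1 * Digamma 1)) (at (1 + (?p - ?p) / 2))"
          using has_field_derivative_Gamma[of "1 :: complex" UNIV] by simp
        show "((\<lambda>w. 1 + (w - ?p) / 2) has_field_derivative 1 / 2) (at ?p)" by (auto intro!: derivative_eq_intros)
      qed
      have g2: "((\<lambda>w. Gamma (1 - (w - ?p) / 2)) has_field_derivative (Gamma 1 * Digamma 1) * (- (1 / 2))) (at ?p)"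
      proof (rule DERIV_chain2[where f = Gamma and g = "\<lambda>w. 1 - (w - ?p) / 2"])
        show "(Gamma has_field_derivative (Gamma 1 * Digamma 1)) (at (1 - (?p - ?p) / 2))"
          using has_field_derivative_Gamma[of "1 :: complex" UNIV] by simp
        show "((\<lambda>w. 1 - (w - ?p) / 2) has_field_derivative - (1 / 2)) (at ?p)" by (auto intro!: derivative_eq_intros)
      qed
      show ?thesis
        unfolding E_def using DERIV_cmult[OF DERIV_mult'[OF g1 g2], of "- (2 / of_real pi)"] by simp
    qed
    have Ep: "E ?p = - (2 / of_real pi)" by (simp add: E_def)
    have sp: "of_real pi * (?p - s / 2) / 2 = of_real pi / 2 - of_real pi * s / 2" by (simp add: field_simps)
    have sinp: "sin (of_real pi * (?p - s / 2) / 2) = cv" unfolding sp cv_def by (simp only: cos_sin_eq)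
    have cosp: "cos (of_real pi * (?p - s / 2) / 2) = sv" unfolding sp sv_def by (simp only: sin_cos_eq)
    have "riemann_zeta holomorphic_on - {1}" using riemann_zeta_spec by blast
    then have "(riemann_zeta has_field_derivative deriv riemann_zeta (1 - s)) (at (1 - s))"
      by (rule holomorphic_derivI) (use s in auto)
    then have dz0: "(riemann_zeta has_field_derivative deriv riemann_zeta (1 - s)) (at (?p - s / 2))" by simp
    have dz: "((\<lambda>w. riemann_zeta (w - s / 2)) has_field_derivative deriv riemann_zeta (1 - s) * 1) (at ?p)"
      by (rule DERIV_chain2[where f = riemann_zeta and g = "\<lambda>w. w - s / 2", OF dz0]) (auto intro!: derivative_eq_intros)
    have ds: "((\<lambda>w. sin (of_real pi * (w - s / 2) / 2)) has_field_derivative of_real pi / 2 * sv) (at ?p)"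
      unfolding cosp[symmetric] by (auto intro!: derivative_eq_intros)
    have dF: "(F has_field_derivative (deriv riemann_zeta (1 - s) * 1 * cv - riemann_zeta (1 - s) * (of_real pi / 2 * sv)) / (cv * cv)) (at ?p)"
      unfolding F_def using DERIV_divide[OF dz ds] sinp cv0 by simp
    have Fp: "F ?p = riemann_zeta (1 - s) / cv" unfolding F_def sinp by simp
    have dX: "((\<lambda>w. exp ((w - 1) * of_real X)) has_field_derivative exp (- s / 2 * of_real X) * of_real X) (at ?p)"
      by (auto intro!: derivative_eq_intros)
    have Xp: "exp ((?p - 1) * of_real X) = exp (- s / 2 * of_real X)" by simp
    have Zp: "zeta_reg (?p + s / 2) = 1" by (simp add: zeta_reg_1)
    define e where "e = exp (- s / 2 * complex_of_real X)"
    define z where "z = riemann_zeta (1 - s)"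
    define z' where "z' = deriv riemann_zeta (1 - s)"
    have tn: "tan (of_real pi * s / 2) = sv / cv" by (simp add: tan_def sv_def cv_def)
    have "(H has_field_derivative (1 * (E ?p * (F ?p * (e * of_real X) + (z' * 1 * cv - z * (of_real pi / 2 * sv)) / (cv * cv) * e) + 0 * (F ?p * e))
        + euler_mascheroni * 1 * (E ?p * (F ?p * e)))) (at ?p)"
      unfolding H_def using DERIV_mult'[OF dZ DERIV_mult'[OF dE DERIV_mult'[OF dF dX]]]
      unfolding Xp Zp e_def[symmetric] z_def[symmetric] z'_def[symmetric] .
    moreover have "1 * (E ?p * (F ?p * (e * of_real X) + (z' * 1 * cv - z * (of_real pi / 2 * sv)) / (cv * cv) * e) + 0 * (F ?p * e))
        + euler_mascheroni * 1 * (E ?p * (F ?p * e))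
      = - (2 / (of_real pi * cv)) * e * (z' + z * (euler_mascheroni + of_real X - of_real pi / 2 * (sv / cv)))"
      unfolding Ep Fp z_def[symmetric] using cv0 by (simp add: field_simps)
    ultimately show "(H has_field_derivative - (2 / (of_real pi * cv)) * exp (- s / 2 * of_real X) * (deriv riemann_zeta (1 - s)
        + riemann_zeta (1 - s) * (euler_mascheroni + of_real X - of_real pi / 2 * tan (of_real pi * s / 2)))) (at ?p)"
      unfolding tn e_def z_def z'_def by simp
  qed
  finally show ?thesis .
qed

text \<open>The zeros s / 2 and 2 + s / 2 of the sine stay outside the open strip, and inside it the
  cosine vanishes only at the excluded point 1 - s / 2.\<close>

lemma zeta_kernel_holomorphic:
  assumes s: "-1 < Re s" "Re s < 1"
  shows "zeta_kernel s holomorphic_on ({w. \<bar>Re s\<bar> / 2 < Re w} \<inter> {w. Re w < 2 + Re s / 2}) - {1 - s / 2, 1 + s / 2}"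
    (is "_ holomorphic_on ?A")
proof -
  have re: "0 < Re (w - s / 2)" "Re (w - s / 2) < 2" "0 < Re (w + s / 2)" "Re (w + s / 2) < 3" if "w \<in> ?A" for w
    using that s by auto
  have ne: "w - s / 2 \<noteq> 1" "w + s / 2 \<noteq> 1" if "w \<in> ?A" for w using that by (auto simp: algebra_simps)
  have nz: "sin (of_real pi * (w - s / 2) / 2) \<noteq> 0" if "w \<in> ?A" for w
  proof -
    have "w - s / 2 \<noteq> 2"
    proof
      assume "w - s / 2 = 2"
      then have "Re (w - s / 2) = 2" by (simp only: complex_Re_numeral)
      then show False using re(2)[OF that] by linarith
    qed
    moreover have "Re (w - s / 2) < 4" using re(2)[OF that] by linarith
    ultimately show ?thesis using re(1)[OF that] by (intro sin_half_pi_nonzero)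
  qed
  have nz': "cos (of_real pi * (w + s / 2) / 2) \<noteq> 0" if "w \<in> ?A" for w
  proof -
    have "w + s / 2 \<noteq> 3"
    proof
      assume "w + s / 2 = 3"
      then have "Re (w + s / 2) = 3" by (simp only: complex_Re_numeral)
      then show False using re(4)[OF that] by linarith
    qed
    moreover have "Re (w + s / 2) < 5" "-1 < Re (w + s / 2)" using re(3,4)[OF that] by linarith+
    ultimately show ?thesis using ne(2)[OF that] by (intro cos_half_pi_nonzero_strip)
  qed
  show ?thesis
    unfolding zeta_kernel_def trig_kernel_def using nz nz' ne by (intro holomorphic_intros) auto
qed

text \<open>Stated for s = 0 too, where the poles coincide and the set of poles is a singleton:
  integrability on Re w = 1 / 2 is used there.\<close>

lemma zeta_kernel_line_shift:
  fixes X c :: real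
  assumes s: "-1 < Re s" "Re s < 1" and c: "1 + \<bar>Re s\<bar> / 2 < c" "c < 2 + Re s / 2"
  defines "h \<equiv> \<lambda>w. zeta_kernel s w * exp ((w - 1) * of_real X)"
  shows "integrable lborel (\<lambda>t. h (Complex (1 / 2) t))"
    and "(\<integral>t. h (Complex c t) \<partial>lborel) - (\<integral>t. h (Complex (1 / 2) t) \<partial>lborel)
      = 2 * of_real pi * (\<Sum>p\<in>{1 - s / 2, 1 + s / 2}. residue h p)"
proof -
  let ?S = "{w. \<bar>Re s\<bar> / 2 < Re w} \<inter> {w. Re w < 2 + Re s / 2}"
  let ?P = "{1 - s / 2, 1 + s / 2}"
  obtain K where K: "K \<ge> 0" "\<And>s' w. norm s' \<le> norm s \<and> Re (w + s' / 2) \<ge> 0 \<and> Re (w - s' / 2) \<ge> 0 \<and> Re w \<le> 3 \<and> \<bar>Im w\<bar> \<ge> norm s / 2 + 1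
    \<Longrightarrow> norm (zeta_kernel s' w) \<le> K * exp (- \<bar>Im w\<bar>)"
    using zeta_kernel_bound[OF norm_ge_zero[of s]] by blast
  have ab: "1 / 2 < c" using c by linarith
  have S: "open ?S" by (intro open_Int open_halfspace_Re_gt open_halfspace_Re_lt)
  have S': "convex ?S" by (intro convex_Int convex_halfspace_Re_gt convex_halfspace_Re_lt)
  have sub: "{w. 1 / 2 \<le> Re w \<and> Re w \<le> c} \<subseteq> ?S" using s c by auto
  have P: "finite ?P" by simp
  have P': "1 / 2 < Re p \<and> Re p < c" if "p \<in> ?P" for p using that s c by auto
  have h: "h holomorphic_on ?S - ?P"
    unfolding h_def by (intro holomorphic_intros zeta_kernel_holomorphic s)
  have b: "norm (h w) \<le> K * exp (2 * \<bar>X\<bar>) * exp (- \<bar>Im w\<bar>)" if w: "1 / 2 \<le> Re w" "Re w \<le> c" "\<bar>Im w\<bar> \<ge> norm s / 2 + 1" for w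
  proof -
    have "Re (w + s / 2) \<ge> 0 \<and> Re (w - s / 2) \<ge> 0 \<and> Re w \<le> 3" using w s c by auto
    then have 1: "norm (zeta_kernel s w) \<le> K * exp (- \<bar>Im w\<bar>)" using w by (intro K(2)) auto
    have "(Re w - 1) * X \<le> \<bar>Re w - 1\<bar> * \<bar>X\<bar>" using abs_ge_self[of "(Re w - 1) * X"] by (simp add: abs_mult)
    also have "\<dots> \<le> 2 * \<bar>X\<bar>" using w s c by (intro mult_right_mono) auto
    finally have 2: "norm (exp ((w - 1) * of_real X)) \<le> exp (2 * \<bar>X\<bar>)" by (simp add: norm_exp_eq_Re)
    have "norm (h w) \<le> K * exp (- \<bar>Im w\<bar>) * exp (2 * \<bar>X\<bar>)"
      unfolding h_def norm_mult using 1 2 K(1) by (intro mult_mono) auto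
    then show ?thesis by (simp add: mult_ac)
  qed
  show "integrable lborel (\<lambda>t. h (Complex (1 / 2) t))"
    by (rule vertical_contour_shift(1)[OF ab S S' sub P P' h b])
  show "(\<integral>t. h (Complex c t) \<partial>lborel) - (\<integral>t. h (Complex (1 / 2) t) \<partial>lborel) = 2 * of_real pi * (\<Sum>p\<in>?P. residue h p)"
    by (rule vertical_contour_shift(3)[OF ab S S' sub P P' h b])
qed

text \<open>On Re w = c both zeta factors converge absolutely, and Re u is constant along the line.
  So the norm of the n-th term is a number times one integrable function of t, and the numbers are
  summable.\<close>

lemma zeta_kernel_dirichlet_integral:
  assumes s: "-1 < Re s" "Re s < 1" and c: "1 + \<bar>Re s\<bar> / 2 < c" "c < 2 + Re s / 2" and x: "x > 0"
  shows "(\<integral>t. zeta_kernel s (Complex c t) * exp ((Complex c t - 1) * of_real (ln x)) \<partial>lborel) / (4 * of_real pi)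
    = of_real x powr (2 - s / 2) / (of_real pi * cos (of_real pi * s / 2)) * (\<Sum>n. divisor_sigma (- s) (Suc n) * power_quotient x s (Suc n))"
proof -
  have c': "1 - Re s / 2 < c" using c by linarith
  define X where "X = complex_of_real (ln x)"
  define Q where "Q = of_real x powr (2 - s / 2) / (of_real pi * cos (of_real pi * s / 2))"
  have Q0: "Q \<noteq> 0" unfolding Q_def using x cos_half_pi_nonzero[OF s] by simp
  define D where "D n = divisor_sigma (- s) (Suc n)" for n
  define E where "E n t = trig_kernel s (Complex c t) * exp (Complex c t * of_real (ln x - ln (real (Suc n))))" for n t
  define f where "f n t = D n * (of_nat (Suc n) powr (s / 2) * (exp (- X) * E n t))" for n t
  define J where "J n = (\<integral>t. E n t \<partial>lborel)" for n
  define g where "g t = trig_kernel s (Complex c t) * exp ((Complex c t - 1) * X)" for t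
  define u where "u t = Complex c t - s / 2" for t
  have E: "has_bochner_integral lborel (E n) (J n)" for n
    using trig_kernel_exp_integral(1)[OF s c' c(2), of "ln x - ln (real (Suc n))"]
    unfolding J_def has_bochner_integral_iff E_def by blast
  have f: "has_bochner_integral lborel (f n) (D n * (of_nat (Suc n) powr (s / 2) * (exp (- X) * J n)))" for n
    unfolding f_def by (intro has_bochner_integral_mult_right E)
  have np: "of_nat (Suc n) powr z = exp (z * of_real (ln (real (Suc n))))" for z :: complex and n
    using of_real_powr_eq_exp[of "real (Suc n)" z] by simp
  have fg: "f n t = D n * of_nat (Suc n) powr (- u t) * g t" for n t
  proof -
    have e: "exp (s / 2 * of_real (ln (real (Suc n)))) * (exp (- X) * exp (Complex c t * of_real (ln x - ln (real (Suc n)))))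
      = exp (- u t * of_real (ln (real (Suc n)))) * exp ((Complex c t - 1) * X)"
      unfolding exp_add[symmetric] by (rule arg_cong[of _ _ exp]) (simp add: X_def u_def algebra_simps)
    have "f n t = D n * (trig_kernel s (Complex c t) * (exp (s / 2 * of_real (ln (real (Suc n)))) * (exp (- X) * exp (Complex c t * of_real (ln x - ln (real (Suc n)))))))"
      unfolding f_def E_def np by (simp only: mult_ac)
    then show ?thesis unfolding e g_def np by (simp only: mult_ac)
  qed
  have Reu: "Re (u t) = c - Re s / 2" "Re (u t + s) = c + Re s / 2" for t by (simp_all add: u_def)
  have u1: "Re (u t) > 1" "Re (u t + s) > 1" for t unfolding Reu using c by linarith+
  have nf: "norm (f n t) = norm (D n) * real (Suc n) powr (- Re (u 0)) * norm (g t)" for n t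
  proof -
    have "norm (of_nat (Suc n) powr (- u t)) = real (Suc n) powr (- Re (u 0))"
      using Reu(1) by (subst norm_powr_real_powr) auto
    then show ?thesis unfolding fg norm_mult by simp
  qed
  have sm: "summable (\<lambda>n. norm (D n) * real (Suc n) powr (- Re (u 0)))"
    unfolding D_def by (rule summable_norm_divisor_sigma[OF u1])
  have "\<exists>L. (\<lambda>n. D n * (of_nat (Suc n) powr (s / 2) * (exp (- X) * J n))) sums L
      \<and> has_bochner_integral lborel (\<lambda>t. riemann_zeta (u t + s) * riemann_zeta (u t) * g t) L"
  proof (rule has_bochner_integral_sums_ex[OF f])
    show "summable (\<lambda>n. norm (f n t))" for t unfolding nf by (intro summable_mult2 sm)
    show "summable (\<lambda>n. \<integral>t. norm (f n t) \<partial>lborel)" unfolding nf integral_mult_right_zero by (intro summable_mult2 sm)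
    show "(\<lambda>n. f n t) sums (riemann_zeta (u t + s) * riemann_zeta (u t) * g t)" for t
      unfolding fg D_def by (intro sums_mult2 divisor_sigma_sums u1)
  qed
  then obtain L where L: "(\<lambda>n. D n * (of_nat (Suc n) powr (s / 2) * (exp (- X) * J n))) sums L"
    "has_bochner_integral lborel (\<lambda>t. riemann_zeta (u t + s) * riemann_zeta (u t) * g t) L" by blast
  have us: "u t + s = Complex c t + s / 2" for t by (simp add: u_def)
  have "(\<lambda>t. riemann_zeta (u t + s) * riemann_zeta (u t) * g t) = (\<lambda>t. zeta_kernel s (Complex c t) * exp ((Complex c t - 1) * X))"
    unfolding us unfolding g_def zeta_kernel_def u_def by (simp add: mult_ac)
  then have I: "(\<integral>t. zeta_kernel s (Complex c t) * exp ((Complex c t - 1) * X) \<partial>lborel) = L"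
    using L(2) by (simp add: has_bochner_integral_iff)
  have term': "of_nat (Suc n) powr (s / 2) * (exp (- X) * J n) = 4 * of_real pi * (Q * power_quotient x s (Suc n))" for n
    using trig_kernel_mellin_term[OF s c' c(2) x, of "Suc n"] unfolding J_def E_def X_def Q_def by (simp add: field_simps)
  have "(\<lambda>n. 4 * of_real pi * Q * (D n * power_quotient x s (Suc n))) sums L"
    using L(1) unfolding term' by (simp add: mult_ac)
  then have "(\<lambda>n. 4 * of_real pi * Q * (D n * power_quotient x s (Suc n)) / (4 * of_real pi * Q)) sums (L / (4 * of_real pi * Q))"
    by (rule sums_divide)
  then have "(\<lambda>n. D n * power_quotient x s (Suc n)) sums (L / (4 * of_real pi * Q))"
    using Q0 by simp
  then have S: "(\<Sum>n. D n * power_quotient x s (Suc n)) = L / (4 * of_real pi * Q)" by (rule sums_unique[symmetric])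
  show ?thesis
    unfolding Q_def[symmetric] X_def[symmetric] D_def[symmetric] S I using Q0 by simp
qed

text \<open>Moving the line from c to 1 / 2 contributes minus half the sum of the residues, as 2 pi
  / (4 pi) = 1 / 2. The residue at 1 - s / 2 is expressed with zeta (1 - s); the functional equation
  converts it to the Gamma s * zeta s of f.\<close>

theorem f_formula_eq_integral:
  assumes s: "-1 < Re s" "Re s < 1" "s \<noteq> 0" and x: "x > 0"
  shows "f_formula x s = f_integral x s"
proof -
  \<comment> \<open>The midpoint of the admissible interval, which is nonempty because |Re s| < 2 +
    Re s for Re s > -1.\<close>
  define c where "c = ((1 + \<bar>Re s\<bar> / 2) + (2 + Re s / 2)) / 2"
  have c: "1 + \<bar>Re s\<bar> / 2 < c" "c < 2 + Re s / 2"
  proof -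
    have "\<bar>Re s\<bar> < 2 + Re s" using s by (cases "Re s \<ge> 0") auto
    then show "1 + \<bar>Re s\<bar> / 2 < c" "c < 2 + Re s / 2" unfolding c_def by (simp_all add: field_simps)
  qed
  define X where "X = complex_of_real (ln x)"
  define cv where "cv = cos (of_real pi * s / 2)"
  have cv0: "cv \<noteq> 0" unfolding cv_def using s by (intro cos_half_pi_nonzero) auto
  define tn where "tn = tan (of_real pi * s / 2)"
  define sv where "sv = sin (of_real pi * s / 2)"
  define Q where "Q = of_real x powr (2 - s / 2) / (of_real pi * cv) * (\<Sum>n. divisor_sigma (- s) (Suc n) * power_quotient x s (Suc n))"
  define z' where "z' = deriv riemann_zeta (1 - s)"
  define G where "G = Gamma s * riemann_zeta s"
  define e where "e = exp (- s * complex_of_real (ln (2 * pi)))"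
  define ex where "ex = exp (- s / 2 * X)"
  define r where "r = riemann_zeta (1 + s) * exp (s / 2 * X) / sv"
  have ne: "1 - s / 2 \<noteq> 1 + s / 2" using s(3) by (auto simp: complex_eq_iff)
  have zr: "riemann_zeta (1 - s) = 2 * e * cv * G"
    unfolding riemann_zeta_reflection[OF s] e_def cv_def G_def by (simp only: mult_ac)
  have i1: "(\<integral>t. zeta_kernel s (Complex c t) * exp ((Complex c t - 1) * X) \<partial>lborel) / (4 * of_real pi) = Q"
    unfolding Q_def X_def cv_def by (rule zeta_kernel_dirichlet_integral[OF s(1,2) c x])
  have i2: "(\<integral>t. zeta_kernel s (Complex c t) * exp ((Complex c t - 1) * X) \<partial>lborel)
      - (\<integral>t. zeta_kernel s (Complex (1 / 2) t) * exp ((Complex (1 / 2) t - 1) * X) \<partial>lborel)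
    = 2 * of_real pi * (- (2 / (of_real pi * cv)) * ex * (z' + 2 * e * cv * G * (euler_mascheroni + X - of_real pi / 2 * tn)) - r)"
    using zeta_kernel_line_shift(2)[OF s(1,2) c, of "ln x"] residue_zeta_kernel_simple[OF s, of "ln x"] residue_zeta_kernel_double[OF s, of "ln x"] ne
    unfolding zr X_def cv_def tn_def sv_def ex_def z'_def r_def by simp
  have I: "f_integral x s = Q + 1 / (of_real pi * cv) * ex * (z' + 2 * e * cv * G * (euler_mascheroni + X - of_real pi / 2 * tn)) + r / 2"
  proof -
    have "A / (4 * of_real pi) = B / (4 * of_real pi) - q / 2" if "B - A = 2 * of_real pi * q" for A B q :: complex
    proof -
      have A: "A = B - 2 * of_real pi * q" using that by (simp add: algebra_simps)
      show ?thesis unfolding A by (simp add: diff_divide_distrib)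
    qed
    from this[OF i2] show ?thesis unfolding f_integral_def X_def[symmetric] i1 by (simp add: field_simps)
  qed
  have l2pi: "ln (2 * pi) = ln 2 + ln pi" by (simp add: ln_mult)
  have p2: "2 powr (- s) * of_real pi powr (- 1 - s) = e / of_real pi"
  proof -
    have "2 powr (- s) = exp (- s * complex_of_real (ln 2))" using of_real_powr_eq_exp[of 2 "- s"] by simp
    moreover have "of_real pi powr (- 1 - s) = exp ((- 1 - s) * complex_of_real (ln pi))" by (rule of_real_powr_eq_exp) simp
    moreover have "exp (- s * complex_of_real (ln 2)) * exp ((- 1 - s) * complex_of_real (ln pi)) = e * exp (of_real (- ln pi))"
      unfolding e_def l2pi exp_add[symmetric] by (rule arg_cong[of _ _ exp]) (simp add: algebra_simps)
    moreover have "exp (of_real (- ln pi)) = 1 / complex_of_real pi" unfolding exp_of_real by (simp add: exp_minus divide_inverse)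
    ultimately show ?thesis by simp
  qed
  have p2p: "of_real (2 * pi) powr s = 1 / e"
    using of_real_powr_eq_exp[of "2 * pi" s] unfolding e_def by (simp add: exp_minus divide_inverse)
  have xp: "of_real x powr z = exp (z * X)" for z using of_real_powr_eq_exp[OF x] by (simp add: X_def)
  have e0: "e \<noteq> 0" by (simp add: e_def)
  have "f_formula x s = r / 2 + Q - e / of_real pi * ex * (G * (of_real pi * tn - 2 * (euler_mascheroni + X)) - 1 / e * z' / cv)"
    unfolding f_formula_def p2 p2p xp[of "s / 2"] xp[of "- s / 2"] Q_def r_def ex_def G_def z'_def tn_def cv_def sv_def X_def
    by (simp add: mult_ac)
  also have "\<dots> = f_integral x s"
    unfolding I using cv0 e0 by (simp add: field_simps)
  finally show ?thesis .
qed

text \<open>The arguments w + s / 2 and w - s / 2 keep real parts strictly between 0 and 1 on this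
  line, away from the pole of zeta and from the zeros of the denominator; s = 0 is not
  exceptional.\<close>

lemma continuous_on_zeta_kernel_line:
  "continuous_on ({s. \<bar>Re s\<bar> < 1} \<times> UNIV) (\<lambda>p. zeta_kernel (fst p) (Complex (1 / 2) (snd p)))"
proof -
  let ?A = "{s :: complex. \<bar>Re s\<bar> < 1} \<times> (UNIV :: real set)"
  have zc: "continuous_on (- {1}) riemann_zeta"
    using riemann_zeta_spec by (blast intro: holomorphic_on_imp_continuous_on)
  have p: "0 < Re (of_real (1 / 2) + \<i> * of_real (snd p) + fst p / 2)" "Re (of_real (1 / 2) + \<i> * of_real (snd p) + fst p / 2) < 1"
      "0 < Re (of_real (1 / 2) + \<i> * of_real (snd p) - fst p / 2)" "Re (of_real (1 / 2) + \<i> * of_real (snd p) - fst p / 2) < 1"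
    if "p \<in> ?A" for p using that by auto
  have c: "continuous_on ?A (\<lambda>p. of_real (1 / 2) + \<i> * of_real (snd p) + fst p / 2)"
    "continuous_on ?A (\<lambda>p. of_real (1 / 2) + \<i> * of_real (snd p) - fst p / 2)"
    by (intro continuous_intros; simp)+
  have z1: "continuous_on ?A (\<lambda>p. riemann_zeta (of_real (1 / 2) + \<i> * of_real (snd p) + fst p / 2))"
  proof (rule continuous_on_compose2[OF zc c(1)], rule image_subsetI)
    fix p assume "p \<in> ?A"
    from p(2)[OF this] show "of_real (1 / 2) + \<i> * of_real (snd p) + fst p / 2 \<in> - {1}" by (metis ComplI less_irrefl one_complex.sel(1) singletonD)
  qed
  have z2: "continuous_on ?A (\<lambda>p. riemann_zeta (of_real (1 / 2) + \<i> * of_real (snd p) - fst p / 2))"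
  proof (rule continuous_on_compose2[OF zc c(2)], rule image_subsetI)
    fix p assume "p \<in> ?A"
    from p(4)[OF this] show "of_real (1 / 2) + \<i> * of_real (snd p) - fst p / 2 \<in> - {1}" by (metis ComplI less_irrefl one_complex.sel(1) singletonD)
  qed
  have nz: "cos (of_real pi * (of_real (1 / 2) + \<i> * of_real (snd p) + fst p / 2) / 2) \<noteq> 0" if "p \<in> ?A" for p
    using p(1,2)[OF that] by (intro cos_half_pi_nonzero) linarith+
  have nz': "sin (of_real pi * (of_real (1 / 2) + \<i> * of_real (snd p) - fst p / 2) / 2) \<noteq> 0" if "p \<in> ?A" for p
  proof (rule sin_half_pi_nonzero)
    show "0 < Re (of_real (1 / 2) + \<i> * of_real (snd p) - fst p / 2)" by (rule p(3)[OF that])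
    show "Re (of_real (1 / 2) + \<i> * of_real (snd p) - fst p / 2) < 4" using p(4)[OF that] by linarith
    show "of_real (1 / 2) + \<i> * of_real (snd p) - fst p / 2 \<noteq> 2"
    proof
      assume "of_real (1 / 2) + \<i> * of_real (snd p) - fst p / 2 = 2"
      then have "Re (of_real (1 / 2) + \<i> * of_real (snd p) - fst p / 2) = 2" by (simp only: complex_Re_numeral)
      then show False using p(4)[OF that] by linarith
    qed
  qed
  have tc: "continuous_on ?A (\<lambda>p. trig_kernel (fst p) (of_real (1 / 2) + \<i> * of_real (snd p)))"
    unfolding trig_kernel_def
  proof (rule continuous_on_divide[OF continuous_on_const])
    show "continuous_on ?A (\<lambda>p. cos (of_real pi * (of_real (1 / 2) + \<i> * of_real (snd p) + fst p / 2) / 2)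
        * sin (of_real pi * (of_real (1 / 2) + \<i> * of_real (snd p) - fst p / 2) / 2))"
      by (intro continuous_intros c) auto
    show "\<forall>p\<in>?A. cos (of_real pi * (of_real (1 / 2) + \<i> * of_real (snd p) + fst p / 2) / 2)
        * sin (of_real pi * (of_real (1 / 2) + \<i> * of_real (snd p) - fst p / 2) / 2) \<noteq> 0"
      using nz nz' by (intro ballI no_zero_divisors) blast+
  qed
  show ?thesis unfolding zeta_kernel_def Complex_eq_of_real by (intro continuous_on_mult z1 z2 tc)
qed

text \<open>For |s| <= 1 / 2 the general bound covers |t| >= 5 / 4, and joint continuity on a
  compact box covers |t| <= 2.\<close>

lemma zeta_kernel_line_bound:
  "\<exists>K\<ge>0. \<forall>s t. norm s \<le> 1 / 2 \<longrightarrow> norm (zeta_kernel s (Complex (1 / 2) t)) \<le> K * exp (- \<bar>t\<bar>)"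
proof -
  obtain K where K: "K \<ge> 0" "\<And>s w. norm s \<le> 1 / 2 \<and> Re (w + s / 2) \<ge> 0 \<and> Re (w - s / 2) \<ge> 0 \<and> Re w \<le> 3 \<and> \<bar>Im w\<bar> \<ge> 1 / 2 / 2 + 1
    \<Longrightarrow> norm (zeta_kernel s w) \<le> K * exp (- \<bar>Im w\<bar>)"
    using zeta_kernel_bound[of "1 / 2"] by auto
  let ?A = "cball 0 (1 / 2) \<times> {-2..2 :: real}"
  have re: "\<bar>Re s\<bar> \<le> 1 / 2" if "norm s \<le> 1 / 2" for s :: complex using abs_Re_le_cmod[of s] that by linarith
  have "?A \<subseteq> {s. \<bar>Re s\<bar> < 1} \<times> UNIV" using re by fastforce
  then have "compact ((\<lambda>p. zeta_kernel (fst p) (Complex (1 / 2) (snd p))) ` ?A)"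
    by (intro compact_continuous_image compact_Times continuous_on_subset[OF continuous_on_zeta_kernel_line]) auto
  then have "bounded ((\<lambda>p. zeta_kernel (fst p) (Complex (1 / 2) (snd p))) ` ?A)" by (rule compact_imp_bounded)
  then obtain B where B: "\<And>p. p \<in> ?A \<Longrightarrow> norm (zeta_kernel (fst p) (Complex (1 / 2) (snd p))) \<le> B"
    unfolding bounded_iff by blast
  define C where "C = max K (B * exp 2)"
  have C0: "C \<ge> 0" using K(1) by (simp add: C_def)
  have "norm (zeta_kernel s (Complex (1 / 2) t)) \<le> C * exp (- \<bar>t\<bar>)" if s: "norm s \<le> 1 / 2" for s t
  proof (cases "\<bar>t\<bar> \<le> 2")
    case True
    have b: "norm (zeta_kernel s (Complex (1 / 2) t)) \<le> B" using B[of "(s, t)"] s abs_le_D1[OF True] abs_le_D2[OF True] by simp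
    have B0: "B \<ge> 0" using b norm_ge_zero order_trans by blast
    have "B = B * exp 2 * exp (- 2)" by (simp add: mult.assoc exp_add[symmetric])
    also have "\<dots> \<le> B * exp 2 * exp (- \<bar>t\<bar>)" using True B0 by (intro mult_left_mono) auto
    also have "\<dots> \<le> C * exp (- \<bar>t\<bar>)" by (intro mult_right_mono) (auto simp: C_def)
    finally show ?thesis using b by linarith
  next
    case False
    have "norm (zeta_kernel s (Complex (1 / 2) t)) \<le> K * exp (- \<bar>Im (Complex (1 / 2) t)\<bar>)"
      using s re[OF s] False by (intro K(2)) auto
    also have "\<dots> \<le> C * exp (- \<bar>t\<bar>)" unfolding complex.sel by (intro mult_right_mono) (auto simp: C_def)
    finally show ?thesis .
  qed
  with C0 show ?thesis by blast
qed

lemma continuous_zeta_kernel_line: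
  assumes "\<bar>Re s\<bar> < 1"
  shows "continuous_on UNIV (\<lambda>t. zeta_kernel s (Complex (1 / 2) t))"
proof -
  have c: "continuous_on UNIV (\<lambda>t :: real. (s, t))" by (intro continuous_intros)
  have "(\<lambda>t. (s, t)) ` UNIV \<subseteq> {s. \<bar>Re s\<bar> < 1} \<times> (UNIV :: real set)" using assms by auto
  from continuous_on_compose2[OF continuous_on_zeta_kernel_line c this] show ?thesis by simp
qed

lemma f_integral_tendsto_0: "(f_integral x \<longlongrightarrow> f_integral x 0) (at 0)"
proof -
  obtain K where K: "K \<ge> 0" "\<And>s t. norm s \<le> 1 / 2 \<Longrightarrow> norm (zeta_kernel s (Complex (1 / 2) t)) \<le> K * exp (- \<bar>t\<bar>)"
    using zeta_kernel_line_bound by blast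
  define X where "X = ln x"
  have re: "\<bar>Re s\<bar> < 1" if "s \<in> ball 0 (1 / 2)" for s :: complex
    using abs_Re_le_cmod[of s] that by simp
  have ec: "continuous_on UNIV (\<lambda>t. exp ((Complex (1 / 2) t - 1) * of_real X))"
    unfolding Complex_eq_of_real by (intro continuous_intros)
  have "((\<lambda>s. \<integral>t. zeta_kernel s (Complex (1 / 2) t) * exp ((Complex (1 / 2) t - 1) * of_real X) \<partial>lborel)
      \<longlongrightarrow> (\<integral>t. zeta_kernel 0 (Complex (1 / 2) t) * exp ((Complex (1 / 2) t - 1) * of_real X) \<partial>lborel)) (at 0)"
  proof (rule integral_tendsto_dominated[where S = "ball 0 (1 / 2)" and w = "\<lambda>t. K * exp (- \<bar>t\<bar>) * exp (- (1 / 2) * X)"])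
    show "(\<lambda>t. zeta_kernel s (Complex (1 / 2) t) * exp ((Complex (1 / 2) t - 1) * of_real X)) \<in> borel_measurable lborel"
      if "s \<in> ball 0 (1 / 2)" for s
      using borel_measurable_continuous_onI[OF continuous_on_mult[OF continuous_zeta_kernel_line[OF re[OF that]] ec]] by simp
    show "norm (zeta_kernel s (Complex (1 / 2) t) * exp ((Complex (1 / 2) t - 1) * of_real X)) \<le> K * exp (- \<bar>t\<bar>) * exp (- (1 / 2) * X)"
      if "s \<in> ball 0 (1 / 2)" for s t
    proof -
      have "norm (zeta_kernel s (Complex (1 / 2) t)) \<le> K * exp (- \<bar>t\<bar>)" using that by (intro K(2)) auto
      moreover have "norm (exp ((Complex (1 / 2) t - 1) * of_real X)) = exp (- (1 / 2) * X)" by (simp add: norm_exp_eq_Re)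
      ultimately show ?thesis unfolding norm_mult by (metis exp_ge_zero mult_right_mono)
    qed
    show "integrable lborel (\<lambda>t. K * exp (- \<bar>t\<bar>) * exp (- (1 / 2) * X))"
      by (intro integrable_mult_left integrable_mult_right integrable_exp_minus_abs)
    show "continuous_on (ball 0 (1 / 2)) (\<lambda>s. zeta_kernel s (Complex (1 / 2) t) * exp ((Complex (1 / 2) t - 1) * of_real X))" for t
    proof (intro continuous_on_mult continuous_on_const)
      have c: "continuous_on (ball 0 (1 / 2)) (\<lambda>s. (s :: complex, t))" by (intro continuous_intros)
      have "(\<lambda>s. (s, t)) ` ball 0 (1 / 2) \<subseteq> {s. \<bar>Re s\<bar> < 1} \<times> UNIV" using re by blast
      from continuous_on_compose2[OF continuous_on_zeta_kernel_line c this]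
      show "continuous_on (ball 0 (1 / 2)) (\<lambda>s. zeta_kernel s (Complex (1 / 2) t))" by simp
    qed
  qed auto
  then show ?thesis unfolding f_integral_def X_def by (intro tendsto_divide tendsto_const) auto
qed

text \<open>Away from s = 0 both sides agree, and the integral is continuous at 0, so the limit in
  \<open>f_kernel\<close> exists and equals the integral there.\<close>

theorem f_kernel_eq_integral:
  assumes s: "-1 < Re s" "Re s < 1" and x: "x > 0"
  shows "f_kernel x s = f_integral x s"
proof (cases "s = 0")
  case False
  then show ?thesis using f_formula_eq_integral[OF s False x] by (simp add: f_kernel_def)
next
  case True
  have "\<forall>\<^sub>F s in at 0. f_integral x s = f_formula x s"
    unfolding eventually_at
  proof (intro exI[of _ 1] conjI ballI impI)
    fix s :: complex assume "s \<noteq> 0 \<and> dist s 0 < 1"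
    then show "f_integral x s = f_formula x s"
      using abs_Re_le_cmod[of s] x by (intro f_formula_eq_integral[symmetric]) auto
  qed simp
  then have "(f_formula x \<longlongrightarrow> f_integral x 0) (at 0)"
    by (rule Lim_transform_eventually[OF f_integral_tendsto_0])
  then have "Lim (at 0) (f_formula x) = f_integral x 0" by (intro tendsto_Lim) auto
  then show ?thesis using True by (simp add: f_kernel_def)
qed

section \<open>The Bessel transform\<close>

text \<open>The oscillating factor has modulus 1, so the double integrand has norm |k t| * |B u| and
  Fubini asks only for integrable k and B. The product k * G is integrable because |G| is at most
  the integral of |B|.\<close>

lemma has_bochner_integral_fourier_swap:
  fixes k B G :: "real \<Rightarrow> complex"
  assumes k: "integrable lborel k" and B: "integrable lborel B"
    and G: "\<And>t. has_bochner_integral lborel (\<lambda>u. exp (\<i> * of_real (t * u)) * B u) (G t)"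
  shows "integrable lborel (\<lambda>t. k t * G t)"
    and "has_bochner_integral lborel (\<lambda>u. (\<integral>t. k t * exp (\<i> * of_real (t * u)) \<partial>lborel) * B u) (\<integral>t. k t * G t \<partial>lborel)"
proof -
  define f where "f t u = k t * (exp (\<i> * of_real (t * u)) * B u)" for t u
  define M where "M = (\<integral>u. norm (B u) \<partial>lborel)"
  have [measurable]: "k \<in> borel_measurable borel" "B \<in> borel_measurable borel"
    using borel_measurable_integrable[OF k] borel_measurable_integrable[OF B] by simp_all
  have em: "(\<lambda>p. exp (\<i> * of_real (fst p * snd p)) :: complex) \<in> borel_measurable borel"
    by (intro borel_measurable_continuous_onI continuous_intros)
  have meas: "(\<lambda>p. f (fst p) (snd p)) \<in> borel_measurable borel"
    unfolding f_def borel_prod[symmetric]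
    using em unfolding borel_prod[symmetric] by measurable
  have g: "has_bochner_integral lborel (f t) (k t * G t)" for t
    unfolding f_def by (intro has_bochner_integral_mult_right G)
  have nf: "norm (f t u) = norm (k t) * norm (B u)" for t u
    unfolding f_def norm_mult by (simp add: norm_exp_i_times)
  have nB: "has_bochner_integral lborel (\<lambda>u. norm (B u)) M"
    using B by (simp add: has_bochner_integral_iff M_def)
  have n: "has_bochner_integral lborel (\<lambda>u. complex_of_real (norm (f t u))) (of_real (norm (k t) * M))" for t
    unfolding nf by (intro has_bochner_integral_of_real has_bochner_integral_mult_right nB)
  have N: "integrable lborel (\<lambda>t. complex_of_real (norm (k t) * M))"
    using k by (intro integrable_of_real integrable_mult_left integrable_norm)
  have h: "has_bochner_integral lborel (\<lambda>t. f t u) ((\<integral>t. k t * exp (\<i> * of_real (t * u)) \<partial>lborel) * B u)" for u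
  proof -
    have "integrable lborel (\<lambda>t. k t * exp (\<i> * of_real (t * u)))"
    proof (rule Bochner_Integration.integrable_bound[OF k])
      have "(\<lambda>t. exp (\<i> * of_real (t * u)) :: complex) \<in> borel_measurable borel"
        by (intro borel_measurable_continuous_onI continuous_intros)
      then show "(\<lambda>t. k t * exp (\<i> * of_real (t * u))) \<in> borel_measurable lborel" by simp
      show "AE t in lborel. norm (k t * exp (\<i> * of_real (t * u))) \<le> norm (k t)"
        by (rule AE_I2) (simp add: norm_mult norm_exp_i_times)
    qed
    then have "has_bochner_integral lborel (\<lambda>t. k t * exp (\<i> * of_real (t * u)) * B u) ((\<integral>t. k t * exp (\<i> * of_real (t * u)) \<partial>lborel) * B u)"
      by (intro has_bochner_integral_mult_left) (simp add: has_bochner_integral_iff)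
    then show ?thesis by (simp add: f_def mult.assoc)
  qed
  have Gt: "G t = (\<integral>u. exp (\<i> * of_real (t * u)) * B u \<partial>lborel)" for t
    using G[of t] by (simp add: has_bochner_integral_iff)
  have ft: "k t * G t = (\<integral>u. f t u \<partial>lborel)" for t using g[of t] by (simp add: has_bochner_integral_iff)
  show I: "integrable lborel (\<lambda>t. k t * G t)"
  proof (rule Bochner_Integration.integrable_bound[OF N])
    have "case_prod f \<in> borel_measurable (borel \<Otimes>\<^sub>M lborel)"
    proof -
      have "case_prod f \<in> borel_measurable (borel \<Otimes>\<^sub>M borel)" using meas unfolding borel_prod by (simp add: case_prod_beta')
      then show ?thesis by simp
    qed
    then have "(\<lambda>t. \<integral>u. f t u \<partial>lborel) \<in> borel_measurable borel"
      by (rule lborel.borel_measurable_lebesgue_integral)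
    then show "(\<lambda>t. k t * G t) \<in> borel_measurable lborel" unfolding ft by simp
    show "AE t in lborel. norm (k t * G t) \<le> norm (complex_of_real (norm (k t) * M))"
    proof (rule AE_I2)
      fix t
      have "norm (k t * G t) \<le> (\<integral>u. norm (f t u) \<partial>lborel)" unfolding ft by (rule integral_norm_bound)
      also have "\<dots> = norm (k t) * M" unfolding nf M_def by simp
      also have "\<dots> \<le> norm (complex_of_real (norm (k t) * M))" unfolding norm_of_real by (rule abs_ge_self)
      finally show "norm (k t * G t) \<le> norm (complex_of_real (norm (k t) * M))" .
    qed
  qed
  show "has_bochner_integral lborel (\<lambda>u. (\<integral>t. k t * exp (\<i> * of_real (t * u)) \<partial>lborel) * B u) (\<integral>t. k t * G t \<partial>lborel)"
    by (rule fubini_of_real_norm[OF meas g n N h]) (use I in \<open>simp add: has_bochner_integral_iff\<close>)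
qed

lemma has_integral_even_half_line:
  fixes f :: "real \<Rightarrow> complex"
  assumes f: "has_bochner_integral lborel f I" and even: "\<And>t. f (- t) = f t"
  shows "(f has_integral I / 2) {0<..}"
proof -
  have int: "integrable lborel f" and I: "I = integral\<^sup>L lborel f" using f by (auto simp: has_bochner_integral_iff)
  have p: "set_integrable lborel {0<..} f" "set_integrable lborel {..<0} f"
    unfolding set_integrable_def using int by (auto intro!: integrable_mult_indicator)
  have "(LINT t:{..<0}|lborel. f t) = (\<integral>t. indicator {..<0} (- t) *\<^sub>R f (- t) \<partial>lborel)"
    unfolding set_lebesgue_integral_def by (subst lborel_integral_real_affine[where c = "-1" and t = 0]) auto
  also have "\<dots> = (LINT t:{0<..}|lborel. f t)"
    unfolding set_lebesgue_integral_def even by (intro Bochner_Integration.integral_cong) (auto simp: indicator_def)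
  finally have m: "(LINT t:{..<0}|lborel. f t) = (LINT t:{0<..}|lborel. f t)" .
  have "I = (\<integral>t. indicator {0<..} t *\<^sub>R f t + indicator {..<0} t *\<^sub>R f t \<partial>lborel)"
    unfolding I
  proof (rule integral_cong_AE)
    show "f \<in> borel_measurable lborel" using int by (rule borel_measurable_integrable)
    show "(\<lambda>t. indicator {0<..} t *\<^sub>R f t + indicator {..<0} t *\<^sub>R f t) \<in> borel_measurable lborel"
      using p unfolding set_integrable_def by (intro borel_measurable_integrable Bochner_Integration.integrable_add)
    show "AE t in lborel. f t = indicator {0<..} t *\<^sub>R f t + indicator {..<0} t *\<^sub>R f t"
      using AE_lborel_singleton[of 0] by eventually_elim (auto simp: indicator_def)
  qed
  also have "\<dots> = (LINT t:{0<..}|lborel. f t) + (LINT t:{..<0}|lborel. f t)"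
    unfolding set_lebesgue_integral_def using p unfolding set_integrable_def by (rule Bochner_Integration.integral_add)
  finally have "(LINT t:{0<..}|lborel. f t) = I / 2" unfolding m by simp
  then show ?thesis using set_borel_integral_eq_integral[OF p(1)] by (metis integrable_integral)
qed

lemma zeta_kernel_line_integrable:
  assumes s: "-1 < Re s" "Re s < 1"
  shows "integrable lborel (\<lambda>t. zeta_kernel s (Complex (1 / 2) t))"
proof -
  have "\<bar>Re s\<bar> < 2 + Re s" using s by (cases "Re s \<ge> 0") auto
  then have "1 + \<bar>Re s\<bar> / 2 < 2 + Re s / 2" by (simp add: field_simps)
  then obtain c where "1 + \<bar>Re s\<bar> / 2 < c" "c < 2 + Re s / 2" using dense by blast
  from zeta_kernel_line_shift(1)[OF s this, of 0] show ?thesis by simp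
qed

section \<open>The even kernel of the final integral\<close>

definition completed_zeta :: "complex \<Rightarrow> complex" where
  "completed_zeta u = exp (- (u / 2) * of_real (ln pi)) * Gamma (u / 2) * riemann_zeta u"

text \<open>What remains of the integrand after the Bessel transform. Of the factor 1 / (16 pi), 1 /
  (4 pi) stems from \<open>f_integral\<close> and 1 / 4 from the Mellin transform of K; the powers
  of pi in \<open>completed_zeta\<close> stem from the pi in the argument of K.\<close>

definition xi_kernel :: "complex \<Rightarrow> real \<Rightarrow> complex" where
  "xi_kernel s t = completed_zeta (Complex (1 / 2) t + s / 2) * completed_zeta (Complex (1 / 2) t - s / 2)
    * trig_kernel s (Complex (1 / 2) t) / (16 * of_real pi)"

lemma trig_kernel_reflect: "trig_kernel s (1 - w) = trig_kernel s w"
proof -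
  have e: "of_real pi * (1 - w + s / 2) / 2 = of_real pi / 2 - of_real pi * (w - s / 2) / 2"
    "of_real pi * (1 - w - s / 2) / 2 = of_real pi / 2 - of_real pi * (w + s / 2) / 2" by (simp_all add: field_simps)
  show ?thesis unfolding trig_kernel_def e cos_sin_eq[symmetric] sin_cos_eq[symmetric] by (simp only: mult.commute)
qed

text \<open>On the critical line t \<mapsto> - t is w \<mapsto> 1 - w, which exchanges cosine and
  sine in the kernel and the two completed zeta factors.\<close>

lemma xi_kernel_even:
  assumes s: "-1 < Re s" "Re s < 1"
  shows "xi_kernel s (- t) = xi_kernel s t"
proof -
  have r: "completed_zeta (1 - u) = completed_zeta u" if "0 < Re u" "Re u < 1" for u
    using completed_zeta_reflection[OF that] unfolding completed_zeta_def .
  have w: "Complex (1 / 2) (- t) = 1 - Complex (1 / 2) t" by (simp add: complex_eq_iff)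
  have e: "1 - Complex (1 / 2) t + s / 2 = 1 - (Complex (1 / 2) t - s / 2)" "1 - Complex (1 / 2) t - s / 2 = 1 - (Complex (1 / 2) t + s / 2)"
    by simp_all
  have "completed_zeta (1 - (Complex (1 / 2) t - s / 2)) = completed_zeta (Complex (1 / 2) t - s / 2)"
    "completed_zeta (1 - (Complex (1 / 2) t + s / 2)) = completed_zeta (Complex (1 / 2) t + s / 2)"
    using s by (intro r; simp)+
  then show ?thesis unfolding xi_kernel_def w trig_kernel_reflect e by (simp only: mult_ac)
qed

text \<open>After x = exp u the integral pairs the Fourier transform of the zeta kernel with K
  weighted by exp (u / 2), so the two integrations can be swapped. The Mellin transform of K
  contributes a powr (- 1/2 - i t): its modulus is cancelled by sqrt a, the rest is the oscillation
  in \<Phi>.\<close>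

lemma bessel_f_kernel_integral:
  assumes s: "-1 < Re s" "Re s < 1" and a: "a > 0"
  defines "\<Phi> \<equiv> \<lambda>t. xi_kernel s t * exp (\<i> * of_real (t * - ln a))"
  shows "integrable lborel \<Phi>"
    and "(\<lambda>x. bessel_K (s / 2) (of_real (2 * pi * a * x)) * f_kernel x s) integrable_on {0<..}"
    and "of_real (sqrt a) * integral {0<..} (\<lambda>x. bessel_K (s / 2) (of_real (2 * pi * a * x)) * f_kernel x s)
      = (\<integral>t. \<Phi> t \<partial>lborel)"
proof -
  let ?L = "\<lambda>x. bessel_K (s / 2) (of_real (2 * pi * a * x)) * f_kernel x s"
  \<comment> \<open>\<open>bessel_K_int\<close> at h is K at 2 h, and 2 pi a x = 2 (b x).\<close>
  define b where "b = pi * a"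
  have b: "b > 0" using a by (simp add: b_def)
  define L where "L x = bessel_K_int (s / 2) (b * x) * f_integral x s" for x
  have L: "?L x = L x" if "x \<in> {0<..}" for x
  proof -
    have x: "x > 0" using that by simp
    have "2 * pi * a * x = 2 * (b * x)" by (simp add: b_def)
    moreover have "bessel_K (s / 2) (of_real (2 * (b * x))) = bessel_K_int (s / 2) (b * x)"
      using b x s by (intro bessel_K_eq_int) auto
    ultimately show ?thesis unfolding L_def by (simp only: f_kernel_eq_integral[OF s x])
  qed
  define k where "k t = zeta_kernel s (Complex (1 / 2) t) / (4 * of_real pi)" for t
  define B where "B u = exp (1 / 2 * of_real u) * bessel_K_int (s / 2) (b * exp u)" for u
  define G where "G t = 1 / 4 * exp (- Complex (1 / 2) t * of_real (ln b)) * Gamma ((Complex (1 / 2) t + s / 2) / 2)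
    * Gamma ((Complex (1 / 2) t - s / 2) / 2)" for t
  have k: "integrable lborel k" unfolding k_def using zeta_kernel_line_integrable[OF s] by simp
  have m: "has_bochner_integral lborel (\<lambda>u. exp (w * of_real u) * bessel_K_int (s / 2) (b * exp u))
    (1 / 4 * exp (- w * of_real (ln b)) * Gamma ((w + s / 2) / 2) * Gamma ((w - s / 2) / 2))" if "Re w = 1 / 2" for w
    using b s that by (intro has_bochner_integral_bessel_K_int_mellin) auto
  have B: "integrable lborel B"
    unfolding B_def using m[of "1 / 2"] by (simp add: has_bochner_integral_iff)
  have eB: "exp (\<i> * of_real (t * u)) * exp (1 / 2 * of_real u) = exp (Complex (1 / 2) t * of_real u)" for t u
    unfolding exp_add[symmetric] Complex_eq_of_real by (rule arg_cong[of _ _ exp]) (simp add: algebra_simps)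
  have G: "has_bochner_integral lborel (\<lambda>u. exp (\<i> * of_real (t * u)) * B u) (G t)" for t
    unfolding B_def G_def mult.assoc[symmetric, of "exp (\<i> * of_real (t * _))"] eB using m[of "Complex (1 / 2) t"] by simp
  have kG: "k t * G t = exp (- 1 / 2 * of_real (ln a)) * \<Phi> t" for t
  proof -
    let ?w = "Complex (1 / 2) t"
    have lb: "ln b = ln pi + ln a" unfolding b_def using a by (simp add: ln_mult)
    have "exp (- ?w * of_real (ln b)) = exp (- ((?w + s / 2) / 2) * of_real (ln pi)) * exp (- ((?w - s / 2) / 2) * of_real (ln pi))
        * (exp (- 1 / 2 * of_real (ln a)) * exp (\<i> * of_real (t * - ln a)))"
      unfolding exp_add[symmetric] lb Complex_eq_of_real by (rule arg_cong[of _ _ exp]) (simp add: field_simps)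
    then show ?thesis
      unfolding k_def G_def \<Phi>_def xi_kernel_def completed_zeta_def zeta_kernel_def by simp
  qed
  have I\<Phi>: "integrable lborel (\<lambda>t. exp (- 1 / 2 * complex_of_real (ln a)) * \<Phi> t)"
    using has_bochner_integral_fourier_swap(1)[OF k B G] unfolding kG .
  have "integrable lborel (\<lambda>t. exp (1 / 2 * complex_of_real (ln a)) * (exp (- 1 / 2 * complex_of_real (ln a)) * \<Phi> t))"
    by (rule integrable_mult_right) (rule I\<Phi>)
  then show "integrable lborel \<Phi>" by (simp add: mult.assoc[symmetric] exp_add[symmetric])
  have Lu: "(\<integral>t. k t * exp (\<i> * of_real (t * u)) \<partial>lborel) * B u = exp u *\<^sub>R L (exp u)" for u
  proof -
    have e: "exp ((Complex (1 / 2) t - 1) * of_real u) = exp (- 1 / 2 * of_real u) * exp (\<i> * of_real (t * u))" for t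
      unfolding exp_add[symmetric] Complex_eq_of_real by (rule arg_cong[of _ _ exp]) (simp add: algebra_simps)
    have "f_integral (exp u) s = (\<integral>t. exp (- 1 / 2 * of_real u) * (k t * exp (\<i> * of_real (t * u))) \<partial>lborel)"
      unfolding f_integral_def ln_exp e k_def integral_divide_zero[symmetric]
      by (intro Bochner_Integration.integral_cong) (simp_all add: mult_ac)
    also have "\<dots> = exp (- 1 / 2 * of_real u) * (\<integral>t. k t * exp (\<i> * of_real (t * u)) \<partial>lborel)"
      by (rule integral_mult_right_zero)
    finally have f: "f_integral (exp u) s = exp (- 1 / 2 * of_real u) * (\<integral>t. k t * exp (\<i> * of_real (t * u)) \<partial>lborel)" .
    have r: "complex_of_real (exp u) * exp (- 1 / 2 * of_real u) = exp (1 / 2 * of_real u)"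
      unfolding exp_of_real[symmetric] exp_add[symmetric] by (rule arg_cong[of _ _ exp]) (simp add: algebra_simps)
    show ?thesis unfolding L_def f B_def scaleR_conv_of_real r[symmetric] by (simp only: mult_ac)
  qed
  define J where "J = (\<integral>t. \<Phi> t \<partial>lborel)"
  have LJ: "has_bochner_integral lborel (\<lambda>u. exp u *\<^sub>R L (exp u)) (exp (- 1 / 2 * of_real (ln a)) * J)"
    using has_bochner_integral_fourier_swap(2)[OF k B G] unfolding Lu kG integral_mult_right_zero J_def[symmetric] .
  have "(\<lambda>u. exp u *\<^sub>R L (exp u)) \<in> borel_measurable borel"
    using borel_measurable_has_bochner_integral[OF LJ] by simp
  then have I: "L absolutely_integrable_on {0<..}" "integral {0<..} L = exp (- 1 / 2 * of_real (ln a)) * J"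
    using LJ has_bochner_integral_exp_substitution by blast+
  have "L integrable_on {0<..}" using I(1) by (rule set_lebesgue_integral_eq_integral(1))
  then show "?L integrable_on {0<..}" by (rule integrable_eq) (simp only: L)
  have "integral {0<..} ?L = exp (- 1 / 2 * of_real (ln a)) * J"
    unfolding I(2)[symmetric] by (rule integral_cong) (rule L)
  moreover have "complex_of_real (sqrt a) = exp (1 / 2 * of_real (ln a))"
  proof -
    have "sqrt a = exp (1 / 2 * ln a)" using a by (simp add: ln_sqrt[symmetric])
    then show ?thesis by (simp only: exp_of_real[symmetric] of_real_mult of_real_divide of_real_1 of_real_numeral)
  qed
  moreover have "exp (1 / 2 * complex_of_real (ln a)) * (exp (- 1 / 2 * of_real (ln a)) * J) = J"
    unfolding mult.assoc[symmetric] exp_add[symmetric] by simp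
  ultimately show "of_real (sqrt a) * integral {0<..} ?L = (\<integral>t. \<Phi> t \<partial>lborel)" unfolding J_def by simp
qed

lemma xi_kernel_cos_integral:
  assumes s: "-1 < Re s" "Re s < 1" and a: "a > 0"
  shows "has_bochner_integral lborel (\<lambda>t. xi_kernel s t * of_real (cos (t * ln a)))
    (\<integral>t. xi_kernel s t * exp (\<i> * of_real (t * - ln a)) \<partial>lborel)" (is "has_bochner_integral _ _ ?J")
proof -
  let ?\<Phi> = "\<lambda>t. xi_kernel s t * exp (\<i> * of_real (t * - ln a))"
  have 1: "has_bochner_integral lborel ?\<Phi> ?J"
    using bessel_f_kernel_integral(1)[OF s a] by (simp add: has_bochner_integral_iff)
  then have "has_bochner_integral lborel (\<lambda>t. ?\<Phi> (- t)) ?J"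
    using lborel_has_bochner_integral_real_affine_iff[of "-1" ?\<Phi> ?J 0] by simp
  from has_bochner_integral_mult_right[OF has_bochner_integral_add[OF 1 this], of "1 / 2"]
  have "has_bochner_integral lborel (\<lambda>t. 1 / 2 * (?\<Phi> t + ?\<Phi> (- t))) (1 / 2 * (?J + ?J))" .
  moreover have "1 / 2 * (?\<Phi> t + ?\<Phi> (- t)) = xi_kernel s t * of_real (cos (t * ln a))" for t
    unfolding xi_kernel_even[OF s] cos_of_real[symmetric] cos_exp_eq by (simp add: field_simps)
  moreover have "1 / 2 * (?J + ?J) = ?J" by simp
  ultimately show ?thesis by (simp only:)
qed

text \<open>In terms of the two zeta arguments p and q, t^2 + (s + 1)^2 = 4 p (1 - q). This cancels
  p and q - 1 among the four linear factors of the two Xi values; the remaining p - 1 and q complete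
  the Gamma factors to two reflection pairs.\<close>

lemma xi_kernel_Xi:
  assumes s: "-1 < Re s" "Re s < 1"
  shows "Gamma ((s - 1 + \<i> * of_real t) / 4) * Gamma ((s - 1 - \<i> * of_real t) / 4)
         * Gamma ((- s + 1 + \<i> * of_real t) / 4) * Gamma ((- s + 1 - \<i> * of_real t) / 4)
         * riemann_Xi ((of_real t - \<i> * s) / 2) * riemann_Xi ((of_real t + \<i> * s) / 2)
         * (C / ((of_real t)\<^sup>2 + (s + 1)\<^sup>2)) = 4 * of_real pi ^ 3 * (xi_kernel s (t / 2) * C)"
proof -
  \<comment> \<open>The variable of the Xi integral is twice that of the kernel, hence t /
    2.\<close>
  define p q where "p = Complex (1 / 2) (t / 2) + s / 2" and "q = Complex (1 / 2) (t / 2) - s / 2"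
  have re: "0 < Re p" "Re p < 1" "0 < Re q" "Re q < 1" unfolding p_def q_def using s by simp_all
  have st: "s = p - q" "\<i> * of_real t = p + q - 1" unfolding p_def q_def Complex_eq_of_real by simp_all
  have g: "(s - 1 + \<i> * of_real t) / 4 = (p - 1) / 2" "(s - 1 - \<i> * of_real t) / 4 = - (q / 2)"
    "(- s + 1 + \<i> * of_real t) / 4 = q / 2" "(- s + 1 - \<i> * of_real t) / 4 = (1 - p) / 2"
    unfolding st by (simp_all add: field_simps)
  have xp: "1 / 2 + \<i> * ((of_real t - \<i> * s) / 2) = p" "1 / 2 + \<i> * ((of_real t + \<i> * s) / 2) = q"
    unfolding p_def q_def Complex_eq_of_real by (simp_all add: algebra_simps diff_divide_distrib add_divide_distrib)
  have xi: "riemann_xi u = 1 / 2 * u * (u - 1) * completed_zeta u" for u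
  proof -
    have "of_real pi powr (- u / 2) = exp (- (u / 2) * of_real (ln pi))" by (subst of_real_powr_eq_exp) simp_all
    then show ?thesis unfolding riemann_xi_def completed_zeta_def by (simp only: mult_ac)
  qed
  have den: "(of_real t)\<^sup>2 + (s + 1)\<^sup>2 = 4 * p * (1 - q)"
  proof -
    have "(of_real t :: complex)\<^sup>2 = - (\<i> * of_real t)\<^sup>2" by (simp add: power_mult_distrib)
    then show ?thesis unfolding st by (simp add: power2_eq_square algebra_simps)
  qed
  have nz: "p \<noteq> 0" "1 - q \<noteq> 0" using re by (auto simp: complex_eq_iff)
  have np: "z \<notin> \<int>\<^sub>\<le>\<^sub>0" if "-1 < Re z" "Re z < 0" for z :: complex
    using that by (auto elim!: nonpos_Ints_cases)
  have G1: "Gamma ((p - 1) / 2 + 1) = (p - 1) / 2 * Gamma ((p - 1) / 2)"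
    using re by (intro Gamma_plus1 np) simp_all
  have p1: "(p - 1) / 2 + 1 = (1 + p) / 2" by (simp add: field_simps)
  have g1: "(p - 1) / 2 * Gamma ((p - 1) / 2) * Gamma ((1 - p) / 2) = of_real pi / cos (of_real pi * p / 2)"
    unfolding G1[symmetric] p1 by (rule Gamma_half_reflection)
  have "Gamma (- (q / 2) + 1) = - (q / 2) * Gamma (- (q / 2))"
    using re by (intro Gamma_plus1 np) simp_all
  then have g2: "Gamma (q / 2) * (- (q / 2) * Gamma (- (q / 2))) = of_real pi / sin (of_real pi * q / 2)"
    using Gamma_reflection_complex[of "q / 2"] by simp
  have x16: "xi_kernel s (t / 2) = completed_zeta p * completed_zeta q * (1 / (cos (of_real pi * p / 2) * sin (of_real pi * q / 2))) / (16 * of_real pi)"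
    unfolding xi_kernel_def trig_kernel_def p_def q_def ..
  have "Gamma ((p - 1) / 2) * Gamma (- (q / 2)) * Gamma (q / 2) * Gamma ((1 - p) / 2)
      * (1 / 2 * p * (p - 1) * completed_zeta p) * (1 / 2 * q * (q - 1) * completed_zeta q) * (C / (4 * p * (1 - q)))
    = 1 / 4 * ((p - 1) / 2 * Gamma ((p - 1) / 2) * Gamma ((1 - p) / 2)) * (Gamma (q / 2) * (- (q / 2) * Gamma (- (q / 2))))
      * (completed_zeta p * completed_zeta q * C)"
  proof -
    have "A * B' * A' * D * (1 / 2 * p * (p - 1) * l) * (1 / 2 * q * (q - 1) * l') * (C / (4 * p * (1 - q)))
      = 1 / 4 * ((p - 1) / 2 * A * D) * (A' * (- (q / 2) * B')) * (l * l' * C)" for A B' A' D l l'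
    proof -
      have q1: "q - 1 = - (1 - q)" by simp
      have pq: "p * (1 - q) \<noteq> 0" using nz by (intro no_zero_divisors)
      have "C / (4 * p * (1 - q)) * (p * (1 - q)) = C / 4"
      proof -
        have "C / (4 * z) * z = C / 4" if "z \<noteq> 0" for z using that by simp
        from this[OF pq] show ?thesis by (simp only: mult.assoc)
      qed
      have "A * B' * A' * D * (1 / 2 * p * (p - 1) * l) * (1 / 2 * q * (q - 1) * l') * (C / (4 * p * (1 - q)))
        = - (1 / 4) * (A * B' * A' * D * (p - 1) * l * q * l') * (C / (4 * p * (1 - q)) * (p * (1 - q)))"
        unfolding q1 by (simp only: mult_minus_left mult_minus_right times_divide_eq_left times_divide_eq_right mult_1_left) (simp add: mult_ac)
      also have "\<dots> = 1 / 4 * ((p - 1) / 2 * A * D) * (A' * (- (q / 2) * B')) * (l * l' * C)"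
        unfolding \<open>C / (4 * p * (1 - q)) * (p * (1 - q)) = C / 4\<close> by (simp add: mult_ac)
      finally show ?thesis .
    qed
    then show ?thesis .
  qed
  also have "\<dots> = 4 * of_real pi ^ 3 * (xi_kernel s (t / 2) * C)"
    unfolding g1 g2 x16 by (simp add: power3_eq_cube mult_ac)
  finally show ?thesis unfolding g riemann_Xi_def xp xi den .
qed

theorem theorem15p6:
  fixes s :: complex and \<alpha> \<beta> :: real
  assumes "-1 < Re s" and "Re s < 1"
    and "\<alpha> > 0" and "\<beta> > 0" and "\<alpha> * \<beta> = 1"
  defines "L \<equiv> \<lambda>(a::real) (x::real). bessel_K (s / 2) (of_real (2 * pi * a * x)) * f_kernel x s"
    and "R \<equiv> \<lambda>t::real.
           Gamma ((s - 1 + \<i> * of_real t) / 4) * Gamma ((s - 1 - \<i> * of_real t) / 4)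
         * Gamma ((- s + 1 + \<i> * of_real t) / 4) * Gamma ((- s + 1 - \<i> * of_real t) / 4)
         * riemann_Xi ((of_real t - \<i> * s) / 2) * riemann_Xi ((of_real t + \<i> * s) / 2)
         * (of_real (cos (t * ln \<alpha> / 2)) / ((of_real t)\<^sup>2 + (s + 1)\<^sup>2))"
  shows "L \<alpha> integrable_on {0<..} \<and> L \<beta> integrable_on {0<..} \<and> R integrable_on {0<..} \<and>
    of_real (sqrt \<alpha>) * integral {0<..} (L \<alpha>) = of_real (sqrt \<beta>) * integral {0<..} (L \<beta>) \<and>
    of_real (sqrt \<beta>) * integral {0<..} (L \<beta>)
      = 1 / (4 * (of_real pi) ^ 3) * integral {0<..} R"
proof -
  note s = assms(1,2)
  define J where "J = (\<integral>t. xi_kernel s t * of_real (cos (t * ln \<alpha>)) \<partial>lborel)"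
  have cosJ: "has_bochner_integral lborel (\<lambda>t. xi_kernel s t * of_real (cos (t * ln \<alpha>))) J"
    using xi_kernel_cos_integral[OF s assms(3)] unfolding J_def by (auto simp: has_bochner_integral_iff)
  have ln\<beta>: "ln \<beta> = - ln \<alpha>"
    using assms(3-5) ln_mult[of \<alpha> \<beta>] by simp
  have cos\<beta>: "cos (t * ln \<beta>) = cos (t * ln \<alpha>)" for t unfolding ln\<beta> by simp
  have L\<alpha>: "of_real (sqrt \<alpha>) * integral {0<..} (L \<alpha>) = J"
    unfolding L_def bessel_f_kernel_integral(3)[OF s assms(3)]
    using xi_kernel_cos_integral[OF s assms(3)] unfolding J_def by (simp add: has_bochner_integral_iff)
  have L\<beta>: "of_real (sqrt \<beta>) * integral {0<..} (L \<beta>) = J"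
    unfolding L_def bessel_f_kernel_integral(3)[OF s assms(4)]
    using xi_kernel_cos_integral[OF s assms(4)] unfolding J_def cos\<beta> by (simp add: has_bochner_integral_iff)
  define E where "E t = 4 * of_real pi ^ 3 * (xi_kernel s (t / 2) * of_real (cos (t * ln \<alpha> / 2)))" for t
  have RE: "R = E" unfolding R_def E_def by (rule ext) (rule xi_kernel_Xi[OF s])
  \<comment> \<open>Rescaling t to t / 2 doubles the integral, and restricting the even integrand to
    t > 0 halves it, so the constant 4 pi^3 is the one that remains.\<close>
  have "has_bochner_integral lborel (\<lambda>t. xi_kernel s (0 + 1 / 2 * t) * of_real (cos ((0 + 1 / 2 * t) * ln \<alpha>))) (J /\<^sub>R \<bar>1 / 2\<bar>)"
    using lborel_has_bochner_integral_real_affine_iff[of "1 / 2" "\<lambda>t. xi_kernel s t * of_real (cos (t * ln \<alpha>))" J 0] cosJ by simp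
  then have "has_bochner_integral lborel (\<lambda>t. xi_kernel s (t / 2) * of_real (cos (t * ln \<alpha> / 2))) (2 * J)"
    by (simp add: scaleR_conv_of_real)
  then have "has_bochner_integral lborel E (4 * of_real pi ^ 3 * (2 * J))"
    unfolding E_def by (rule has_bochner_integral_mult_right)
  moreover have "E (- t) = E t" for t unfolding E_def using xi_kernel_even[OF s, of "t / 2"] by simp
  ultimately have "(E has_integral 4 * of_real pi ^ 3 * (2 * J) / 2) {0<..}"
    by (rule has_integral_even_half_line)
  then have R: "R integrable_on {0<..}" "integral {0<..} R = 4 * of_real pi ^ 3 * J"
    unfolding RE by (auto simp: integral_unique has_integral_integrable)
  have "1 / (4 * (of_real pi) ^ 3) * integral {0<..} R = J" unfolding R(2) by simp
  moreover have "L \<alpha> integrable_on {0<..}" "L \<beta> integrable_on {0<..}"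
    unfolding L_def by (rule bessel_f_kernel_integral(2)[OF s]; fact)+
  ultimately show ?thesis using L\<alpha> L\<beta> R(1) by simp
qed

end
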